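(* Let $a,b$ be positive integers with $a<b$. (i) When $b\ge2$, there exists a smooth function $f$ belonging to the case (B) (with these $a,b$) such that $m_0(f)=1/b$. (ii) When $a\ge2$, there exists a smooth function $f$ belonging to the case (C) (with these $a,b$) such that $m_0(f)=1/a$. (iii) When $a\ge2$, there exists a smooth function $f$ belonging to the case (D) (with these $a,b$) such that $m_0(f)=1/b$.
   Context: Let $U$ be a sufficiently small open neighborhood of the origin in $\mathbb{R}^2$. A smooth function defined near the origin is flat at the origin if all its derivatives vanish there. A real-valued smooth function $f$ on $U$ with $f(0,0)=0$, $\nabla f(0,0)=0$ belongs, on $U$, to case (B) if $f(x,y)=v(x,y)x^ay^b+g(x,y)$; case (C) if $f(x,y)=v(x,y)x^ay^b+h(x,y)$; case (D) if $f(x,y)=v(x,y)x^ay^b+g(x,y)+h(x,y)$, where $v,g,h$ are smooth on $U$, $v(0,0)\neq0$, and $g,h$ are non-zero flat functions of the forms $g(x,y)=\sum_{j=0}^{b-1}y^jg_j(x)$, $h(x,y)=\sum_{j=0}^{a-1}x^jh_j(y)$ with $g_j,h_j$ flat at the origin. For $\varphi\in C_0^\infty(U)$ (smooth, compact support in $U$, real-valued), $Z_f(\varphi)(s)=\int_{\mathbb{R}^2}|f(x,y)|^s\varphi(x,y)\,dx\,dy$, holomorphic on $\mathrm{Re}(s)>0$. Put $$m_0(f,\varphi):=\sup\{\rho>0: Z_f(\varphi)\text{ can be meromorphically continued to a domain containing } \mathrm{Re}(s)>-\rho\},$$ $$m_0(f):=\inf\{m_0(f,\varphi):\varphi\in C_0^\infty(U)\}.$$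 *)

theory Defs
  imports "HOL-Complex_Analysis.Complex_Analysis" "HOL-Library.Extended_Nonnegative_Real"
begin

section \<open>Smooth and flat functions\<close>

text \<open>
  The iterated directional derivative of \<open>f\<close> along a list of vectors. With the vectors taken
  from the standard basis these are the partial derivatives of all orders (the empty list gives
  \<open>f\<close> itself); on the real line, the direction 1 gives the usual derivative.
\<close>

primrec iter_deriv ::
  "'a::real_normed_vector list \<Rightarrow> ('a \<Rightarrow> 'b::real_normed_vector) \<Rightarrow> 'a \<Rightarrow> 'b" where
  "iter_deriv [] f = f"
| "iter_deriv (w # ws) f = (\<lambda>x. frechet_derivative (iter_deriv ws f) (at x) w)"

definition smooth_on ::
  "'a::real_normed_vector set \<Rightarrow> ('a \<Rightarrow> 'b::real_normed_vector) \<Rightarrow> bool" where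
  "smooth_on U f \<longleftrightarrow> open U \<and> (\<forall>ws. \<forall>x\<in>U. iter_deriv ws f differentiable (at x))"

text \<open>
  The derivative of order zero is included: a flat function vanishes at the point. The notion is
  meaningful for functions that are smooth near \<open>x\<close>.
\<close>

definition flat_at :: "'a::real_normed_vector \<Rightarrow> ('a \<Rightarrow> 'b::real_normed_vector) \<Rightarrow> bool" where
  "flat_at x f \<longleftrightarrow> (\<forall>ws. iter_deriv ws f x = 0)"

text \<open>
  Elements of $C_0^\infty(U)$ are extended by zero to the whole space.
\<close>

definition test_functions :: "'a::real_normed_vector set \<Rightarrow> ('a \<Rightarrow> real) set" where
  "test_functions U =
     {\<phi>. smooth_on UNIV \<phi> \<and> compact (closure {z. \<phi> z \<noteq> 0}) \<and> closure {z. \<phi> z \<noteq> 0} \<subseteq> U}"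


section \<open>The classes of functions\<close>

text \<open>
  Functions on \<open>U\<close> are total functions of which only the values on \<open>U\<close> matter. The functions of
  one variable in the sums below live on the projections of \<open>U\<close> to the coordinate axes.
\<close>

definition singular_at_origin :: "(real \<times> real) set \<Rightarrow> (real \<times> real \<Rightarrow> real) \<Rightarrow> bool" where
  "singular_at_origin U f \<longleftrightarrow>
     smooth_on U f \<and> f (0, 0) = 0 \<and> (f has_derivative (\<lambda>_. 0)) (at (0, 0))"

definition flat_in_x :: "nat \<Rightarrow> (real \<times> real) set \<Rightarrow> (real \<times> real \<Rightarrow> real) \<Rightarrow> bool" where
  "flat_in_x b U g \<longleftrightarrow>
     smooth_on U g \<and> flat_at (0, 0) g \<and> (\<exists>z\<in>U. g z \<noteq> 0) \<and>
     (\<exists>gs :: nat \<Rightarrow> real \<Rightarrow> real.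
        (\<forall>j<b. smooth_on (fst ` U) (gs j) \<and> flat_at 0 (gs j)) \<and>
        (\<forall>(x, y)\<in>U. g (x, y) = (\<Sum>j<b. y ^ j * gs j x)))"

definition flat_in_y :: "nat \<Rightarrow> (real \<times> real) set \<Rightarrow> (real \<times> real \<Rightarrow> real) \<Rightarrow> bool" where
  "flat_in_y a U h \<longleftrightarrow>
     smooth_on U h \<and> flat_at (0, 0) h \<and> (\<exists>z\<in>U. h z \<noteq> 0) \<and>
     (\<exists>hs :: nat \<Rightarrow> real \<Rightarrow> real.
        (\<forall>j<a. smooth_on (snd ` U) (hs j) \<and> flat_at 0 (hs j)) \<and>
        (\<forall>(x, y)\<in>U. h (x, y) = (\<Sum>j<a. x ^ j * hs j y)))"

definition case_B :: "nat \<Rightarrow> nat \<Rightarrow> (real \<times> real) set \<Rightarrow> (real \<times> real \<Rightarrow> real) \<Rightarrow> bool" where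
  "case_B a b U f \<longleftrightarrow> singular_at_origin U f \<and>
     (\<exists>v g. smooth_on U v \<and> v (0, 0) \<noteq> 0 \<and> flat_in_x b U g \<and>
        (\<forall>(x, y)\<in>U. f (x, y) = v (x, y) * x ^ a * y ^ b + g (x, y)))"

definition case_C :: "nat \<Rightarrow> nat \<Rightarrow> (real \<times> real) set \<Rightarrow> (real \<times> real \<Rightarrow> real) \<Rightarrow> bool" where
  "case_C a b U f \<longleftrightarrow> singular_at_origin U f \<and>
     (\<exists>v h. smooth_on U v \<and> v (0, 0) \<noteq> 0 \<and> flat_in_y a U h \<and>
        (\<forall>(x, y)\<in>U. f (x, y) = v (x, y) * x ^ a * y ^ b + h (x, y)))"

definition case_D :: "nat \<Rightarrow> nat \<Rightarrow> (real \<times> real) set \<Rightarrow> (real \<times> real \<Rightarrow> real) \<Rightarrow> bool" where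
  "case_D a b U f \<longleftrightarrow> singular_at_origin U f \<and>
     (\<exists>v g h. smooth_on U v \<and> v (0, 0) \<noteq> 0 \<and> flat_in_x b U g \<and> flat_in_y a U h \<and>
        (\<forall>(x, y)\<in>U. f (x, y) = v (x, y) * x ^ a * y ^ b + g (x, y) + h (x, y)))"


section \<open>Local zeta functions\<close>

definition local_zeta ::
  "(real \<times> real \<Rightarrow> real) \<Rightarrow> (real \<times> real \<Rightarrow> real) \<Rightarrow> complex \<Rightarrow> complex" where
  "local_zeta f \<phi> s = (LINT z|lborel. complex_of_real \<bar>f z\<bar> powr s * complex_of_real (\<phi> z))"

text \<open>
  Only the values of the local zeta function on the half-plane \<open>Re s > 0\<close> are used, since the
  Bochner integral has a default value where the integrand is not integrable.
\<close>

definition zeta_continues ::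
  "(real \<times> real \<Rightarrow> real) \<Rightarrow> (real \<times> real \<Rightarrow> real) \<Rightarrow> real \<Rightarrow> bool" where
  "zeta_continues f \<phi> \<rho> \<longleftrightarrow>
     (\<exists>D F. open D \<and> connected D \<and> {s. Re s > - \<rho>} \<subseteq> D \<and> F meromorphic_on D \<and>
        (\<forall>s. Re s > 0 \<longrightarrow> F s = local_zeta f \<phi> s))"

text \<open>
  The value can be infinite; a supremum over the empty set is 0.
\<close>

definition m0_at :: "(real \<times> real \<Rightarrow> real) \<Rightarrow> (real \<times> real \<Rightarrow> real) \<Rightarrow> ennreal" where
  "m0_at f \<phi> = Sup (ennreal ` {\<rho>. \<rho> > 0 \<and> zeta_continues f \<phi> \<rho>})"

definition m0 :: "(real \<times> real) set \<Rightarrow> (real \<times> real \<Rightarrow> real) \<Rightarrow> ennreal" where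
  "m0 U f = Inf (m0_at f ` test_functions U)"

text \<open>
  ``For every sufficiently small open neighbourhood \<open>U\<close> of the origin''; the bound \<open>U0\<close> may depend
  on the function under consideration.
\<close>

definition for_small_nhds :: "((real \<times> real) set \<Rightarrow> bool) \<Rightarrow> bool" where
  "for_small_nhds P \<longleftrightarrow>
     (\<exists>U0. open U0 \<and> (0, 0) \<in> U0 \<and> (\<forall>U. open U \<and> (0, 0) \<in> U \<and> U \<subseteq> U0 \<longrightarrow> P U))"

end

theory Submission
  imports Defs
begin

text \<open>
  Write \<open>e(t) = exp (- |t| ^ - k)\<close>, a function that is smooth, positive off the origin and flat
  at it. The examples are
  \<open>f = x ^ a y ^ b + x ^ a y ^ (b - 2) e(x)\<close> for case (B),
  \<open>f = x ^ a y ^ b + x ^ (a - 2) y ^ b e(y)\<close> for case (C), and the sum of all three terms for case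
  (D). Membership in the cases is read off with \<open>v = 1\<close>.

  In each example let \<open>u\<close> be the variable in which the flat term loses two powers, let \<open>w\<close> be the
  other one, and let \<open>m\<close> and \<open>n\<close> be their exponents in the monomial; in case (D), where each variable
  has such a term, \<open>u = y\<close>. The value to be found is \<open>1 / m\<close>.
  The summands have equal signs (the exponents differ by even numbers), so \<open>|f|\<close> is the sum of
  their absolute values and is bounded below by each of them.

  Upper bound. Test against \<open>w ^ (2 n)\<close> times a bump. The weight makes the integral over \<open>w\<close> harmless,
  and by domination by \<open>|w| ^ n |u| ^ m\<close> the zeta function \<open>Z\<close> is holomorphic for \<open>Re s > - 1 / m\<close>.
  At \<open>s = - 1 / m\<close> the inner integral behaves like the integral of \<open>1 / u\<close>, cut off at the scale
  \<open>u = sqrt e(w)\<close> below which the flat term dominates, so it is of size \<open>log (1 / e(w)) = |w| ^ - k\<close>.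
  With \<open>k = 2 n + 1\<close> this is not integrable against \<open>w ^ (2 n)\<close>, hence by Fatou's lemma \<open>Z\<close> is unbounded
  as \<open>s\<close> decreases to \<open>- 1 / m\<close>. On the other hand the cut-off makes the inner integral finite for every
  \<open>w \<noteq> 0\<close>, so that \<open>(s + 1 / m) Z(s)\<close> tends to 0. A function meromorphic at \<open>- 1 / m\<close> that is unbounded
  along a sequence has a pole there and grows at least like \<open>1 / |s + 1 / m|\<close>; so \<open>Z\<close> has no meromorphic
  continuation across the point. This is \<open>flat_perturbation_not_continuable\<close>.

  Lower bound. In cases (B) and (D), \<open>m = b\<close> is the larger exponent, and domination by \<open>|x| ^ a |y| ^ b\<close>
  already gives holomorphy for \<open>Re s > - 1 / b\<close> with any test function (\<open>local_zeta_holomorphic\<close>). In case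
  (C), \<open>m = a\<close>, and the poles between \<open>- 1 / b\<close> and \<open>- 1 / a\<close> have to be crossed. There the zeta function of
  \<open>f\<close> is compared with that of the monomial. The difference of the integrands gains a small power of
  \<open>e(y) / x ^ 2\<close>, which pays for every negative power of \<open>y\<close>, so it contributes a holomorphic function
  (\<open>local_zeta_difference_holomorphic\<close>); the monomial is continued by integrating by parts \<open>b\<close> times in \<open>y\<close>
  (\<open>monomial_zeta_iterated_by_parts\<close>).

  All estimates are global, so the functions work on every open neighbourhood of the origin.
\<close>

section \<open>Calculus of smooth and flat functions\<close>

text \<open>
  Everything is done for functions smooth on the whole space, where iterated derivatives satisfy
  their defining recursion at every point; restriction to an open set is then trivial.
\<close>

lemma iter_deriv_append: "iter_deriv (ws @ vs) f = iter_deriv ws (iter_deriv vs f)"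
  by (induction ws) auto

lemma iter_deriv_single: "iter_deriv [w] f = (\<lambda>x. frechet_derivative f (at x) w)"
  by simp

lemma smooth_UNIV_imp_smooth_on: "smooth_on UNIV f \<Longrightarrow> open U \<Longrightarrow> smooth_on U f"
  by (simp add: smooth_on_def)

lemma smooth_imp_differentiable: "smooth_on UNIV f \<Longrightarrow> f differentiable (at x)"
  using iter_deriv.simps(1)[of f] by (metis UNIV_I smooth_on_def)

lemma smooth_imp_has_derivative:
  "smooth_on UNIV f \<Longrightarrow> (f has_derivative frechet_derivative f (at x)) (at x)"
  using smooth_imp_differentiable frechet_derivative_works by blast

lemma smooth_imp_continuous_on: "smooth_on UNIV f \<Longrightarrow> continuous_on A f"
  by (meson continuous_at_imp_continuous_on differentiable_imp_continuous_within smooth_imp_differentiable)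

lemma smooth_partial_derivative:
  "smooth_on UNIV f \<Longrightarrow> smooth_on UNIV (\<lambda>x. frechet_derivative f (at x) w)"
  unfolding smooth_on_def iter_deriv_single[symmetric] iter_deriv_append[symmetric] by blast

lemma flat_partial_derivative:
  "flat_at z f \<Longrightarrow> flat_at z (\<lambda>x. frechet_derivative f (at x) w)"
  unfolding flat_at_def iter_deriv_single[symmetric] iter_deriv_append[symmetric] by blast

lemma flat_imp_zero: "flat_at z f \<Longrightarrow> f z = 0"
  using iter_deriv.simps(1) unfolding flat_at_def by metis

text \<open>
  Smoothness and flatness refer to derivatives of all orders. They are obtained without formulas for
  these by exhibiting a family of functions that is closed under directional derivatives.
\<close>

lemma iter_deriv_in_closed_family:
  assumes "f \<in> F" and "\<And>g w. g \<in> F \<Longrightarrow> (\<lambda>x. frechet_derivative g (at x) w) \<in> F"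
  shows "iter_deriv ws f \<in> F"
  using assms by (induction ws) auto

lemma smooth_by_closed_family:
  assumes "f \<in> F" and "\<And>g w. g \<in> F \<Longrightarrow> (\<lambda>x. frechet_derivative g (at x) w) \<in> F"
    and "\<And>g x. g \<in> F \<Longrightarrow> g differentiable (at x)"
  shows "smooth_on UNIV f"
  using iter_deriv_in_closed_family[OF assms(1,2)] assms(3) by (auto simp: smooth_on_def)

lemma flat_by_closed_family:
  assumes "f \<in> F" and "\<And>g w. g \<in> F \<Longrightarrow> (\<lambda>x. frechet_derivative g (at x) w) \<in> F"
    and "\<And>g. g \<in> F \<Longrightarrow> g z = 0"
  shows "flat_at z f"
  using iter_deriv_in_closed_family[OF assms(1,2)] assms(3) by (auto simp: flat_at_def)

lemma iter_deriv_add: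
  assumes "smooth_on UNIV f" "smooth_on UNIV g"
  shows "iter_deriv ws (\<lambda>x. f x + g x) = (\<lambda>x. iter_deriv ws f x + iter_deriv ws g x)"
proof (induction ws)
  case (Cons w ws)
  have "iter_deriv ws f differentiable (at x)" "iter_deriv ws g differentiable (at x)" for x
    using assms by (auto simp: smooth_on_def)
  then have "((\<lambda>x. iter_deriv ws f x + iter_deriv ws g x) has_derivative
      (\<lambda>h. frechet_derivative (iter_deriv ws f) (at x) h
        + frechet_derivative (iter_deriv ws g) (at x) h)) (at x)" for x
    by (auto intro!: has_derivative_add simp: frechet_derivative_works)
  then have "frechet_derivative (\<lambda>x. iter_deriv ws f x + iter_deriv ws g x) (at x)
     = (\<lambda>h. frechet_derivative (iter_deriv ws f) (at x) h
        + frechet_derivative (iter_deriv ws g) (at x) h)" for x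
    using frechet_derivative_at by metis
  then show ?case using Cons by simp
qed simp

lemma smooth_add:
  "smooth_on UNIV f \<Longrightarrow> smooth_on UNIV g \<Longrightarrow> smooth_on UNIV (\<lambda>x. f x + g x)"
  by (simp add: smooth_on_def iter_deriv_add[unfolded smooth_on_def])

lemma flat_add:
  "smooth_on UNIV f \<Longrightarrow> smooth_on UNIV g \<Longrightarrow> flat_at z f \<Longrightarrow> flat_at z g
     \<Longrightarrow> flat_at z (\<lambda>x. f x + g x)"
  by (simp add: flat_at_def iter_deriv_add)

lemma iter_deriv_affine:
  assumes "smooth_on UNIV f" "bounded_linear A"
  shows "iter_deriv ws (\<lambda>z. f (A z + c)) = (\<lambda>z. iter_deriv (map A ws) f (A z + c))"
proof (induction ws)
  case (Cons w ws)
  let ?g = "iter_deriv (map A ws) f"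
  have "(?g has_derivative frechet_derivative ?g (at x)) (at x)" for x
    using assms(1) by (auto simp: smooth_on_def frechet_derivative_works)
  moreover have "((\<lambda>z. A z + c) has_derivative A) (at z)" for z
    using bounded_linear_imp_has_derivative[OF assms(2)] by (auto intro!: derivative_eq_intros)
  ultimately have "((\<lambda>z. ?g (A z + c)) has_derivative
      (\<lambda>h. frechet_derivative ?g (at (A z + c)) (A h))) (at z)" for z
    using has_derivative_compose by fast
  then have "frechet_derivative (\<lambda>z. ?g (A z + c)) (at z)
      = (\<lambda>h. frechet_derivative ?g (at (A z + c)) (A h))" for z
    using frechet_derivative_at by metis
  then show ?case using Cons by simp
qed simp

lemma smooth_affine_compose:
  assumes "smooth_on UNIV f" "bounded_linear A"
  shows "smooth_on UNIV (\<lambda>z. f (A z + c))"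
  unfolding smooth_on_def iter_deriv_affine[OF assms]
proof (intro conjI allI ballI open_UNIV)
  fix ws z
  have "(\<lambda>z. A z + c) differentiable (at z)"
    using bounded_linear_imp_differentiable[OF assms(2)] by (intro differentiable_add) auto
  then show "(\<lambda>z. iter_deriv (map A ws) f (A z + c)) differentiable (at z)"
    using assms(1) differentiable_chain_at[of "\<lambda>z. A z + c" z "iter_deriv (map A ws) f"]
    by (auto simp: smooth_on_def o_def)
qed

lemma flat_affine_compose:
  assumes "smooth_on UNIV f" "bounded_linear A" "flat_at (A z + c) f"
  shows "flat_at z (\<lambda>z. f (A z + c))"
  using assms(3) unfolding flat_at_def iter_deriv_affine[OF assms(1,2)] by auto

lemma smooth_affine:
  assumes "bounded_linear A"
  shows "smooth_on UNIV (\<lambda>z. A z + c)"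
proof (rule smooth_by_closed_family[where F = "{\<lambda>z. A z + c | A c. bounded_linear A}"])
  fix g w x assume "g \<in> {\<lambda>z. A z + c | A c. bounded_linear (A :: 'a \<Rightarrow> 'b)}"
  then obtain A c where g: "g = (\<lambda>z. A z + c)" and A: "bounded_linear A" by blast
  have d: "(g has_derivative A) (at z)" for z
    using bounded_linear_imp_has_derivative[OF A] unfolding g by (auto intro!: derivative_eq_intros)
  then show "g differentiable (at x)" unfolding differentiable_def by blast
  from d have "(\<lambda>x. frechet_derivative g (at x) w) = (\<lambda>z. 0 + A w)"
    using frechet_derivative_at by fastforce
  then show "(\<lambda>x. frechet_derivative g (at x) w) \<in> {\<lambda>z. A z + c | A c. bounded_linear (A :: 'a \<Rightarrow> 'b)}"
    by (auto intro!: exI[of _ "\<lambda>_. 0"] bounded_linear_zero exI[of _ "A w"])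
qed (use assms in blast)

lemma smooth_const: "smooth_on UNIV (\<lambda>_. c)"
  using smooth_affine[OF bounded_linear_zero, of c] by simp

lemma flat_zero: "flat_at z (\<lambda>_. 0)"
proof (rule flat_by_closed_family[of _ "{\<lambda>_. 0}"])
  show "(\<lambda>x. frechet_derivative g (at x) w) \<in> {\<lambda>_. 0}" if "g \<in> {\<lambda>_. 0}" for g w
    using that by (simp add: frechet_derivative_const)
qed auto

text \<open>
  By the Leibniz rule, the sums of products of members of two derivative-closed families form a
  derivative-closed family.
\<close>

inductive_set product_span ::
  "('a::real_normed_vector \<Rightarrow> real) set \<Rightarrow> ('a \<Rightarrow> real) set \<Rightarrow> ('a \<Rightarrow> real) set"
  for F G where
  product: "f \<in> F \<Longrightarrow> g \<in> G \<Longrightarrow> (\<lambda>x. f x * g x) \<in> product_span F G"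
| sum: "p \<in> product_span F G \<Longrightarrow> q \<in> product_span F G \<Longrightarrow> (\<lambda>x. p x + q x) \<in> product_span F G"

lemma product_span_closed:
  assumes p: "p \<in> product_span F G"
    and F: "\<And>f w. f \<in> F \<Longrightarrow> (\<lambda>x. frechet_derivative f (at x) w) \<in> F"
      "\<And>f x. f \<in> F \<Longrightarrow> f differentiable (at x)"
    and G: "\<And>f w. f \<in> G \<Longrightarrow> (\<lambda>x. frechet_derivative f (at x) w) \<in> G"
      "\<And>f x. f \<in> G \<Longrightarrow> f differentiable (at x)"
  shows "(\<lambda>x. frechet_derivative p (at x) w) \<in> product_span F G \<and> (\<forall>x. p differentiable (at x))"
  using p
proof induction
  case (product f g)
  let ?d = "\<lambda>x. \<lambda>h. f x * frechet_derivative g (at x) h + frechet_derivative f (at x) h * g x"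
  have d: "((\<lambda>x. f x * g x) has_derivative ?d x) (at x)" for x
    using F(2)[OF product(1)] G(2)[OF product(2)]
    by (intro has_derivative_mult) (auto simp: frechet_derivative_works)
  then have "frechet_derivative (\<lambda>x. f x * g x) (at x) = ?d x" for x
    using frechet_derivative_at by metis
  moreover have "(\<lambda>x. ?d x w) \<in> product_span F G"
    by (rule product_span.sum[OF product_span.product[OF product(1) G(1)[OF product(2)]]
          product_span.product[OF F(1)[OF product(1)] product(2)]])
  ultimately show ?case using d unfolding differentiable_def by auto
next
  case (sum p q)
  let ?d = "\<lambda>x. \<lambda>h. frechet_derivative p (at x) h + frechet_derivative q (at x) h"
  have d: "((\<lambda>x. p x + q x) has_derivative ?d x) (at x)" for x
    using sum by (intro has_derivative_add) (auto simp: frechet_derivative_works)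
  then have "frechet_derivative (\<lambda>x. p x + q x) (at x) = ?d x" for x
    using frechet_derivative_at by metis
  moreover have "(\<lambda>x. ?d x w) \<in> product_span F G"
    using sum product_span.sum by blast
  ultimately show ?case using d unfolding differentiable_def by auto
qed

lemma smooth_mult:
  fixes f g :: "'a::real_normed_vector \<Rightarrow> real"
  assumes "smooth_on UNIV f" "smooth_on UNIV g"
  shows "smooth_on UNIV (\<lambda>x. f x * g x)"
proof (rule smooth_by_closed_family)
  show "(\<lambda>x. f x * g x) \<in> product_span {h. smooth_on UNIV h} {h. smooth_on UNIV h}"
    using assms by (intro product_span.product) auto
qed (use product_span_closed[of _ "{h. smooth_on UNIV h}" "{h. smooth_on UNIV h}"]
      smooth_partial_derivative smooth_imp_differentiable in blast)+

text \<open>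
  Every function in the span of products of a flat and a smooth function vanishes at the point.
\<close>

lemma flat_mult:
  fixes f g :: "'a::real_normed_vector \<Rightarrow> real"
  assumes "smooth_on UNIV f" "flat_at z f" "smooth_on UNIV g"
  shows "flat_at z (\<lambda>x. f x * g x)"
proof (rule flat_by_closed_family)
  let ?F = "{h. smooth_on UNIV h \<and> flat_at z h}" and ?G = "{h. smooth_on UNIV h}"
  show "(\<lambda>x. f x * g x) \<in> product_span ?F ?G"
    using assms by (intro product_span.product) auto
  show "(\<lambda>x. frechet_derivative p (at x) w) \<in> product_span ?F ?G" if "p \<in> product_span ?F ?G" for p w
    using that product_span_closed[of p ?F ?G]
      smooth_partial_derivative smooth_imp_differentiable flat_partial_derivative by blast
  show "p z = 0" if "p \<in> product_span ?F ?G" for p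
    using that by (induction rule: product_span.induct) (auto dest: flat_imp_zero)
qed

lemma smooth_power:
  fixes f :: "'a::real_normed_vector \<Rightarrow> real"
  assumes "smooth_on UNIV f"
  shows "smooth_on UNIV (\<lambda>x. f x ^ n)"
  by (induction n) (auto intro: smooth_mult assms smooth_const)

lemma flat_imp_has_derivative_zero:
  assumes "smooth_on UNIV f" "flat_at z f"
  shows "(f has_derivative (\<lambda>_. 0)) (at z)"
proof -
  have "iter_deriv [w] f z = 0" for w using assms(2) unfolding flat_at_def by blast
  then have "frechet_derivative f (at z) = (\<lambda>_. 0)" by (auto simp: fun_eq_iff)
  then show ?thesis using smooth_imp_has_derivative[OF assms(1), of z] by simp
qed

lemma smooth_fst: "smooth_on UNIV (fst :: 'a::real_normed_vector \<times> 'b::real_normed_vector \<Rightarrow> 'a)"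
  using smooth_affine[OF bounded_linear_fst, of 0] by simp

lemma smooth_snd: "smooth_on UNIV (snd :: 'a::real_normed_vector \<times> 'b::real_normed_vector \<Rightarrow> 'b)"
  using smooth_affine[OF bounded_linear_snd, of 0] by simp

lemma smooth_ident: "smooth_on UNIV (\<lambda>x::'a::real_normed_vector. x)"
  using smooth_affine[OF bounded_linear_ident, of 0] by simp

lemma smooth_compose_fst: "smooth_on UNIV f \<Longrightarrow> smooth_on UNIV (\<lambda>z. f (fst z))"
  using smooth_affine_compose[OF _ bounded_linear_fst, of f 0] by simp

lemma smooth_compose_snd: "smooth_on UNIV f \<Longrightarrow> smooth_on UNIV (\<lambda>z. f (snd z))"
  using smooth_affine_compose[OF _ bounded_linear_snd, of f 0] by simp

lemma flat_compose_fst: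
  "smooth_on UNIV f \<Longrightarrow> flat_at (fst z) f \<Longrightarrow> flat_at z (\<lambda>z. f (fst z))"
  using flat_affine_compose[OF _ bounded_linear_fst, of f _ 0] by simp

lemma flat_compose_snd:
  "smooth_on UNIV f \<Longrightarrow> flat_at (snd z) f \<Longrightarrow> flat_at z (\<lambda>z. f (snd z))"
  using flat_affine_compose[OF _ bounded_linear_snd, of f _ 0] by simp

section \<open>A flat function and a bump function\<close>

text \<open>
  One-sided, with an arbitrary polynomial in \<open>1 / x\<close> as a factor, so that differentiation only
  changes the polynomial.
\<close>

definition flat_germ :: "nat \<Rightarrow> real poly \<Rightarrow> real \<Rightarrow> real" where
  "flat_germ k q x = (if x > 0 then poly q (inverse x) * exp (- (inverse x ^ k)) else 0)"

text \<open>
  In the variable \<open>t = 1 / x\<close> this is the differentiability of \<^const>\<open>flat_germ\<close> at 0.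
\<close>

lemma poly_mult_exp_tendsto_0:
  assumes "k \<ge> 1"
  shows "((\<lambda>t::real. poly q t * exp (- (t ^ k))) \<longlongrightarrow> 0) at_top"
proof -
  have 1: "((\<lambda>t::real. t ^ i * exp (- (t ^ k))) \<longlongrightarrow> 0) at_top" for i
  proof (rule Lim_null_comparison)
    show "\<forall>\<^sub>F t in at_top. norm (t ^ i * exp (- (t ^ k))) \<le> t ^ i / exp t"
      using eventually_ge_at_top[of "1::real"]
    proof eventually_elim
      case (elim t)
      then have "t \<le> t ^ k" using power_increasing[of 1 k t] assms by simp
      then have "t ^ i * exp (- (t ^ k)) \<le> t ^ i * exp (- t)"
        using elim by (intro mult_left_mono) auto
      then show ?case using elim by (simp add: exp_minus divide_inverse)
    qed
    show "((\<lambda>t::real. t ^ i / exp t) \<longlongrightarrow> 0) at_top" by (rule tendsto_power_div_exp_0)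
  qed
  have "((\<lambda>t::real. \<Sum>i\<le>degree q. coeff q i * (t ^ i * exp (- (t ^ k)))) \<longlongrightarrow> (\<Sum>i\<le>degree q. coeff q i * 0)) at_top"
    by (intro tendsto_intros 1)
  then show ?thesis by (simp add: poly_altdef sum_distrib_right mult.assoc)
qed

lemma flat_germ_has_derivative:
  assumes "k \<ge> 1"
  shows "(flat_germ k q has_real_derivative
    flat_germ k (monom (real k) (k + 1) * q - monom 1 2 * pderiv q) x) (at x)"
proof -
  consider "x > 0" | "x < 0" | "x = 0" by linarith
  then show ?thesis
  proof cases
    case 1
    have "((\<lambda>x. poly q (inverse x) * exp (- (inverse x ^ k))) has_real_derivative
       poly q (inverse x) * (exp (- (inverse x ^ k)) * (- (real k * inverse x ^ (k - 1) * - (inverse x)\<^sup>2)))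
       + (poly (pderiv q) (inverse x) * - (inverse x)\<^sup>2) * exp (- (inverse x ^ k))) (at x)"
      using 1 by (auto intro!: derivative_eq_intros DERIV_chain2[OF poly_DERIV] simp: power2_eq_square)
    moreover have "poly q (inverse x) * (exp (- (inverse x ^ k)) * (- (real k * inverse x ^ (k - 1) * - (inverse x)\<^sup>2)))
       + (poly (pderiv q) (inverse x) * - (inverse x)\<^sup>2) * exp (- (inverse x ^ k))
       = flat_germ k (monom (real k) (k + 1) * q - monom 1 2 * pderiv q) x"
    proof -
      have "inverse x ^ (k + 1) = inverse x ^ (k - 1) * (inverse x)\<^sup>2"
        using assms by (cases k) (auto simp: power2_eq_square)
      then show ?thesis
        using 1 unfolding flat_germ_def poly_diff poly_mult poly_monom by (simp add: algebra_simps)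
    qed
    ultimately have "((\<lambda>x. poly q (inverse x) * exp (- (inverse x ^ k))) has_real_derivative
       flat_germ k (monom (real k) (k + 1) * q - monom 1 2 * pderiv q) x) (at x)"
      by simp
    then show ?thesis
      by (rule has_field_derivative_transform_within_open[where S = "{0<..}"])
        (use 1 in \<open>auto simp: flat_germ_def\<close>)
  next
    case 2
    have "((\<lambda>x. 0) has_real_derivative 0) (at x)" by simp
    then have "(flat_germ k q has_real_derivative 0) (at x)"
      by (rule has_field_derivative_transform_within_open[where S = "{..<0}"])
        (use 2 in \<open>auto simp: flat_germ_def\<close>)
    then show ?thesis using 2 by (simp add: flat_germ_def)
  next
    case 3
    have "((\<lambda>h. poly (pCons 0 q) (inverse h) * exp (- (inverse h ^ k))) \<longlongrightarrow> 0) (at_right 0)"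
      using filterlim_compose[OF poly_mult_exp_tendsto_0[OF assms] filterlim_inverse_at_top_right] .
    then have "((\<lambda>h. flat_germ k q h / h) \<longlongrightarrow> 0) (at_right 0)"
      by (rule Lim_transform_eventually)
        (auto simp: eventually_at_filter flat_germ_def divide_simps)
    moreover have "((\<lambda>h. flat_germ k q h / h) \<longlongrightarrow> 0) (at_left 0)"
      by (rule Lim_transform_eventually[OF tendsto_const])
        (auto simp: eventually_at_filter flat_germ_def)
    ultimately have "((\<lambda>h. flat_germ k q h / h) \<longlongrightarrow> 0) (at 0)"
      using filterlim_split_at by blast
    then show ?thesis using 3 by (simp add: DERIV_def flat_germ_def)
  qed
qed

lemma
  assumes "k \<ge> 1"
  shows smooth_flat_germ: "smooth_on UNIV (flat_germ k q)"
    and flat_flat_germ: "flat_at 0 (flat_germ k q)"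
proof -
  have d: "(\<lambda>x. frechet_derivative (flat_germ k q) (at x) w)
      = flat_germ k (smult w (monom (real k) (k + 1) * q - monom 1 2 * pderiv q))" for q w
  proof
    fix x
    have "frechet_derivative (flat_germ k q) (at x)
        = (\<lambda>h. flat_germ k (monom (real k) (k + 1) * q - monom 1 2 * pderiv q) x * h)"
      using flat_germ_has_derivative[OF assms, of q x] frechet_derivative_at
      unfolding has_field_derivative_def by metis
    then show "frechet_derivative (flat_germ k q) (at x) w
      = flat_germ k (smult w (monom (real k) (k + 1) * q - monom 1 2 * pderiv q)) x"
      by (simp add: flat_germ_def)
  qed
  have diff: "flat_germ k q differentiable (at x)" for q x
    using flat_germ_has_derivative[OF assms] real_differentiable_def by blast
  show "smooth_on UNIV (flat_germ k q)"
    by (rule smooth_by_closed_family[of _ "range (flat_germ k)"]) (auto simp: d diff)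
  show "flat_at 0 (flat_germ k q)"
    by (rule flat_by_closed_family[of _ "range (flat_germ k)"]) (auto simp: d, simp add: flat_germ_def)
qed

definition flat_exp :: "nat \<Rightarrow> real \<Rightarrow> real" where
  "flat_exp k x = (if x = 0 then 0 else exp (- (inverse \<bar>x\<bar> ^ k)))"

lemma flat_exp_eq: "flat_exp k = (\<lambda>x. flat_germ k 1 x + flat_germ k 1 (- x))"
  by (auto simp: flat_exp_def flat_germ_def fun_eq_iff)

lemma
  assumes "k \<ge> 1"
  shows smooth_flat_exp: "smooth_on UNIV (flat_exp k)"
    and flat_flat_exp: "flat_at 0 (flat_exp k)"
proof -
  have n: "bounded_linear (\<lambda>x::real. - x)" by (rule bounded_linear_minus[OF bounded_linear_ident])
  have s: "smooth_on UNIV (\<lambda>x. flat_germ k 1 (- x))" "flat_at 0 (\<lambda>x. flat_germ k 1 (- x))"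
    using smooth_affine_compose[OF smooth_flat_germ[OF assms] n, of 1 0]
      flat_affine_compose[OF smooth_flat_germ[OF assms] n, of 0 0 1] flat_flat_germ[OF assms, of 1] by auto
  show "smooth_on UNIV (flat_exp k)" "flat_at 0 (flat_exp k)"
    unfolding flat_exp_eq
    by (intro smooth_add flat_add smooth_flat_germ flat_flat_germ assms s)+
qed

text \<open>
  The exponent 1 suffices here, since only smoothness and the support matter.
\<close>

definition bump :: "real \<Rightarrow> real \<Rightarrow> real" where
  "bump r x = flat_germ 1 1 (r + x) * flat_germ 1 1 (r - x)"

lemma bump_nonneg: "bump r x \<ge> 0"
  by (simp add: bump_def flat_germ_def)

lemma bump_pos_iff: "bump r x \<noteq> 0 \<longleftrightarrow> \<bar>x\<bar> < r"
  by (auto simp: bump_def flat_germ_def)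

lemma smooth_bump: "smooth_on UNIV (bump r)"
proof -
  have "bounded_linear (\<lambda>x::real. - x)" by (rule bounded_linear_minus[OF bounded_linear_ident])
  then have "smooth_on UNIV (\<lambda>x. flat_germ 1 1 (r - x))"
    using smooth_affine_compose[OF smooth_flat_germ[of 1 1], of "\<lambda>x. - x" r] by simp
  moreover have "smooth_on UNIV (\<lambda>x. flat_germ 1 1 (x + r))"
    using smooth_affine_compose[OF smooth_flat_germ bounded_linear_ident] by auto
  ultimately show ?thesis
    unfolding bump_def using smooth_mult by (fastforce simp: add.commute[of r])
qed

section \<open>Holomorphic parameter integrals\<close>

text \<open>
  Cauchy's inequality turns the local bound on the integrand into a bound on its derivative, hence on
  the difference quotients, and dominated convergence applies to these.
\<close>

lemma holomorphic_on_integral_dominated: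
  fixes G :: "complex \<Rightarrow> 'a \<Rightarrow> complex"
  assumes D: "open D"
    and meas: "\<And>s. s \<in> D \<Longrightarrow> G s \<in> borel_measurable M"
    and hol: "\<And>z. z \<in> space M \<Longrightarrow> (\<lambda>s. G s z) holomorphic_on D"
    and dom: "\<And>s0. s0 \<in> D \<Longrightarrow> \<exists>r>0. \<exists>w. integrable M w \<and>
       (AE z in M. \<forall>s\<in>ball s0 r. norm (G s z) \<le> w z)"
  shows "(\<lambda>s. LINT z|M. G s z) holomorphic_on D"
  unfolding holomorphic_on_open[OF D]
proof
  fix s0 assume s0: "s0 \<in> D"
  obtain r0 w where r0: "r0 > 0" and w: "integrable M w"
    and wb: "AE z in M. \<forall>s\<in>ball s0 r0. norm (G s z) \<le> w z" using dom[OF s0] by blast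
  obtain r1 where r1: "r1 > 0" "ball s0 r1 \<subseteq> D" using D s0 openE by blast
  define r where "r = min r0 r1 / 3"
  have r: "r > 0" "ball s0 (3 * r) \<subseteq> D" "ball s0 (3 * r) \<subseteq> ball s0 r0" using r0 r1 by (auto simp: r_def)
  have int: "integrable M (G s)" if "s \<in> ball s0 (3 * r)" for s
  proof (rule Bochner_Integration.integrable_bound[OF w])
    show "G s \<in> borel_measurable M" using meas that r by blast
    show "AE z in M. norm (G s z) \<le> norm (w z)"
      using wb by eventually_elim (use that r in \<open>force intro: order_trans[OF _ abs_ge_self]\<close>)
  qed
  define Q where "Q = (\<lambda>s z. (G s z - G s0 z) / (s - s0))"
  have limQ: "((\<lambda>s. Q s z) \<longlongrightarrow> deriv (\<lambda>s. G s z) s0) (at s0)" if "z \<in> space M" for z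
    using holomorphic_derivI[OF hol[OF that] D s0]
    unfolding has_field_derivative_iff Q_def .
  have bQ: "norm (Q s z) \<le> w z / r"
    if z: "z \<in> space M" "\<forall>s\<in>ball s0 r0. norm (G s z) \<le> w z" and s: "s \<in> ball s0 r" "s \<noteq> s0" for s z
  proof -
    have "norm (G s z - G s0 z) \<le> w z / r * norm (s - s0)"
    proof (rule field_differentiable_bound[of "ball s0 r" "\<lambda>s. G s z" "deriv (\<lambda>s. G s z)"])
      fix x assume x: "x \<in> ball s0 r"
      have sub: "cball x r \<subseteq> ball s0 (3 * r)"
      proof
        fix y assume "y \<in> cball x r"
        then show "y \<in> ball s0 (3 * r)"
          using x r(1) dist_triangle[of s0 y x] by simp
      qed
      have xD: "x \<in> D" using sub r by (auto simp: subset_eq)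
      show "((\<lambda>s. G s z) has_field_derivative deriv (\<lambda>s. G s z) x) (at x within ball s0 r)"
        using holomorphic_derivI[OF hol[OF z(1)] D xD] by (rule has_field_derivative_at_within)
      have "norm ((deriv ^^ 1) (\<lambda>s. G s z) x) \<le> fact 1 * w z / r ^ 1"
      proof (rule Cauchy_inequality)
        have "cball x r \<subseteq> D" using sub r by blast
        then show "(\<lambda>s. G s z) holomorphic_on ball x r" "continuous_on (cball x r) (\<lambda>s. G s z)"
          using hol[OF z(1)] holomorphic_on_subset holomorphic_on_imp_continuous_on ball_subset_cball
          by (blast, metis holomorphic_on_subset holomorphic_on_imp_continuous_on)
        show "norm (G y z) \<le> w z" if "norm (x - y) = r" for y
        proof -
          have "y \<in> cball x r" using that by (simp add: dist_norm)
          then show ?thesis using z(2) sub r(3) by blast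
        qed
      qed (use r in auto)
      then show "norm (deriv (\<lambda>s. G s z) x) \<le> w z / r" by simp
    qed (use s r in auto)
    then show ?thesis using s r(1) unfolding Q_def by (simp add: norm_divide divide_simps)
  qed
  have "((\<lambda>s. (LINT z|M. Q s z)) \<longlongrightarrow> (LINT z|M. deriv (\<lambda>s. G s z) s0)) (at s0)"
    unfolding tendsto_at_iff_sequentially
  proof (intro allI impI)
    fix X :: "nat \<Rightarrow> complex" assume X: "\<forall>i. X i \<in> UNIV - {s0}" "X \<longlonglongrightarrow> s0"
    then have "eventually (\<lambda>i. X i \<in> ball s0 r) sequentially"
      using r(1) by (simp add: tendsto_iff dist_commute)
    then obtain N where N: "\<And>i. X (i + N) \<in> ball s0 r"
      unfolding eventually_sequentially by (metis le_add2)
    have X0: "filterlim X (at s0) sequentially"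
      using X by (auto simp: filterlim_at)
    have lim: "(\<lambda>i. Q (X (i + N)) z) \<longlonglongrightarrow> deriv (\<lambda>s. G s z) s0" if "z \<in> space M" for z
      using LIMSEQ_ignore_initial_segment[OF filterlim_compose[OF limQ[OF that] X0], of N] .
    have ballD: "ball s0 r \<subseteq> D" using r by (auto simp: subset_eq)
    have mQ: "Q (X (i + N)) \<in> borel_measurable M" for i
      unfolding Q_def using meas[of "X (i + N)"] meas[OF s0] N[of i] ballD by auto
    have "(\<lambda>i. LINT z|M. Q (X (i + N)) z) \<longlonglongrightarrow> (LINT z|M. deriv (\<lambda>s. G s z) s0)"
    proof (rule integral_dominated_convergence[where w = "\<lambda>z. w z / r"])
      show "(\<lambda>z. deriv (\<lambda>s. G s z) s0) \<in> borel_measurable M"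
        by (rule borel_measurable_LIMSEQ_metric[OF mQ lim])
      show "integrable M (\<lambda>z. w z / r)" using w by simp
      show "AE z in M. (\<lambda>i. Q (X (i + N)) z) \<longlonglongrightarrow> deriv (\<lambda>s. G s z) s0" using lim by auto
      show "AE z in M. norm (Q (X (i + N)) z) \<le> w z / r" for i
        using wb AE_space by eventually_elim (use bQ N X in auto)
    qed (rule mQ)
    then show "((\<lambda>s. LINT z|M. Q s z) \<circ> X) \<longlonglongrightarrow> (LINT z|M. deriv (\<lambda>s. G s z) s0)"
      unfolding o_def by (rule LIMSEQ_offset)
  qed
  moreover have "eventually (\<lambda>s. (LINT z|M. Q s z) = ((LINT z|M. G s z) - (LINT z|M. G s0 z)) / (s - s0)) (at s0)"
    unfolding eventually_at
    by (rule exI[of _ r]) (use r in \<open>auto simp: Q_def int dist_commute\<close>)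
  ultimately have "((\<lambda>s. ((LINT z|M. G s z) - (LINT z|M. G s0 z)) / (s - s0)) \<longlongrightarrow>
      (LINT z|M. deriv (\<lambda>s. G s z) s0)) (at s0)"
    using tendsto_cong by fastforce
  then show "\<exists>f'. ((\<lambda>s. LINT z|M. G s z) has_field_derivative f') (at s0)"
    unfolding has_field_derivative_iff by blast
qed

section \<open>An obstruction to meromorphic continuation\<close>

text \<open>
  At a point, a meromorphic function is either bounded nearby or has a pole, and near a pole it is at
  least of the order of a simple pole. So growth slower than that of a simple pole forces boundedness.
  A meromorphic function may take arbitrary values on a discrete set, which is why removable
  singularities are removed before the identity theorem is applied.
\<close>

lemma meromorphic_continuation_slow_imp_bounded:
  fixes F Z :: "complex \<Rightarrow> complex" and t :: "nat \<Rightarrow> real"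
  assumes F: "F meromorphic_on D" "open D" "{s. Re s > - \<rho>} \<subseteq> D" and c: "0 < c" "c < \<rho>"
    and Z: "Z holomorphic_on {s. Re s > - c}"
    and eq: "\<And>s. Re s > 0 \<Longrightarrow> F s = Z s"
    and t: "\<And>i. t i > - c" "t \<longlonglongrightarrow> - c"
    and slow: "(\<lambda>i. of_real (t i + c) * Z (of_real (t i))) \<longlonglongrightarrow> 0"
  shows "Bseq (\<lambda>i. Z (of_real (t i)))"
proof -
  define H where "H = {s. Re s > - c}"
  have H: "open H" "connected H" "H \<subseteq> D" 
    using F(3) c open_halfspace_Re_gt[of "-c"] convex_halfspace_Re_gt[of "-c"]
    by (auto simp: H_def intro!: convex_connected)
  have FH: "F meromorphic_on H" using F(1) H(3) meromorphic_on_subset by blast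
  have Za: "Z analytic_on H" using Z H(1) by (simp add: analytic_on_open H_def)
  have FZ: "(\<lambda>s. F s - Z s) meromorphic_on H"
    by (intro meromorphic_intros FH analytic_on_imp_meromorphic_on Za)
  define G where "G = remove_sings (\<lambda>s. F s - Z s)"
  have G: "G nicely_meromorphic_on H" using FZ unfolding G_def by (rule remove_sings_nicely_meromorphic)
  have right: "open {s::complex. Re s > 0}" by (rule open_halfspace_Re_gt)
  have "G s = 0" if "Re s > 0" for s
  proof -
    have "eventually (\<lambda>s. F s - Z s = 0) (at s)"
      using eventually_at_in_open'[OF right, of s] that by (auto elim!: eventually_mono simp: eq)
    then have "G s = remove_sings (\<lambda>_. 0) s" unfolding G_def by (rule remove_sings_cong) simp
    then show ?thesis by simp
  qed
  then have "eventually (\<lambda>s. G s = 0) (at 1)"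
    using eventually_at_in_open'[OF right, of 1] by (auto elim!: eventually_mono)
  then have "frequently (\<lambda>s. G s = 0) (at 1)" using eventually_frequently[of "at (1::complex)"] by simp
  then have G0: "G s = 0" if "s \<in> H" for s
    using frequently_eq_meromorphic_imp_constant[OF _ G H(1,2), of 0 1] that c by (auto simp: H_def)
  define F' where "F' = remove_sings F"
  have F'Z: "F' s = Z s" if s: "s \<in> H" for s
  proof -
    have sing: "isolated_singularity_at (\<lambda>s. F s - Z s) s" "not_essential (\<lambda>s. F s - Z s) s"
      using FZ s meromorphic_at_iff meromorphic_on_meromorphic_at by blast+
    have "eventually (\<lambda>s. G s = F s - Z s) (at s)"
      unfolding G_def by (rule eventually_remove_sings_eq_at[OF sing(1)])
    moreover have "eventually (\<lambda>s. s \<in> H) (at s)" using eventually_at_in_open'[OF H(1) s] .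
    ultimately have "eventually (\<lambda>s. F s = Z s) (at s)"
      by eventually_elim (use G0 in auto)
    then have "F' s = remove_sings Z s" unfolding F'_def by (rule remove_sings_cong) simp
    also have "\<dots> = Z s" using Za s by (intro remove_sings_at_analytic) (auto simp: analytic_on_def)
    finally show ?thesis .
  qed
  define s0 where "s0 = complex_of_real (- c)"
  have s0D: "s0 \<in> D" using F(3) c by (auto simp: s0_def)
  have iso: "isolated_singularity_at F' s0" "not_essential F' s0"
    using F(1) s0D meromorphic_at_iff meromorphic_on_meromorphic_at unfolding F'_def
    by (metis isolated_singularity_at_remove_sings, metis not_essential_remove_sings)
  have ts: "filterlim (\<lambda>i. complex_of_real (t i)) (at s0) sequentially"
    unfolding filterlim_at
  proof
    show "(\<lambda>i. complex_of_real (t i)) \<longlonglongrightarrow> s0"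
      unfolding s0_def by (rule tendsto_of_real[OF t(2)])
    have "complex_of_real (t i) \<noteq> s0" for i
      using t(1)[of i] unfolding s0_def of_real_eq_iff by simp
    then show "\<forall>\<^sub>F i in sequentially. complex_of_real (t i) \<in> UNIV \<and> complex_of_real (t i) \<noteq> s0"
      by simp
  qed
  have Zt: "Z (of_real (t i)) = F' (of_real (t i))" for i
    using F'Z t(1)[of i] by (simp add: H_def)
  \<comment> \<open>At a pole, \<open>1 / F'\<close> extends holomorphically by 0, so its difference quotient converges; multiplied with the slow factor it tends to 0, but the product is 1.\<close>
  have "\<not> is_pole F' s0"
  proof
    assume pole: "is_pole F' s0"
    obtain r where r: "r > 0" "F' holomorphic_on ball s0 r - {s0}"
      using iso(1) unfolding isolated_singularity_at_def by (metis analytic_imp_holomorphic)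
    have "eventually (\<lambda>s. F' s \<noteq> 0) (at s0)" using non_zero_neighbour_pole[OF pole] .
    then obtain r2 where r2: "r2 > 0" "\<And>s. s \<noteq> s0 \<Longrightarrow> dist s s0 < r2 \<Longrightarrow> F' s \<noteq> 0"
      unfolding eventually_at by auto
    define h where "h = (\<lambda>s. if s = s0 then 0 else inverse (F' s))"
    define d where "d = min r r2"
    have "h holomorphic_on ball s0 d"
      unfolding h_def
      by (rule is_pole_inverse_holomorphic[OF _ _ pole])
        (use r r2 in \<open>auto simp: d_def dist_commute intro: holomorphic_on_subset\<close>)
    then obtain h' where "(h has_field_derivative h') (at s0)"
      using r r2 unfolding holomorphic_on_open[OF open_ball] by (force simp: d_def)
    then have "((\<lambda>s. (h s - h s0) / (s - s0)) \<longlongrightarrow> h') (at s0)"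
      by (simp add: has_field_derivative_iff)
    then have "(\<lambda>i. (h (of_real (t i)) - h s0) / (of_real (t i) - s0)) \<longlonglongrightarrow> h'"
      using filterlim_compose ts by blast
    from tendsto_mult[OF this slow]
    have "(\<lambda>i. (h (of_real (t i)) - h s0) / (of_real (t i) - s0) * (of_real (t i + c) * Z (of_real (t i)))) \<longlonglongrightarrow> 0"
      by simp
    moreover have "eventually (\<lambda>i. (h (of_real (t i)) - h s0) / (of_real (t i) - s0) * (of_real (t i + c) * Z (of_real (t i))) = 1) sequentially"
    proof -
      have ev: "eventually (\<lambda>i. F' (of_real (t i)) \<noteq> 0) sequentially"
        using non_zero_neighbour_pole[OF pole] ts unfolding filterlim_iff by blast
      then show ?thesis
      proof eventually_elim
        case (elim i)
        have nz: "complex_of_real (t i + c) \<noteq> 0"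
          using t(1)[of i] unfolding of_real_eq_0_iff by simp
        have eq: "complex_of_real (t i) - s0 = of_real (t i + c)" by (simp add: s0_def)
        have h: "h (of_real (t i)) - h s0 = inverse (F' (of_real (t i)))"
          using t(1)[of i] unfolding h_def s0_def of_real_eq_iff by simp
        show ?case unfolding h eq Zt using nz elim by (metis divide_inverse mult.commute mult.assoc left_inverse nonzero_mult_div_cancel_left)
      qed
    qed
    ultimately have "(\<lambda>i. 1::complex) \<longlonglongrightarrow> 0" by (rule Lim_transform_eventually)
    then show False by (simp add: LIMSEQ_const_iff)
  qed
  then obtain l where "(F' \<longlongrightarrow> l) (at s0)" using iso(2) unfolding not_essential_def by blast
  then have "(\<lambda>i. F' (of_real (t i))) \<longlonglongrightarrow> l" using filterlim_compose ts by blast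
  then show ?thesis using convergent_imp_Bseq convergentI Zt by force
qed

section \<open>Integrals of powers and of local zeta functions\<close>

text \<open>
  All majorants below are sums of products of these functions in the two coordinates.
\<close>

definition cut_powr :: "real \<Rightarrow> real \<Rightarrow> real \<Rightarrow> real" where
  "cut_powr R a x = indicator {-R..R} x * \<bar>x\<bar> powr a"

lemma cut_powr_measurable [measurable]: "cut_powr R a \<in> borel_measurable borel"
  unfolding cut_powr_def by measurable

lemma cut_powr_nonneg: "cut_powr R a x \<ge> 0"
  by (simp add: cut_powr_def)

lemma has_bochner_integral_cut_powr:
  assumes "a > -1" "R > 0"
  shows "has_bochner_integral lborel (cut_powr R a) (2 * R powr (a + 1) / (a + 1))"
proof -
  let ?f = "\<lambda>x. indicator {0..R} x * x powr a"
  have f: "has_bochner_integral lborel ?f (R powr (a + 1) / (a + 1))"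
  proof (rule has_bochner_integral_nn_integral)
    have "((\<lambda>x. x powr a) has_integral R powr (a + 1) / (a + 1)) {0..R}"
      using has_integral_powr_from_0[of a R] assms by simp
    then have "(?f has_integral R powr (a + 1) / (a + 1)) UNIV"
      unfolding has_integral_restrict_UNIV[symmetric, of "\<lambda>x. x powr a"]
      by (rule has_integral_eq[rotated]) (auto simp: indicator_def)
    then show "(\<integral>\<^sup>+x. ennreal (?f x) \<partial>lborel) = ennreal (R powr (a + 1) / (a + 1))"
      by (intro nn_integral_has_integral_lborel) auto
  qed (use assms in auto)
  have "has_bochner_integral lborel (\<lambda>x. ?f (- x)) (R powr (a + 1) / (a + 1))"
    using lborel_has_bochner_integral_real_affine_iff[of "-1" ?f "R powr (a + 1) / (a + 1)" 0] f by simp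
  from has_bochner_integral_add[OF f this]
  have "has_bochner_integral lborel (\<lambda>x. ?f x + ?f (- x)) (2 * R powr (a + 1) / (a + 1))"
    by (simp add: field_simps)
  moreover have "?f x + ?f (- x) = cut_powr R a x" if "x \<noteq> 0" for x
    using that by (auto simp: cut_powr_def indicator_def)
  then have "AE x in lborel. cut_powr R a x = ?f x + ?f (- x)"
    using AE_lborel_singleton[of 0] by (auto elim!: eventually_mono)
  ultimately show ?thesis
    by (subst has_bochner_integral_cong_AE[where g = "\<lambda>x. ?f x + ?f (- x)"]) auto
qed

lemma integral_product_lborel:
  fixes f g :: "real \<Rightarrow> real"
  assumes f: "integrable lborel f" and g: "integrable lborel g"
  shows "integrable lborel (\<lambda>z. f (fst z) * g (snd z))"
    and "(LINT z|lborel. f (fst z) * g (snd z)) = (LINT x|lborel. f x) * (LINT y|lborel. g y)"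
proof -
  have "integrable (lborel \<Otimes>\<^sub>M lborel) (\<lambda>z. f (fst z) * g (snd z))"
  proof (rule lborel_pair.Fubini_integrable)
    show "(\<lambda>z. f (fst z) * g (snd z)) \<in> borel_measurable (lborel \<Otimes>\<^sub>M lborel)"
      using f g by measurable
    have "(\<lambda>x. \<integral>y. norm (f (fst (x, y)) * g (snd (x, y))) \<partial>lborel) = (\<lambda>x. \<bar>f x\<bar> * (LINT y|lborel. \<bar>g y\<bar>))"
      by (simp add: abs_mult)
    then show "integrable lborel (\<lambda>x. \<integral>y. norm (f (fst (x, y)) * g (snd (x, y))) \<partial>lborel)"
      using f by simp
  qed (use g in simp)
  then have *: "integrable (lborel \<Otimes>\<^sub>M lborel) (\<lambda>(x, y). f x * g y)"
    by (simp add: case_prod_beta')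
  then show "integrable lborel (\<lambda>z. f (fst z) * g (snd z))"
    by (simp add: lborel_prod case_prod_beta')
  have "(LINT z|lborel. f (fst z) * g (snd z)) = (LINT x|lborel. LINT y|lborel. f x * g y)"
    using lborel_pair.integral_fst'[OF *] by (simp add: lborel_prod case_prod_beta')
  then show "(LINT z|lborel. f (fst z) * g (snd z)) = (LINT x|lborel. f x) * (LINT y|lborel. g y)"
    by simp
qed

lemma AE_coordinates_nonzero: "AE z in lborel. fst z \<noteq> (0::real) \<and> snd z \<noteq> (0::real)"
proof -
  have "{z \<in> space (lborel \<Otimes>\<^sub>M lborel). fst z \<noteq> (0::real) \<and> snd z \<noteq> (0::real)} \<in> sets (lborel \<Otimes>\<^sub>M lborel)"
    by measurable
  note iff = lborel_pair.AE_pair_iff[OF this]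
  have nz: "AE x in lborel. x \<noteq> (0::real)" by (rule AE_lborel_singleton)
  have "AE x in lborel. AE y in lborel. x \<noteq> (0::real) \<and> y \<noteq> (0::real)"
    using nz by eventually_elim (use nz in simp)
  then have "AE z in lborel \<Otimes>\<^sub>M lborel. fst z \<noteq> (0::real) \<and> snd z \<noteq> (0::real)"
    using iff by blast
  then show ?thesis by (simp only: lborel_prod)
qed

text \<open>
  The negative exponent controls small values and the nonnegative one controls large values.
\<close>

lemma powr_between_le:
  fixes L x M :: real
  assumes "0 < L" "L \<le> x" "x \<le> M" "1 \<le> M" "\<sigma>\<^sub>1 \<le> \<sigma>" "\<sigma>\<^sub>1 \<le> 0" "\<sigma> \<le> \<sigma>\<^sub>2" "0 \<le> \<sigma>\<^sub>2"
  shows "x powr \<sigma> \<le> L powr \<sigma>\<^sub>1 + M powr \<sigma>\<^sub>2"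
proof (cases "x \<le> 1")
  case True
  have "x powr \<sigma> \<le> x powr \<sigma>\<^sub>1" using assms True by (intro powr_mono') auto
  also have "\<dots> \<le> L powr \<sigma>\<^sub>1" using assms by (intro powr_mono2') auto
  finally show ?thesis by (smt (verit) powr_ge_zero)
next
  case False
  have "x powr \<sigma> \<le> x powr \<sigma>\<^sub>2" using assms False by (intro powr_mono) auto
  also have "\<dots> \<le> M powr \<sigma>\<^sub>2" using assms by (intro powr_mono2) auto
  finally show ?thesis by (smt (verit) powr_ge_zero)
qed

lemma norm_of_real_powr: "x \<ge> 0 \<Longrightarrow> norm (complex_of_real x powr s) = x powr Re s"
  by (cases "x = 0") (auto simp: norm_powr_real_powr)

lemma measurable_of_real_powr [measurable]:
  fixes f :: "'a \<Rightarrow> real"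
  assumes [measurable]: "f \<in> borel_measurable M"
  shows "(\<lambda>z. complex_of_real \<bar>f z\<bar> powr s) \<in> borel_measurable M"
proof -
  have "(\<lambda>z. complex_of_real \<bar>f z\<bar> powr s)
    = (\<lambda>z. if \<bar>f z\<bar> = 0 then 0 else exp (s * complex_of_real (ln \<bar>f z\<bar>)))"
    by (auto simp: powr_def Ln_of_real fun_eq_iff)
  then show ?thesis by simp
qed

text \<open>
  The conditions on \<open>c\<close> say that \<open>p + \<alpha> \<sigma> > - 1\<close> and \<open>q + \<beta> \<sigma> > - 1\<close> for \<open>\<sigma> > - c\<close>, so that the powers
  arising from the lower bound on \<open>f\<close> and from the vanishing of \<open>\<phi>\<close> on the axes are integrable.
  The majorant holds off the axes only, since \<open>0 powr a = 0\<close>.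
\<close>

lemma dominated_by_monomial:
  fixes f \<phi> :: "real \<times> real \<Rightarrow> real" and \<alpha> \<beta> p q :: nat and c R M C :: real
  assumes supp: "\<And>z. \<phi> z \<noteq> 0 \<Longrightarrow> \<bar>fst z\<bar> \<le> R \<and> \<bar>snd z\<bar> \<le> R \<and> \<bar>f z\<bar> \<le> M" and R: "R > 0" and M: "M \<ge> 1"
    and \<phi>: "\<And>x y. \<bar>\<phi> (x, y)\<bar> \<le> C * \<bar>x\<bar> ^ p * \<bar>y\<bar> ^ q"
    and lower: "\<And>x y. \<bar>x\<bar> ^ \<alpha> * \<bar>y\<bar> ^ \<beta> \<le> \<bar>f (x, y)\<bar>"
    and c: "0 < c" "c * \<alpha> \<le> p + 1" "c * \<beta> \<le> q + 1"
    and \<sigma>: "- c < \<sigma>\<^sub>1" "\<sigma>\<^sub>1 \<le> 0" "0 \<le> \<sigma>\<^sub>2"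
  shows "\<exists>w. integrable lborel w \<and>
    (AE z in lborel. \<forall>s. \<sigma>\<^sub>1 \<le> Re s \<and> Re s \<le> \<sigma>\<^sub>2 \<longrightarrow>
        norm (complex_of_real \<bar>f z\<bar> powr s * complex_of_real (\<phi> z)) \<le> w z)"
proof -
  define w where "w = (\<lambda>z. C * (cut_powr R (\<alpha> * \<sigma>\<^sub>1 + p) (fst z) * cut_powr R (\<beta> * \<sigma>\<^sub>1 + q) (snd z))
      + C * M powr \<sigma>\<^sub>2 * (cut_powr R p (fst z) * cut_powr R q (snd z)))"
  have e: "n * \<sigma>\<^sub>1 + r > -1" if "c * n \<le> r + 1" for n r :: nat
  proof (cases "n = 0")
    case False
    then have "(- c) * n < \<sigma>\<^sub>1 * n" using \<sigma> by (intro mult_strict_right_mono) auto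
    then show ?thesis using that by (simp add: algebra_simps)
  qed auto
  have int: "integrable lborel (cut_powr R a)" if "a > -1" for a
    using has_bochner_integral_cut_powr[OF that R] by (simp add: has_bochner_integral_iff)
  have "integrable lborel w"
    unfolding w_def
    by (intro Bochner_Integration.integrable_add integrable_mult_right integral_product_lborel int)
       (use e[OF c(2)] e[OF c(3)] in auto)
  moreover have "AE z in lborel. \<forall>s. \<sigma>\<^sub>1 \<le> Re s \<and> Re s \<le> \<sigma>\<^sub>2 \<longrightarrow>
        norm (complex_of_real \<bar>f z\<bar> powr s * complex_of_real (\<phi> z)) \<le> w z"
    using AE_coordinates_nonzero
  proof (eventually_elim, intro allI impI)
    fix z :: "real \<times> real" and s assume z: "fst z \<noteq> 0 \<and> snd z \<noteq> 0" and s: "\<sigma>\<^sub>1 \<le> Re s \<and> Re s \<le> \<sigma>\<^sub>2"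
    obtain x y where xy: "z = (x, y)" by force
    have C: "C * \<bar>x\<bar> ^ p * \<bar>y\<bar> ^ q \<ge> 0" using \<phi>[of x y] by linarith
    then have C0: "C \<ge> 0" using z xy by (simp add: zero_le_mult_iff not_le) (smt (verit) zero_less_power abs_ge_zero mult_le_0_iff)
    show "norm (complex_of_real \<bar>f z\<bar> powr s * complex_of_real (\<phi> z)) \<le> w z"
    proof (cases "\<phi> z = 0")
      case True
      then show ?thesis using C0 by (auto simp: w_def cut_powr_nonneg intro!: add_nonneg_nonneg mult_nonneg_nonneg)
    next
      case False
      let ?L = "\<bar>x\<bar> ^ \<alpha> * \<bar>y\<bar> ^ \<beta>"
      have L: "?L > 0" using z xy by simp
      have "norm (complex_of_real \<bar>f z\<bar> powr s * complex_of_real (\<phi> z)) = \<bar>f z\<bar> powr Re s * \<bar>\<phi> z\<bar>"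
        by (simp add: norm_mult norm_of_real_powr)
      also have "\<dots> \<le> (?L powr \<sigma>\<^sub>1 + M powr \<sigma>\<^sub>2) * (C * \<bar>x\<bar> ^ p * \<bar>y\<bar> ^ q)"
      proof (rule mult_mono)
        show "\<bar>f z\<bar> powr Re s \<le> ?L powr \<sigma>\<^sub>1 + M powr \<sigma>\<^sub>2"
          by (rule powr_between_le) (use L lower supp[OF False] M \<sigma> s xy in auto)
      qed (use \<phi>[of x y] xy in auto)
      also have "\<dots> = w z"
      proof -
        have pw: "cut_powr R (n * \<sigma>\<^sub>1 + r) x = (\<bar>x\<bar> ^ n) powr \<sigma>\<^sub>1 * \<bar>x\<bar> ^ r" "cut_powr R r x = \<bar>x\<bar> ^ r"
          if "\<bar>x\<bar> \<le> R" "x \<noteq> 0" for x and n r :: nat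
          using that by (auto simp: cut_powr_def abs_le_iff indicator_def powr_add powr_powr powr_realpow simp flip: powr_realpow)
        have "?L powr \<sigma>\<^sub>1 = (\<bar>x\<bar> ^ \<alpha>) powr \<sigma>\<^sub>1 * (\<bar>y\<bar> ^ \<beta>) powr \<sigma>\<^sub>1"
          by (simp add: powr_mult)
        then show ?thesis
          using supp[OF False] z unfolding w_def xy fst_conv snd_conv
          by (subst (1 2) pw(1); (subst pw(2))?; simp add: pw(2) algebra_simps)
      qed
      finally show ?thesis .
    qed
  qed
  ultimately show ?thesis by blast
qed

lemma of_real_powr_holomorphic: "(\<lambda>s. complex_of_real x powr s) holomorphic_on A"
  by (intro holomorphic_intros)

lemma ball_Re_bounds: "s \<in> ball s0 r \<Longrightarrow> Re s0 - r < Re s \<and> Re s < Re s0 + r \<and> norm s \<le> norm s0 + r"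
  using abs_Re_le_cmod[of "s0 - s"] norm_triangle_ineq2[of s s0] by (auto simp: dist_norm norm_minus_commute)

text \<open>
  The majorants are needed on bounded parts of vertical strips only; the strips are chosen to contain
  \<open>Re s = 0\<close> so that the signs of their boundary exponents are known.
\<close>

lemma holomorphic_on_right_halfplane_integral:
  fixes G :: "complex \<Rightarrow> 'a \<Rightarrow> complex"
  assumes meas: "\<And>s. - c < Re s \<Longrightarrow> G s \<in> borel_measurable M" and c: "c > 0"
    and hol: "\<And>z. z \<in> space M \<Longrightarrow> (\<lambda>s. G s z) holomorphic_on {s. Re s > - c}"
    and dom: "\<And>\<sigma>\<^sub>1 \<sigma>\<^sub>2 N. - c < \<sigma>\<^sub>1 \<Longrightarrow> \<sigma>\<^sub>1 \<le> 0 \<Longrightarrow> 0 \<le> \<sigma>\<^sub>2 \<Longrightarrow> \<exists>w. integrable M w \<and>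
       (AE z in M. \<forall>s. \<sigma>\<^sub>1 \<le> Re s \<and> Re s \<le> \<sigma>\<^sub>2 \<and> norm s \<le> N \<longrightarrow> norm (G s z) \<le> w z)"
  shows "(\<lambda>s. LINT z|M. G s z) holomorphic_on {s. Re s > - c}"
    and "Re s > - c \<Longrightarrow> integrable M (G s)"
proof -
  show "(\<lambda>s. LINT z|M. G s z) holomorphic_on {s. Re s > - c}"
  proof (rule holomorphic_on_integral_dominated)
    fix s0 assume "s0 \<in> {s. - c < Re s}"
    define r where "r = (Re s0 + c) / 2"
    have r: "r > 0" "Re s0 - r > - c" using \<open>s0 \<in> _\<close> by (auto simp: r_def field_simps)
    define \<sigma>\<^sub>1 \<sigma>\<^sub>2 where "\<sigma>\<^sub>1 = min 0 (Re s0 - r)" and "\<sigma>\<^sub>2 = max 0 (Re s0 + r)"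
    obtain w where w: "integrable M w" "AE z in M. \<forall>s. \<sigma>\<^sub>1 \<le> Re s \<and> Re s \<le> \<sigma>\<^sub>2 \<and> norm s \<le> norm s0 + r \<longrightarrow> norm (G s z) \<le> w z"
      using dom[of \<sigma>\<^sub>1 \<sigma>\<^sub>2 "norm s0 + r"] r c unfolding \<sigma>\<^sub>1_def \<sigma>\<^sub>2_def by auto
    have "AE z in M. \<forall>s\<in>ball s0 r. norm (G s z) \<le> w z"
      using w(2) by eventually_elim (force simp: \<sigma>\<^sub>1_def \<sigma>\<^sub>2_def dest!: ball_Re_bounds)
    then show "\<exists>r>0. \<exists>w. integrable M w \<and> (AE z in M. \<forall>s\<in>ball s0 r. norm (G s z) \<le> w z)"
      using r w(1) by blast
  qed (use meas hol open_halfspace_Re_gt in auto)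
  assume s: "Re s > - c"
  obtain w where w: "integrable M w" "AE z in M. \<forall>s'. min 0 (Re s) \<le> Re s' \<and> Re s' \<le> max 0 (Re s) \<and> norm s' \<le> norm s \<longrightarrow> norm (G s' z) \<le> w z"
    using dom[of "min 0 (Re s)" "max 0 (Re s)" "norm s"] s c by auto
  show "integrable M (G s)"
  proof (rule Bochner_Integration.integrable_bound[OF w(1) meas[OF s]])
    show "AE z in M. norm (G s z) \<le> norm (w z)"
      using w(2) by eventually_elim (auto intro: order_trans[OF _ abs_ge_self])
  qed
qed

lemma
  fixes f \<phi> :: "real \<times> real \<Rightarrow> real" and \<alpha> \<beta> p q :: nat and c R M C :: real
  assumes [measurable]: "f \<in> borel_measurable borel" "\<phi> \<in> borel_measurable borel"
    and supp: "\<And>z. \<phi> z \<noteq> 0 \<Longrightarrow> \<bar>fst z\<bar> \<le> R \<and> \<bar>snd z\<bar> \<le> R \<and> \<bar>f z\<bar> \<le> M" and R: "R > 0" and M: "M \<ge> 1"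
    and \<phi>: "\<And>x y. \<bar>\<phi> (x, y)\<bar> \<le> C * \<bar>x\<bar> ^ p * \<bar>y\<bar> ^ q"
    and lower: "\<And>x y. \<bar>x\<bar> ^ \<alpha> * \<bar>y\<bar> ^ \<beta> \<le> \<bar>f (x, y)\<bar>"
    and c: "0 < c" "c * \<alpha> \<le> p + 1" "c * \<beta> \<le> q + 1"
  shows local_zeta_holomorphic: "local_zeta f \<phi> holomorphic_on {s. Re s > - c}"
    and local_zeta_integrable: "Re s > - c \<Longrightarrow>
      integrable lborel (\<lambda>z. complex_of_real \<bar>f z\<bar> powr s * complex_of_real (\<phi> z))"
proof -
  let ?G = "\<lambda>s z. complex_of_real \<bar>f z\<bar> powr s * complex_of_real (\<phi> z)"
  have hol: "(\<lambda>s. ?G s z) holomorphic_on {s. Re s > - c}" for z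
    by (intro holomorphic_intros of_real_powr_holomorphic)
  have meas: "?G s \<in> borel_measurable lborel" for s by measurable
  have dom: "\<exists>w. integrable lborel w \<and> (AE z in lborel. \<forall>s. \<sigma>\<^sub>1 \<le> Re s \<and> Re s \<le> \<sigma>\<^sub>2 \<and> norm s \<le> N
      \<longrightarrow> norm (?G s z) \<le> w z)" if \<sigma>: "- c < \<sigma>\<^sub>1" "\<sigma>\<^sub>1 \<le> 0" "0 \<le> \<sigma>\<^sub>2" for \<sigma>\<^sub>1 \<sigma>\<^sub>2 N
  proof -
    obtain w where w: "integrable lborel w" "AE z in lborel. \<forall>s. \<sigma>\<^sub>1 \<le> Re s \<and> Re s \<le> \<sigma>\<^sub>2 \<longrightarrow> norm (?G s z) \<le> w z"
      using dominated_by_monomial[of \<phi> R f M C p q \<alpha> \<beta> c, OF supp R M \<phi> lower c \<sigma>] by blast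
    then show ?thesis by (intro exI[of _ w]) (auto elim!: eventually_mono)
  qed
  note * = holomorphic_on_right_halfplane_integral[of c ?G lborel, OF meas c(1) hol dom]
  show "local_zeta f \<phi> holomorphic_on {s. Re s > - c}"
    using *(1) unfolding local_zeta_def[abs_def] by blast
  show "Re s > - c \<Longrightarrow> integrable lborel (?G s)" using *(2) by blast
qed

section \<open>Slow growth at the critical exponent\<close>

lemma tendsto_0_by_two_parameter_bound:
  fixes a :: "nat \<Rightarrow> 'a::real_normed_vector" and \<epsilon> :: "nat \<Rightarrow> real"
  assumes bd: "\<And>\<eta>. 0 < \<eta> \<Longrightarrow> \<eta> \<le> 1 \<Longrightarrow> \<exists>K. \<forall>i. norm (a i) \<le> A * \<eta> + K * \<epsilon> i"
    and \<epsilon>: "\<epsilon> \<longlonglongrightarrow> 0"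
  shows "a \<longlonglongrightarrow> 0"
proof (rule LIMSEQ_I)
  fix e :: real assume e: "e > 0"
  define \<eta> where "\<eta> = min 1 (e / (2 * (\<bar>A\<bar> + 1)))"
  have \<eta>: "0 < \<eta>" "\<eta> \<le> 1" using e by (auto simp: \<eta>_def)
  have "A * \<eta> \<le> (\<bar>A\<bar> + 1) * \<eta>" using \<eta> by (intro mult_right_mono) auto
  also have "\<dots> \<le> (\<bar>A\<bar> + 1) * (e / (2 * (\<bar>A\<bar> + 1)))"
    by (intro mult_left_mono) (auto simp: \<eta>_def)
  also have "\<dots> = e / 2" by (simp add: field_simps)
  finally have A: "A * \<eta> \<le> e / 2" .
  obtain K where K: "\<And>i. norm (a i) \<le> A * \<eta> + K * \<epsilon> i" using bd[OF \<eta>] by blast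
  have "(\<lambda>i. K * \<epsilon> i) \<longlonglongrightarrow> K * 0" by (intro tendsto_intros \<epsilon>)
  then have "eventually (\<lambda>i. K * \<epsilon> i < e / 2) sequentially"
    using e by (intro order_tendstoD) auto
  then have "eventually (\<lambda>i. norm (a i) < e) sequentially"
    by eventually_elim (use K A in \<open>smt (verit) field_sum_of_halves\<close>)
  then show "\<exists>no. \<forall>n\<ge>no. norm (a n - 0) < e" by (simp add: eventually_sequentially)
qed

lemma flat_exp_pos: "x \<noteq> 0 \<Longrightarrow> flat_exp k x > 0"
  by (simp add: flat_exp_def)

lemma flat_exp_nonneg: "flat_exp k x \<ge> 0"
  by (simp add: flat_exp_def)

lemma flat_exp_le_1: "flat_exp k x \<le> 1"
  by (simp add: flat_exp_def)

lemma flat_exp_mono: "0 < x \<Longrightarrow> x \<le> \<bar>y\<bar> \<Longrightarrow> flat_exp k x \<le> flat_exp k y"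
  by (auto simp: flat_exp_def intro!: power_mono le_imp_inverse_le)

text \<open>
  The integral is split at \<open>|w| = \<eta>\<close>. For small \<open>|w|\<close> the bound by the monomial produces the full factor
  \<open>1 / (t + 1 / m)\<close>, but on a strip of width \<open>2 \<eta>\<close>. For the other \<open>w\<close> the flat term is bounded away
  from 0, so the power of \<open>u\<close> is \<open>m - 2\<close> and its integral stays bounded as \<open>t\<close> tends to \<open>- 1 / m\<close>.
  The weight \<open>|w| ^ (2 n)\<close> absorbs \<open>|w| powr (n t)\<close>, since \<open>t > - 1\<close>.
\<close>

lemma local_zeta_slow:
  fixes F \<phi> :: "real \<times> real \<Rightarrow> real" and n m k :: nat and R M C t :: real
  assumes [measurable]: "F \<in> borel_measurable borel" "\<phi> \<in> borel_measurable borel"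
    and m: "m \<ge> 2"
    and supp: "\<And>z. \<phi> z \<noteq> 0 \<Longrightarrow> \<bar>fst z\<bar> \<le> R \<and> \<bar>snd z\<bar> \<le> R \<and> \<bar>F z\<bar> \<le> M" and R: "R \<ge> 1" and M: "M \<ge> 1"
    and \<phi>: "\<And>w u. \<bar>\<phi> (w, u)\<bar> \<le> C * \<bar>w\<bar> ^ (2 * n)"
    and lower: "\<And>w u. \<bar>w\<bar> ^ n * \<bar>u\<bar> ^ m \<le> \<bar>F (w, u)\<bar>"
      "\<And>w u. \<bar>w\<bar> ^ n * \<bar>u\<bar> ^ (m - 2) * flat_exp k w \<le> \<bar>F (w, u)\<bar>"
    and t: "- (1 / m) < t" "t < 0" and \<eta>: "0 < \<eta>" "\<eta> \<le> 1"
  shows "norm (of_real (t + 1 / m) * local_zeta F \<phi> (of_real t))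
    \<le> C * R ^ (2 * n) * (4 * R / m) * \<eta>
      + C * R ^ (2 * n) * (flat_exp k \<eta> powr - (1 / m)) * (2 * R\<^sup>2 * m) * (t + 1 / m)"
proof -
  define K where "K = flat_exp k \<eta> powr - (1 / m)"
  define C' where "C' = C * R ^ (2 * n)"
  have "0 \<le> C * \<bar>1\<bar> ^ (2 * n)" using \<phi>[of 1 1] by linarith
  then have C: "C \<ge> 0" by simp
  then have C': "C' \<ge> 0" using R by (simp add: C'_def)
  have K: "K \<ge> 0" by (simp add: K_def)
  have m1: "1 / real m \<le> 1" using m by simp
  have mt: "m * t > -1" using t(1) m by (simp add: field_simps)
  have mt': "(m - 2) * t \<ge> -1 + 2 / m"
  proof -
    have "(real m - 2) * t \<ge> (real m - 2) * - (1 / m)"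
      using t m by (intro mult_left_mono) auto
    then have "(m - 2) * t \<ge> (real m - 2) * - (1 / m)"
      using m by (simp add: of_nat_diff)
    also have "(real m - 2) * - (1 / m) = -1 + 2 / m" using m by (simp add: field_simps)
    finally show ?thesis .
  qed
  have m2: "2 / real m > 0" using m by simp
  define w1 where "w1 = (\<lambda>z. indicator {-\<eta>..\<eta>} (fst z) * cut_powr R (m * t) (snd z))"
  define w2 where "w2 = (\<lambda>z. indicator {-R..R} (fst z) * cut_powr R ((m - 2) * t) (snd z))"
  define g where "g = (\<lambda>z. C' * (w1 z + K * w2 z))"
  have ind: "integrable lborel (indicator {-r..r} :: real \<Rightarrow> real)" "(LINT x|lborel. indicator {-r..r} x) = 2 * r"
    if "r > 0" for r :: real
    using that by (auto simp: )
  have cp: "integrable lborel (cut_powr R a)" "(LINT x|lborel. cut_powr R a x) = 2 * R powr (a + 1) / (a + 1)"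
    if "a > -1" for a
    using has_bochner_integral_cut_powr[OF that, of R] R by (auto simp: has_bochner_integral_iff)
  have mt2: "(m - 2) * t > -1" using mt' m2 by linarith
  have w1: "integrable lborel w1" "(LINT z|lborel. w1 z) = 2 * \<eta> * (2 * R powr (m * t + 1) / (m * t + 1))"
    unfolding w1_def using integral_product_lborel[OF ind(1)[OF \<eta>(1)] cp(1)[OF mt]] ind(2)[OF \<eta>(1)] cp(2)[OF mt]
    by simp_all
  have R0: "R > 0" using R by simp
  have w2: "integrable lborel w2" "(LINT z|lborel. w2 z) = 2 * R * (2 * R powr ((m - 2) * t + 1) / ((m - 2) * t + 1))"
    unfolding w2_def using integral_product_lborel[OF ind(1)[OF R0] cp(1)[OF mt2]] ind(2)[OF R0] cp(2)[OF mt2]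
    by simp_all
  have g: "integrable lborel g" "(LINT z|lborel. g z) = C' * ((LINT z|lborel. w1 z) + K * (LINT z|lborel. w2 z))"
    unfolding g_def using w1(1) w2(1) by simp_all
  have bound: "norm (complex_of_real \<bar>F z\<bar> powr of_real t * complex_of_real (\<phi> z)) \<le> g z"
    if z: "fst z \<noteq> 0 \<and> snd z \<noteq> 0" for z
  proof (cases "\<phi> z = 0")
    case True
    then show ?thesis using C' K by (simp add: g_def w1_def w2_def cut_powr_nonneg)
  next
    case False
    obtain w u where wu: "z = (w, u)" by force
    have w: "w \<noteq> 0" "u \<noteq> 0" "\<bar>w\<bar> \<le> R" "\<bar>u\<bar> \<le> R" using z wu supp[OF False] by auto
    have "\<bar>w\<bar> powr (n * t) * \<bar>w\<bar> ^ (2 * n) = \<bar>w\<bar> powr (n * t + 2 * n)"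
      using w by (simp add: powr_add powr_realpow[symmetric])
    also have "\<dots> \<le> R powr (n * t + 2 * n)"
    proof (rule powr_mono2)
      have "n * t \<ge> real n * (- 1)" using t m1 by (intro mult_left_mono) auto
      then show "0 \<le> n * t + 2 * n" by simp
    qed (use w in auto)
    also have "\<dots> \<le> R powr (2 * n)"
      using R t by (intro powr_mono) (auto simp: mult_nonneg_nonpos)
    also have "\<dots> = R ^ (2 * n)" using R by (simp add: powr_realpow[symmetric])
    finally have wR: "\<bar>w\<bar> powr (n * t) * \<bar>w\<bar> ^ (2 * n) \<le> R ^ (2 * n)" .
    have pw: "(\<bar>x\<bar> ^ j) powr t = \<bar>x\<bar> powr (j * t)" if "x \<noteq> 0" for x :: real and j
      using that by (simp add: powr_powr powr_realpow[symmetric])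
    have key: "\<bar>F z\<bar> powr t * \<bar>\<phi> z\<bar> \<le> C' * P"
      if P: "\<bar>F z\<bar> powr t \<le> \<bar>w\<bar> powr (n * t) * P" "P \<ge> 0" for P
    proof -
      have "\<bar>F z\<bar> powr t * \<bar>\<phi> z\<bar> \<le> (\<bar>w\<bar> powr (n * t) * P) * (C * \<bar>w\<bar> ^ (2 * n))"
        using P \<phi>[of w u] wu by (intro mult_mono) auto
      also have "\<dots> = C * P * (\<bar>w\<bar> powr (n * t) * \<bar>w\<bar> ^ (2 * n))" by simp
      also have "\<dots> \<le> C * P * R ^ (2 * n)" using C P wR by (intro mult_left_mono) auto
      finally show ?thesis by (simp add: C'_def mult_ac)
    qed
    have n: "norm (complex_of_real \<bar>F z\<bar> powr of_real t * complex_of_real (\<phi> z)) = \<bar>F z\<bar> powr t * \<bar>\<phi> z\<bar>"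
      by (simp add: norm_mult norm_of_real_powr)
    show ?thesis
    proof (cases "\<bar>w\<bar> \<le> \<eta>")
      case True
      have "\<bar>F z\<bar> powr t \<le> (\<bar>w\<bar> ^ n * \<bar>u\<bar> ^ m) powr t"
        using lower(1)[of w u] w t wu by (intro powr_mono2') auto
      also have "\<dots> = \<bar>w\<bar> powr (n * t) * \<bar>u\<bar> powr (m * t)" using w by (simp add: powr_mult pw)
      finally have "\<bar>F z\<bar> powr t * \<bar>\<phi> z\<bar> \<le> C' * \<bar>u\<bar> powr (m * t)" by (rule key) simp
      also have "\<dots> = C' * w1 z" using True w wu
        by (simp add: w1_def cut_powr_def indicator_def abs_le_iff)
      also have "\<dots> \<le> g z"
        unfolding g_def using C' K by (intro mult_left_mono) (auto simp: w2_def cut_powr_nonneg)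
      finally show ?thesis using n by simp
    next
      case False
      have e: "flat_exp k \<eta> \<le> flat_exp k w" using False \<eta> by (intro flat_exp_mono) auto
      have "flat_exp k w powr t \<le> flat_exp k \<eta> powr t"
        using e t \<eta> flat_exp_pos[of \<eta> k] by (intro powr_mono2') auto
      also have "\<dots> \<le> K"
        unfolding K_def using t \<eta> flat_exp_pos[of \<eta> k] flat_exp_le_1[of k \<eta>] by (intro powr_mono') auto
      finally have eK: "flat_exp k w powr t \<le> K" .
      have "\<bar>F z\<bar> powr t \<le> (\<bar>w\<bar> ^ n * \<bar>u\<bar> ^ (m - 2) * flat_exp k w) powr t"
        using lower(2)[of w u] w t wu flat_exp_pos[of w k] by (intro powr_mono2') auto
      also have "\<dots> = \<bar>w\<bar> powr (n * t) * \<bar>u\<bar> powr ((m - 2) * t) * flat_exp k w powr t"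
        using w flat_exp_nonneg[of k w] by (simp add: powr_mult pw)
      also have "\<dots> \<le> \<bar>w\<bar> powr (n * t) * \<bar>u\<bar> powr ((m - 2) * t) * K"
        using eK by (intro mult_left_mono) auto
      finally have "\<bar>F z\<bar> powr t \<le> \<bar>w\<bar> powr (n * t) * (K * \<bar>u\<bar> powr ((m - 2) * t))"
        by (simp add: mult_ac)
      then have "\<bar>F z\<bar> powr t * \<bar>\<phi> z\<bar> \<le> C' * (K * \<bar>u\<bar> powr ((m - 2) * t))"
        by (rule key) (use K in simp)
      also have "\<dots> = C' * (K * w2 z)" using w wu
        by (simp add: w2_def cut_powr_def indicator_def abs_le_iff)
      also have "\<dots> \<le> g z"
        unfolding g_def using C' by (intro mult_left_mono) (auto simp: w1_def cut_powr_nonneg)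
      finally show ?thesis using n by simp
    qed
  qed
  let ?I = "\<lambda>z. complex_of_real \<bar>F z\<bar> powr of_real t * complex_of_real (\<phi> z)"
  have AE: "AE z in lborel. norm (?I z) \<le> g z"
    using AE_coordinates_nonzero by eventually_elim (rule bound)
  have intI: "integrable lborel ?I"
    by (rule Bochner_Integration.integrable_bound[OF g(1)])
      (use AE in \<open>auto elim!: eventually_mono intro: order_trans[OF _ abs_ge_self]\<close>)
  have "norm (local_zeta F \<phi> (of_real t)) \<le> (LINT z|lborel. norm (?I z))"
    unfolding local_zeta_def by (rule integral_norm_bound)
  also have "\<dots> \<le> (LINT z|lborel. g z)"
    using intI g(1) AE by (intro integral_mono_AE) auto
  finally have Zg: "norm (local_zeta F \<phi> (of_real t)) \<le> (LINT z|lborel. g z)" .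
  have \<epsilon>: "t + 1 / m > 0" using t by simp
  have Rle: "R powr a \<le> R" if "a \<le> 1" for a
    using powr_mono[OF that R] R by simp
  have W1: "(t + 1 / m) * (LINT z|lborel. w1 z) \<le> 4 * R / m * \<eta>"
  proof -
    have "R powr (m * t + 1) \<le> R" using t by (intro Rle) (auto simp: mult_nonneg_nonpos)
    moreover have "(t + 1 / m) / (m * t + 1) = 1 / m"
    proof -
      have "m * t + 1 = m * (t + 1 / m)" using m by (simp add: field_simps)
      then show ?thesis using \<epsilon> by simp
    qed
    moreover have "(t + 1 / m) * (LINT z|lborel. w1 z) = 4 * \<eta> * R powr (m * t + 1) * ((t + 1 / m) / (m * t + 1))"
      unfolding w1(2) by simp
    ultimately show ?thesis using \<eta> m by (simp add: divide_right_mono)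
  qed
  have W2: "(LINT z|lborel. w2 z) \<le> 2 * R\<^sup>2 * m"
  proof -
    have "R powr ((m - 2) * t + 1) \<le> R" using t m by (intro Rle) (auto simp: mult_nonneg_nonpos)
    then have "R powr ((m - 2) * t + 1) / ((m - 2) * t + 1) \<le> R / (2 / m)"
      using mt' m2 R by (intro frac_le) auto
    then have "4 * R * (R powr ((m - 2) * t + 1) / ((m - 2) * t + 1)) \<le> 4 * R * (R / (2 / m))"
      using R by (intro mult_left_mono) auto
    then show ?thesis unfolding w2(2) by (simp add: power2_eq_square field_simps)
  qed
  have "norm (of_real (t + 1 / m) * local_zeta F \<phi> (of_real t)) = (t + 1 / m) * norm (local_zeta F \<phi> (of_real t))"
    using \<epsilon> by (simp only: norm_mult norm_of_real abs_of_pos)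
  also have "\<dots> \<le> (t + 1 / m) * (LINT z|lborel. g z)" using Zg \<epsilon> by (intro mult_left_mono) auto
  also have "\<dots> = C' * ((t + 1 / m) * (LINT z|lborel. w1 z)) + C' * K * (t + 1 / m) * (LINT z|lborel. w2 z)"
    unfolding g(2) by (simp only: ring_distribs mult_ac)
  also have "\<dots> \<le> C' * (4 * R / m * \<eta>) + C' * K * (t + 1 / m) * (2 * R\<^sup>2 * m)"
    using W1 W2 C' K \<epsilon> by (intro add_mono mult_left_mono) auto
  finally show ?thesis unfolding C'_def K_def by (simp only: mult_ac)
qed

section \<open>Unboundedness at the critical exponent\<close>

lemma nn_integral_inverse_near_0:
  fixes \<delta> K :: real
  assumes "\<delta> > 0" "K > 0"
  shows "(\<integral>\<^sup>+w. ennreal (K / w) * indicator {0<..<\<delta>} w \<partial>lborel) = \<infinity>"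
proof -
  have "ennreal (K * real N) \<le> (\<integral>\<^sup>+w. ennreal (K / w) * indicator {0<..<\<delta>} w \<partial>lborel)" for N :: nat
  proof -
    define b where "b = \<delta> / 2"
    define a where "a = b * exp (- real N)"
    have ab: "0 < a" "a \<le> b" "b < \<delta>" using assms by (auto simp: a_def b_def mult_le_cancel_left1)
    have "ln a = ln b + ln (exp (- real N))"
      unfolding a_def using assms by (intro ln_mult_pos) (auto simp: b_def)
    then have "ln b - ln a = real N" by simp
    then have "ennreal (K * real N) = ennreal (K * ln b - K * ln a)" by (simp add: algebra_simps)
    also have "\<dots> = (\<integral>\<^sup>+w. ennreal (K / w) * indicator {a..b} w \<partial>lborel)"
      using ab assms
      by (intro nn_integral_FTC_Icc[symmetric]) (auto intro!: derivative_eq_intros DERIV_isCont)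
    also have "\<dots> \<le> (\<integral>\<^sup>+w. ennreal (K / w) * indicator {0<..<\<delta>} w \<partial>lborel)"
      using ab by (intro nn_integral_mono) (auto simp: indicator_def)
    finally show ?thesis .
  qed
  moreover have "\<exists>N::nat. ennreal x < ennreal (K * real N)" if "x \<ge> 0" for x
  proof -
    obtain N :: nat where "x / K < real N" using reals_Archimedean2 by blast
    then have "x < K * real N" using assms by (simp add: field_simps)
    then show ?thesis using that by (auto simp: ennreal_less_iff)
  qed
  ultimately show ?thesis
    by (cases "\<integral>\<^sup>+w. ennreal (K / w) * indicator {0<..<\<delta>} w \<partial>lborel") (auto simp: not_le[symmetric])
qed

text \<open>
  The region lies between \<open>sqrt e(w)\<close> and the fourth root of \<open>e(w)\<close>; the integral of \<open>1 / u\<close> over this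
  range is exactly \<open>1 / (4 w ^ k)\<close>, and \<open>k = 2 n + 1\<close> leaves \<open>1 / w\<close> after multiplication with the weight.
\<close>

lemma nn_integral_cusp_region:
  fixes K \<delta> :: real and k n :: nat
  assumes \<delta>: "\<delta> > 0" and K: "K > 0" and k: "k = 2 * n + 1"
  shows "(\<integral>\<^sup>+z. (if 0 < fst z \<and> fst z < \<delta> \<and> exp (- (inverse (fst z) ^ k) / 2) \<le> snd z
             \<and> snd z \<le> exp (- (inverse (fst z) ^ k) / 4)
           then ennreal (K * fst z ^ (2 * n) / snd z) else 0) \<partial>lborel) = \<infinity>"
    (is "(\<integral>\<^sup>+z. ?g z \<partial>lborel) = \<infinity>")
proof -
  have [measurable]: "?g \<in> borel_measurable (lborel \<Otimes>\<^sub>M lborel)" by measurable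
  have "(\<integral>\<^sup>+u. ?g (w, u) \<partial>lborel) = ennreal (K / 4 / w) * indicator {0<..<\<delta>} w" for w
  proof (cases "0 < w \<and> w < \<delta>")
    case True
    define a where "a = exp (- (inverse w ^ k) / 2)"
    define b where "b = exp (- (inverse w ^ k) / 4)"
    have ab: "0 < a" "a \<le> b" using True by (auto simp: a_def b_def)
    have "(\<integral>\<^sup>+u. ?g (w, u) \<partial>lborel) = (\<integral>\<^sup>+u. ennreal (K * w ^ (2 * n) / u) * indicator {a..b} u \<partial>lborel)"
      using True by (intro nn_integral_cong) (auto simp: a_def b_def)
    also have "\<dots> = ennreal (K * w ^ (2 * n) * ln b - K * w ^ (2 * n) * ln a)"
      using ab K True
      by (intro nn_integral_FTC_Icc) (auto intro!: derivative_eq_intros DERIV_isCont)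
    also have "K * w ^ (2 * n) * ln b - K * w ^ (2 * n) * ln a = K / 4 / w"
      using True unfolding a_def b_def k by (simp add: field_simps power_inverse)
    finally show ?thesis using True by simp
  next
    case False
    then have "?g (w, u) = 0" for u by auto
    then have "(\<integral>\<^sup>+u. ?g (w, u) \<partial>lborel) = 0" by simp
    then show ?thesis using False by simp
  qed
  then have "(\<integral>\<^sup>+z. ?g z \<partial>(lborel \<Otimes>\<^sub>M lborel)) = (\<integral>\<^sup>+w. ennreal (K / 4 / w) * indicator {0<..<\<delta>} w \<partial>lborel)"
    by (subst lborel.nn_integral_fst[symmetric]) auto
  also have "\<dots> = \<infinity>" using nn_integral_inverse_near_0[OF \<delta>, of "K / 4"] K by simp
  finally show ?thesis by (simp only: lborel_prod)
qed

text \<open>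
  If the values were bounded, then by Fatou's lemma the integral at the critical exponent would be
  finite; but it is at least the integral over the cusp region, on which \<open>|F|\<close> is comparable to the
  monomial.
\<close>

lemma local_zeta_unbounded:
  fixes F \<phi> :: "real \<times> real \<Rightarrow> real" and n m k :: nat and A \<kappa> \<delta> :: real and t :: "nat \<Rightarrow> real"
  assumes [measurable]: "F \<in> borel_measurable borel" "\<phi> \<in> borel_measurable borel"
    and m: "m > 0" and k: "k = 2 * n + 1"
    and \<phi>: "\<And>z. \<phi> z \<ge> 0"
    and int: "\<And>i. integrable lborel (\<lambda>z. complex_of_real \<bar>F z\<bar> powr of_real (t i) * complex_of_real (\<phi> z))"
    and t: "t \<longlonglongrightarrow> - (1 / m)"
    and region: "\<And>w u. 0 < w \<Longrightarrow> w < \<delta> \<Longrightarrow> exp (- (inverse w ^ k) / 2) \<le> u \<Longrightarrow> u \<le> exp (- (inverse w ^ k) / 4)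
        \<Longrightarrow> 0 < \<bar>F (w, u)\<bar> \<and> \<bar>F (w, u)\<bar> \<le> A * w ^ n * u ^ m \<and> \<kappa> * w ^ (2 * n) \<le> \<phi> (w, u)"
    and pos: "0 < A" "0 < \<kappa>" "0 < \<delta>" "\<delta> \<le> 1"
  shows "\<not> Bseq (\<lambda>i. local_zeta F \<phi> (of_real (t i)))"
proof
  assume "Bseq (\<lambda>i. local_zeta F \<phi> (of_real (t i)))"
  then obtain B where B: "\<And>i. norm (local_zeta F \<phi> (of_real (t i))) \<le> B" using BseqE by blast
  let ?h = "\<lambda>s z. \<bar>F z\<bar> powr s * \<phi> z"
  have cplx: "complex_of_real \<bar>F z\<bar> powr of_real s * complex_of_real (\<phi> z) = of_real (?h s z)" for s z
    by (simp add: powr_of_real)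
  have inth: "integrable lborel (?h (t i))" for i
    using int[of i] unfolding cplx by (simp only: complex_of_real_integrable_eq)
  have "(\<integral>\<^sup>+z. ennreal (?h (t i) z) \<partial>lborel) \<le> ennreal B" for i
  proof -
    have "local_zeta F \<phi> (of_real (t i)) = of_real (LINT z|lborel. ?h (t i) z)"
      unfolding local_zeta_def cplx by (rule integral_complex_of_real)
    then have "\<bar>LINT z|lborel. ?h (t i) z\<bar> \<le> B" using B[of i] by (simp only: norm_of_real)
    moreover have "(\<integral>\<^sup>+z. ennreal (?h (t i) z) \<partial>lborel) = ennreal (LINT z|lborel. ?h (t i) z)"
      by (rule nn_integral_eq_integral[OF inth]) (use \<phi> in simp)
    ultimately show ?thesis by (simp add: ennreal_leI)
  qed
  then have "liminf (\<lambda>i. \<integral>\<^sup>+z. ennreal (?h (t i) z) \<partial>lborel) \<le> liminf (\<lambda>i::nat. ennreal B)"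
    by (intro Liminf_mono) auto
  then have "liminf (\<lambda>i. \<integral>\<^sup>+z. ennreal (?h (t i) z) \<partial>lborel) \<le> ennreal B"
    by (simp add: Liminf_const)
  moreover have "(\<integral>\<^sup>+z. liminf (\<lambda>i. ennreal (?h (t i) z)) \<partial>lborel)
      \<le> liminf (\<lambda>i. \<integral>\<^sup>+z. ennreal (?h (t i) z) \<partial>lborel)"
    by (rule nn_integral_liminf) measurable
  moreover have "liminf (\<lambda>i. ennreal (?h (t i) z)) = ennreal (?h (- (1 / m)) z)" for z
  proof (rule lim_imp_Liminf)
    show "(\<lambda>i. ennreal (?h (t i) z)) \<longlonglongrightarrow> ennreal (?h (- (1 / m)) z)"
    proof (cases "F z = 0")
      case False
      then show ?thesis by (intro tendsto_intros tendsto_powr t) auto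
    qed simp
  qed simp
  ultimately have le: "(\<integral>\<^sup>+z. ennreal (?h (- (1 / m)) z) \<partial>lborel) \<le> ennreal B" by simp
  define K where "K = A powr - (1 / m) * \<kappa>"
  have K: "K > 0" using pos by (simp add: K_def)
  have "\<infinity> = (\<integral>\<^sup>+z. (if 0 < fst z \<and> fst z < \<delta> \<and> exp (- (inverse (fst z) ^ k) / 2) \<le> snd z
             \<and> snd z \<le> exp (- (inverse (fst z) ^ k) / 4)
           then ennreal (K * fst z ^ (2 * n) / snd z) else 0) \<partial>lborel)"
    using nn_integral_cusp_region[OF pos(3) K k] by simp
  also have "\<dots> \<le> (\<integral>\<^sup>+z. ennreal (?h (- (1 / m)) z) \<partial>lborel)"
  proof (rule nn_integral_mono)
    fix z :: "real \<times> real"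
    obtain w u where z: "z = (w, u)" by force
    show "(if 0 < fst z \<and> fst z < \<delta> \<and> exp (- (inverse (fst z) ^ k) / 2) \<le> snd z
             \<and> snd z \<le> exp (- (inverse (fst z) ^ k) / 4)
           then ennreal (K * fst z ^ (2 * n) / snd z) else 0) \<le> ennreal (?h (- (1 / m)) z)"
    proof (cases "0 < w \<and> w < \<delta> \<and> exp (- (inverse w ^ k) / 2) \<le> u \<and> u \<le> exp (- (inverse w ^ k) / 4)")
      case True
      then have u: "u > 0" using exp_gt_zero[of "- (inverse w ^ k) / 2"] by linarith
      note r = region[of w u] True
      have w: "0 < w" "w \<le> 1" using True pos by auto
      have "K * w ^ (2 * n) / u = A powr - (1 / m) * (1 / u) * (\<kappa> * w ^ (2 * n))"
        by (simp add: K_def)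
      also have "\<dots> \<le> \<bar>F z\<bar> powr - (1 / m) * \<phi> z"
      proof (rule mult_mono)
        have "1 / u = (u ^ m) powr - (1 / m)"
          using u m by (simp add: powr_realpow[symmetric] powr_powr powr_minus_divide)
        moreover have "1 \<le> (w ^ n) powr - (1 / m)"
        proof -
          have "1 = 1 powr - (1 / real m)" by simp
          also have "\<dots> \<le> (w ^ n) powr - (1 / m)"
            using w by (intro powr_mono2') (auto simp: power_le_one)
          finally show ?thesis .
        qed
        ultimately have "A powr - (1 / m) * (1 / u) \<le> A powr - (1 / m) * ((w ^ n) powr - (1 / m) * (u ^ m) powr - (1 / m))"
          using u by (intro mult_left_mono) (auto simp: mult_le_cancel_right1)
        also have "\<dots> = (A * w ^ n * u ^ m) powr - (1 / m)"
          using pos w u by (simp add: powr_mult)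
        also have "\<dots> \<le> \<bar>F z\<bar> powr - (1 / m)"
          using r z by (intro powr_mono2') auto
        finally show "A powr - (1 / m) * (1 / u) \<le> \<bar>F z\<bar> powr - (1 / m)" .
      qed (use r z pos w in auto)
      finally show ?thesis using True z by (simp add: ennreal_leI)
    qed (use z in auto)
  qed
  finally show False using le by (simp add: top_unique)
qed

text \<open>
  The two preceding estimates contradict \<open>meromorphic_continuation_slow_imp_bounded\<close>.
\<close>

theorem flat_perturbation_not_continuable:
  fixes F \<phi> :: "real \<times> real \<Rightarrow> real" and n m k :: nat and R M C A \<kappa> \<delta> \<rho> :: real
  assumes meas: "F \<in> borel_measurable borel" "\<phi> \<in> borel_measurable borel"
    and m: "m \<ge> 2" and k: "k = 2 * n + 1"
    and supp: "\<And>z. \<phi> z \<noteq> 0 \<Longrightarrow> \<bar>fst z\<bar> \<le> R \<and> \<bar>snd z\<bar> \<le> R \<and> \<bar>F z\<bar> \<le> M" and R: "R \<ge> 1" and M: "M \<ge> 1"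
    and \<phi>: "\<And>z. \<phi> z \<ge> 0" "\<And>w u. \<phi> (w, u) \<le> C * \<bar>w\<bar> ^ (2 * n)"
    and lower: "\<And>w u. \<bar>w\<bar> ^ n * \<bar>u\<bar> ^ m \<le> \<bar>F (w, u)\<bar>"
      "\<And>w u. \<bar>w\<bar> ^ n * \<bar>u\<bar> ^ (m - 2) * flat_exp k w \<le> \<bar>F (w, u)\<bar>"
    and region: "\<And>w u. 0 < w \<Longrightarrow> w < \<delta> \<Longrightarrow> exp (- (inverse w ^ k) / 2) \<le> u \<Longrightarrow> u \<le> exp (- (inverse w ^ k) / 4)
        \<Longrightarrow> \<bar>F (w, u)\<bar> \<le> A * w ^ n * u ^ m \<and> \<kappa> * w ^ (2 * n) \<le> \<phi> (w, u)"
    and pos: "0 < A" "0 < \<kappa>" "0 < \<delta>" "\<delta> \<le> 1" and \<rho>: "\<rho> > 1 / m"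
  shows "\<not> zeta_continues F \<phi> \<rho>"
proof
  assume "zeta_continues F \<phi> \<rho>"
  then obtain D Z where D: "open D" "{s. Re s > - \<rho>} \<subseteq> D" "Z meromorphic_on D"
    and Z: "\<And>s. Re s > 0 \<Longrightarrow> Z s = local_zeta F \<phi> s"
    unfolding zeta_continues_def by blast
  define \<epsilon> where "\<epsilon> = (\<lambda>i::nat. 1 / m * inverse (real (Suc (Suc i))))"
  define t where "t = (\<lambda>i. - (1 / m) + \<epsilon> i)"
  have c: "0 < 1 / real m" using m by simp
  have \<epsilon>: "0 < \<epsilon> i" "\<epsilon> i < 1 / m" for i
  proof -
    show "0 < \<epsilon> i" using m by (simp add: \<epsilon>_def)
    have "1 / real m * inverse (real (Suc (Suc i))) < 1 / real m * 1"
      using c by (intro mult_strict_left_mono) (auto simp: inverse_less_1_iff)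
    then show "\<epsilon> i < 1 / m" by (simp add: \<epsilon>_def)
  qed
  have "(\<lambda>i. 1 / m * inverse (real (Suc (Suc i)))) \<longlonglongrightarrow> 1 / m * 0"
    by (intro tendsto_intros LIMSEQ_Suc[OF LIMSEQ_inverse_real_of_nat])
  then have \<epsilon>0: "\<epsilon> \<longlonglongrightarrow> 0" by (simp add: \<epsilon>_def)
  have "t \<longlonglongrightarrow> - (1 / m) + 0" unfolding t_def by (intro tendsto_intros \<epsilon>0)
  then have tl: "t \<longlonglongrightarrow> - (1 / m)" by simp
  have t: "t i > - (1 / m)" "t i < 0" for i using \<epsilon>[of i] by (auto simp: t_def)
  have R0: "R > 0" using R by simp
  have \<phi>': "\<bar>\<phi> (w, u)\<bar> \<le> C * \<bar>w\<bar> ^ (2 * n)" "\<bar>\<phi> (w, u)\<bar> \<le> C * \<bar>w\<bar> ^ (2 * n) * \<bar>u\<bar> ^ 0" for w u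
    using \<phi>(1)[of "(w, u)"] \<phi>(2)[of w u] by auto
  have cn: "1 / m * real n \<le> real (2 * n + 1)"
  proof -
    have "1 / m * real n \<le> 1 * real n" using m by (intro mult_right_mono) auto
    then show ?thesis by simp
  qed
  have cm: "1 / m * real m \<le> real (0 + 1)" using m by simp
  note zeta = local_zeta_holomorphic[OF meas supp R0 M \<phi>'(2) lower(1) c cn cm]
    local_zeta_integrable[OF meas supp R0 M \<phi>'(2) lower(1) c cn cm]
  have "Bseq (\<lambda>i. local_zeta F \<phi> (of_real (t i)))"
  proof (rule meromorphic_continuation_slow_imp_bounded[OF D(3,1,2) c \<rho> zeta(1) Z t(1) tl])
    show "(\<lambda>i. of_real (t i + 1 / m) * local_zeta F \<phi> (of_real (t i))) \<longlonglongrightarrow> 0"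
    proof (rule tendsto_0_by_two_parameter_bound[OF _ \<epsilon>0])
      fix \<eta> :: real assume \<eta>: "0 < \<eta>" "\<eta> \<le> 1"
      show "\<exists>K. \<forall>i. norm (of_real (t i + 1 / m) * local_zeta F \<phi> (of_real (t i)))
          \<le> C * R ^ (2 * n) * (4 * R / m) * \<eta> + K * \<epsilon> i"
        using local_zeta_slow[OF meas m supp R M \<phi>'(1) lower t \<eta>]
        by (intro exI[of _ "C * R ^ (2 * n) * (flat_exp k \<eta> powr - (1 / m)) * (2 * R\<^sup>2 * m)"]) (simp add: t_def)
    qed
  qed
  moreover have "\<not> Bseq (\<lambda>i. local_zeta F \<phi> (of_real (t i)))"
  proof (rule local_zeta_unbounded[OF meas _ k \<phi>(1) _ tl _ pos])
    fix w u :: real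
    assume wu: "0 < w" "w < \<delta>" "exp (- (inverse w ^ k) / 2) \<le> u" "u \<le> exp (- (inverse w ^ k) / 4)"
    then have "u > 0" using exp_gt_zero[of "- (inverse w ^ k) / 2"] by linarith
    then have "0 < \<bar>w\<bar> ^ n * \<bar>u\<bar> ^ m" using wu by simp
    then show "0 < \<bar>F (w, u)\<bar> \<and> \<bar>F (w, u)\<bar> \<le> A * w ^ n * u ^ m \<and> \<kappa> * w ^ (2 * n) \<le> \<phi> (w, u)"
      using lower(1)[of w u] region[OF wu] by linarith
  qed (use m zeta(2) t in auto)
  ultimately show False by contradiction
qed

section \<open>Comparison with the monomial\<close>

lemma norm_exp_minus_one_le: "norm (exp z - 1) \<le> norm z * exp (norm z)" for z :: complex
proof -
  have "norm (exp z - exp 0) \<le> exp (norm z) * norm (z - 0)"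
  proof (rule field_differentiable_bound[of "cball 0 (norm z)" exp exp])
    fix w :: complex assume "w \<in> cball 0 (norm z)"
    then show "norm (exp w) \<le> exp (norm z)" using order_trans[OF norm_exp] by force
  qed (auto intro: DERIV_subset[OF DERIV_exp])
  then show ?thesis by (simp add: mult.commute)
qed

text \<open>
  With \<open>q = (A - B) / B\<close>, the difference is at most of order \<open>q\<close> relative to the size of the powers when
  \<open>q < 1\<close>, and trivially of order 1 otherwise; both are absorbed by \<open>q powr \<delta>\<close>. The exponent \<open>\<delta>\<close> is
  free so that the loss in \<open>1 / x ^ 2\<close> in the application can be made small.
\<close>

lemma norm_powr_diff_le:
  fixes A B M \<sigma>\<^sub>1 \<sigma>\<^sub>2 N \<delta> :: real
  assumes AB: "0 < B" "B \<le> A" "A \<le> M" "1 \<le> M"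
    and s: "\<sigma>\<^sub>1 \<le> Re s" "Re s \<le> \<sigma>\<^sub>2" "norm s \<le> N" and \<sigma>: "\<sigma>\<^sub>1 \<le> 0" "0 \<le> \<sigma>\<^sub>2" and \<delta>: "0 < \<delta>" "\<delta> \<le> 1"
  shows "norm (complex_of_real A powr s - complex_of_real B powr s)
    \<le> (2 + N * exp N) * (B powr \<sigma>\<^sub>1 * ((A - B) / B) powr \<delta> + M powr \<sigma>\<^sub>2)"
proof -
  define q where "q = (A - B) / B"
  have q: "q \<ge> 0" using AB by (simp add: q_def)
  have A: "A = B * (1 + q)" using AB by (simp add: q_def field_simps)
  have N: "N \<ge> 0" using s norm_ge_zero order_trans by blast
  have bA: "A powr Re s \<le> B powr \<sigma>\<^sub>1 + M powr \<sigma>\<^sub>2" by (rule powr_between_le) (use AB s \<sigma> in auto)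
  have bB: "B powr Re s \<le> B powr \<sigma>\<^sub>1 + M powr \<sigma>\<^sub>2" by (rule powr_between_le) (use AB s \<sigma> in auto)
  show ?thesis
  proof (cases "q \<ge> 1")
    case True
    have "norm (complex_of_real A powr s - complex_of_real B powr s) \<le> A powr Re s + B powr Re s"
      using norm_triangle_ineq4[of "complex_of_real A powr s" "complex_of_real B powr s"] AB
      by (simp add: norm_of_real_powr)
    also have "\<dots> \<le> 2 * (B powr \<sigma>\<^sub>1 * 1 + M powr \<sigma>\<^sub>2)" using bA bB by simp
    also have "\<dots> \<le> 2 * (B powr \<sigma>\<^sub>1 * q powr \<delta> + M powr \<sigma>\<^sub>2)"
      using True \<delta> by (intro mult_left_mono add_mono) (auto intro: ge_one_powr_ge_zero)
    also have "\<dots> \<le> (2 + N * exp N) * (B powr \<sigma>\<^sub>1 * q powr \<delta> + M powr \<sigma>\<^sub>2)"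
      using N by (intro mult_right_mono) auto
    finally show ?thesis unfolding q_def .
  next
    case False
    have "complex_of_real A powr s = complex_of_real B powr s * complex_of_real (1 + q) powr s"
      using AB q unfolding A of_real_mult by (intro powr_times_real) auto
    also have "complex_of_real (1 + q) powr s = exp (s * of_real (ln (1 + q)))"
      using q by (simp add: powr_def flip: of_real_add Ln_of_real)
    finally have "complex_of_real A powr s - complex_of_real B powr s
       = complex_of_real B powr s * (exp (s * of_real (ln (1 + q))) - 1)" by (simp add: algebra_simps)
    then have "norm (complex_of_real A powr s - complex_of_real B powr s)
       = B powr Re s * norm (exp (s * of_real (ln (1 + q))) - 1)"
      using AB by (simp add: norm_mult norm_of_real_powr)
    also have "\<dots> \<le> (B powr \<sigma>\<^sub>1 + M powr \<sigma>\<^sub>2) * (N * exp N * q powr \<delta>)"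
    proof (rule mult_mono[OF bB])
      have l: "0 \<le> ln (1 + q)" "ln (1 + q) \<le> q" using q by (auto intro: ln_add_one_self_le_self)
      then have n: "norm (s * complex_of_real (ln (1 + q))) \<le> N * q"
        unfolding norm_mult using s N by (intro mult_mono) auto
      have "N * q \<le> N" using False N q by (simp add: mult_left_le)
      have "norm (exp (s * of_real (ln (1 + q))) - 1) \<le> N * q * exp N"
        by (rule order_trans[OF norm_exp_minus_one_le], intro mult_mono) (use n \<open>N * q \<le> N\<close> N q in auto)
      also have "q \<le> q powr \<delta>" using False q \<delta> powr_mono'[of \<delta> 1 q] by (cases "q = 0") auto
      then have "N * q * exp N \<le> N * exp N * q powr \<delta>" using N mult_left_mono[of q "q powr \<delta>" "N * exp N"] by (simp add: mult_ac)
      finally show "norm (exp (s * of_real (ln (1 + q))) - 1) \<le> N * exp N * q powr \<delta>" .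
    qed auto
    also have "\<dots> = N * exp N * (B powr \<sigma>\<^sub>1 * q powr \<delta> + M powr \<sigma>\<^sub>2 * q powr \<delta>)"
      by (simp add: algebra_simps)
    also have "\<dots> \<le> N * exp N * (B powr \<sigma>\<^sub>1 * q powr \<delta> + M powr \<sigma>\<^sub>2)"
    proof -
      have "q powr \<delta> \<le> 1" using False q \<delta> by (intro powr_le1) auto
      then show ?thesis using N by (intro mult_left_mono add_left_mono mult_left_le) auto
    qed
    also have "\<dots> \<le> (2 + N * exp N) * (B powr \<sigma>\<^sub>1 * q powr \<delta> + M powr \<sigma>\<^sub>2)"
      by (intro mult_right_mono) auto
    finally show ?thesis unfolding q_def .
  qed
qed

text \<open>
  Here \<open>q = e(y) / x ^ 2\<close>. A power \<open>e(y) powr \<delta>\<close> beats every negative power of \<open>y\<close>, and the price is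
  \<open>|x| powr (- 2 \<delta>)\<close>, which is affordable for small \<open>\<delta>\<close> because \<open>a \<sigma> > - 1\<close>.
\<close>

lemma local_zeta_difference_holomorphic:
  fixes f f0 \<phi> :: "real \<times> real \<Rightarrow> real" and a b k :: nat
  assumes [measurable]: "f \<in> borel_measurable borel" "f0 \<in> borel_measurable borel" "\<phi> \<in> borel_measurable borel"
    and a: "a \<ge> 1" and k: "k \<ge> b"
    and supp: "\<And>z. \<phi> z \<noteq> 0 \<Longrightarrow> \<bar>fst z\<bar> \<le> R \<and> \<bar>snd z\<bar> \<le> R \<and> \<bar>f z\<bar> \<le> M" and R: "R \<ge> 1" and M: "M \<ge> 1"
    and \<phi>: "\<And>z. \<bar>\<phi> z\<bar> \<le> C"
    and f0: "\<And>x y. \<bar>f0 (x, y)\<bar> = \<bar>x\<bar> ^ a * \<bar>y\<bar> ^ b"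
    and f: "\<And>x y. x \<noteq> 0 \<Longrightarrow> \<bar>f (x, y)\<bar> = \<bar>x\<bar> ^ a * \<bar>y\<bar> ^ b * (1 + flat_exp k y / x\<^sup>2)"
  shows "(\<lambda>s. LINT z|lborel. (complex_of_real \<bar>f z\<bar> powr s - complex_of_real \<bar>f0 z\<bar> powr s) * complex_of_real (\<phi> z))
     holomorphic_on {s. Re s > - (1 / a)}"
proof (rule holomorphic_on_right_halfplane_integral(1))
  fix \<sigma>\<^sub>1 \<sigma>\<^sub>2 N :: real assume \<sigma>: "- (1 / a) < \<sigma>\<^sub>1" "\<sigma>\<^sub>1 \<le> 0" "0 \<le> \<sigma>\<^sub>2"
  define N' where "N' = max N 0"
  define K where "K = (2 + N' * exp N') * C"
  have "0 \<le> \<bar>\<phi> 0\<bar>" by simp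
  also have "\<dots> \<le> C" by (rule \<phi>)
  finally have C: "C \<ge> 0" .
  have K: "K \<ge> 0" using C by (simp add: K_def N'_def)
  have a\<sigma>: "a * \<sigma>\<^sub>1 > -1" using \<sigma>(1) a by (simp add: field_simps)
  have \<sigma>1: "\<sigma>\<^sub>1 > -1"
  proof -
    have "1 / real a \<le> 1" using a by simp
    then show ?thesis using \<sigma>(1) by linarith
  qed
  \<comment> \<open>Small enough that \<open>|x| powr (a \<sigma>\<^sub>1 - 2 \<delta>)\<close> is still integrable at 0.\<close>
  define \<delta> where "\<delta> = min 1 ((1 + a * \<sigma>\<^sub>1) / 4)"
  have \<delta>: "0 < \<delta>" "\<delta> \<le> 1" using a\<sigma> by (auto simp: \<delta>_def)
  have "\<delta> \<le> (1 + a * \<sigma>\<^sub>1) / 4" unfolding \<delta>_def by (rule min.cobounded2)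
  moreover have "A - 2 * \<delta> > -1" if "\<delta> \<le> (1 + A) / 4" "A > -1" for A
    using that by (simp add: field_simps)
  ultimately have \<delta>a: "a * \<sigma>\<^sub>1 - 2 * \<delta> > -1" using a\<sigma> by blast
  define w where "w = (\<lambda>z. K * (R ^ k / \<delta>) * (cut_powr R (a * \<sigma>\<^sub>1 - 2 * \<delta>) (fst z) * indicator {-R..R} (snd z))
      + K * M powr \<sigma>\<^sub>2 * (indicator {-R..R} (fst z) * indicator {-R..R} (snd z)))"
  have ind: "integrable lborel (indicator {-R..R} :: real \<Rightarrow> real)"
    by (rule integrable_real_indicator) (use R in auto)
  have "integrable lborel (cut_powr R (a * \<sigma>\<^sub>1 - 2 * \<delta>))"
    using has_bochner_integral_cut_powr[OF \<delta>a, of R] R by (simp add: has_bochner_integral_iff)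
  then have w: "integrable lborel w"
    unfolding w_def by (intro Bochner_Integration.integrable_add integrable_mult_right integral_product_lborel ind)
  moreover have "AE z in lborel. \<forall>s. \<sigma>\<^sub>1 \<le> Re s \<and> Re s \<le> \<sigma>\<^sub>2 \<and> norm s \<le> N \<longrightarrow>
      norm ((complex_of_real \<bar>f z\<bar> powr s - complex_of_real \<bar>f0 z\<bar> powr s) * complex_of_real (\<phi> z)) \<le> w z"
    using AE_coordinates_nonzero
  proof (eventually_elim, intro allI impI)
    fix z :: "real \<times> real" and s assume z: "fst z \<noteq> 0 \<and> snd z \<noteq> 0" and s: "\<sigma>\<^sub>1 \<le> Re s \<and> Re s \<le> \<sigma>\<^sub>2 \<and> norm s \<le> N"
    obtain x y where xy: "z = (x, y)" by force
    have nz: "x \<noteq> 0" "y \<noteq> 0" using z xy by auto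
    show "norm ((complex_of_real \<bar>f z\<bar> powr s - complex_of_real \<bar>f0 z\<bar> powr s) * complex_of_real (\<phi> z)) \<le> w z"
    proof (cases "\<phi> z = 0")
      case True
      then show ?thesis using K \<delta> R by (auto simp: w_def cut_powr_nonneg intro!: add_nonneg_nonneg mult_nonneg_nonneg)
    next
      case False
      then have b: "\<bar>x\<bar> \<le> R" "\<bar>y\<bar> \<le> R" "\<bar>f z\<bar> \<le> M" using supp xy by auto
      define B where "B = \<bar>x\<bar> ^ a * \<bar>y\<bar> ^ b"
      define e where "e = flat_exp k y"
      have e: "e > 0" using nz by (simp add: e_def flat_exp_def)
      have B: "B > 0" using nz by (simp add: B_def)
      have fB: "\<bar>f z\<bar> = B * (1 + e / x\<^sup>2)" using f[OF nz(1)] xy by (simp add: B_def e_def)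
      have "\<bar>f z\<bar> - B = B * (e / x\<^sup>2)" unfolding fB by (simp add: algebra_simps)
      then have q: "(\<bar>f z\<bar> - B) / B = e / x\<^sup>2" using B by simp
      have "B \<le> \<bar>f z\<bar>" unfolding fB using B e by (simp add: mult_le_cancel_left1)
      then have "norm (complex_of_real \<bar>f z\<bar> powr s - complex_of_real B powr s)
        \<le> (2 + N' * exp N') * (B powr \<sigma>\<^sub>1 * (e / x\<^sup>2) powr \<delta> + M powr \<sigma>\<^sub>2)"
        unfolding q[symmetric] using B b M s \<sigma> \<delta> by (intro norm_powr_diff_le) (auto simp: N'_def)
      also have "B powr \<sigma>\<^sub>1 * (e / x\<^sup>2) powr \<delta> \<le> \<bar>x\<bar> powr (a * \<sigma>\<^sub>1 - 2 * \<delta>) * (R ^ k / \<delta>)"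
      proof -
        have pw: "(\<bar>x\<bar> ^ j) powr t = \<bar>x\<bar> powr (j * t)" if "x \<noteq> 0" for x t :: real and j
          using that by (simp add: powr_powr powr_realpow[symmetric])
        have "B powr \<sigma>\<^sub>1 * (e / x\<^sup>2) powr \<delta>
            = (\<bar>x\<bar> powr (a * \<sigma>\<^sub>1) / \<bar>x\<bar> powr (2 * \<delta>)) * (\<bar>y\<bar> powr (b * \<sigma>\<^sub>1) * e powr \<delta>)"
          using nz e pw[OF nz(1), of 2 \<delta>] unfolding B_def by (simp add: powr_mult powr_divide pw)
        also have "\<bar>x\<bar> powr (a * \<sigma>\<^sub>1) / \<bar>x\<bar> powr (2 * \<delta>) = \<bar>x\<bar> powr (a * \<sigma>\<^sub>1 - 2 * \<delta>)"
          by (simp add: powr_diff)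
        also have "\<bar>y\<bar> powr (b * \<sigma>\<^sub>1) * e powr \<delta> \<le> R ^ k / \<delta>"
        proof -
          define v where "v = \<delta> * inverse \<bar>y\<bar> ^ k"
          have v: "v > 0" using \<delta> nz by (simp add: v_def)
          have "e powr \<delta> = exp (- v)"
            using nz by (simp add: e_def flat_exp_def v_def powr_def)
          also have "\<dots> \<le> 1 / v"
          proof -
            have "v \<le> exp v" using exp_ge_add_one_self[of v] by linarith
            then show ?thesis using v by (simp add: exp_minus divide_simps)
          qed
          also have "\<dots> = \<bar>y\<bar> powr k / \<delta>"
            using nz by (simp add: v_def powr_realpow power_inverse field_simps)
          finally have "\<bar>y\<bar> powr (b * \<sigma>\<^sub>1) * e powr \<delta> \<le> \<bar>y\<bar> powr (b * \<sigma>\<^sub>1) * (\<bar>y\<bar> powr k / \<delta>)"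
            by (intro mult_left_mono) auto
          also have "\<dots> = \<bar>y\<bar> powr (b * \<sigma>\<^sub>1 + k) / \<delta>" by (simp add: powr_add)
          also have "\<bar>y\<bar> powr (b * \<sigma>\<^sub>1 + k) \<le> R powr (b * \<sigma>\<^sub>1 + k)"
          proof (rule powr_mono2)
            have "real b * \<sigma>\<^sub>1 \<ge> real b * (-1)" using \<sigma>1 by (intro mult_left_mono) auto
            then show "0 \<le> b * \<sigma>\<^sub>1 + k" using k by simp
          qed (use b in auto)
          also have "\<dots> \<le> R powr k" using R \<sigma> by (intro powr_mono) (auto simp: mult_nonneg_nonpos)
          finally show ?thesis using R \<delta> by (simp add: powr_realpow divide_right_mono)
        qed
        finally show ?thesis by (simp add: mult_left_mono)
      qed
      finally have n: "norm (complex_of_real \<bar>f z\<bar> powr s - complex_of_real B powr s)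
        \<le> (2 + N' * exp N') * (\<bar>x\<bar> powr (a * \<sigma>\<^sub>1 - 2 * \<delta>) * (R ^ k / \<delta>) + M powr \<sigma>\<^sub>2)"
        by (simp add: N'_def mult_left_mono)
      have "norm ((complex_of_real \<bar>f z\<bar> powr s - complex_of_real \<bar>f0 z\<bar> powr s) * complex_of_real (\<phi> z))
         = norm (complex_of_real \<bar>f z\<bar> powr s - complex_of_real B powr s) * \<bar>\<phi> z\<bar>"
        using f0[of x y] xy by (simp add: norm_mult B_def)
      also have "\<dots> \<le> ((2 + N' * exp N') * (\<bar>x\<bar> powr (a * \<sigma>\<^sub>1 - 2 * \<delta>) * (R ^ k / \<delta>) + M powr \<sigma>\<^sub>2)) * C"
        using n \<phi> order_trans[OF norm_ge_zero n] by (intro mult_mono) (simp_all del: split_paired_All)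
      also have "\<dots> = w z"
        using b nz unfolding w_def xy K_def by (simp add: cut_powr_def indicator_def abs_le_iff add_divide_distrib algebra_simps)
      finally show ?thesis .
    qed
  qed
  ultimately show "\<exists>w. integrable lborel w \<and> (AE z in lborel. \<forall>s. \<sigma>\<^sub>1 \<le> Re s \<and> Re s \<le> \<sigma>\<^sub>2 \<and> norm s \<le> N \<longrightarrow>
      norm ((complex_of_real \<bar>f z\<bar> powr s - complex_of_real \<bar>f0 z\<bar> powr s) * complex_of_real (\<phi> z)) \<le> w z)"
    by blast
next
  fix z
  show "(\<lambda>s. (complex_of_real \<bar>f z\<bar> powr s - complex_of_real \<bar>f0 z\<bar> powr s) * complex_of_real (\<phi> z))
     holomorphic_on {s. Re s > - (1 / a)}"
    by (intro holomorphic_intros of_real_powr_holomorphic)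
qed (use a in \<open>measurable, simp\<close>)

section \<open>Continuation for the monomial by integration by parts\<close>

definition partial_y :: "(real \<times> real \<Rightarrow> real) \<Rightarrow> real \<times> real \<Rightarrow> real" where
  "partial_y \<phi> z = frechet_derivative \<phi> (at z) (0, 1)"

lemma partial_y_test_function:
  assumes "\<phi> \<in> test_functions U"
  shows "partial_y \<phi> \<in> test_functions U"
proof -
  let ?K = "closure {z. \<phi> z \<noteq> 0}"
  have sm: "smooth_on UNIV \<phi>" and K: "compact ?K" "?K \<subseteq> U" using assms by (auto simp: test_functions_def)
  have "partial_y \<phi> z = 0" if "z \<notin> ?K" for z
  proof -
    have "((\<lambda>_. 0) has_derivative (\<lambda>_. 0)) (at z)" by simp
    then have "(\<phi> has_derivative (\<lambda>_. 0)) (at z)"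
    proof (rule has_derivative_transform_within_open[OF _ open_Compl[OF closed_closure]])
      show "z \<in> - ?K" using that by simp
      show "0 = \<phi> y" if "y \<in> - ?K" for y using that closure_subset[of "{z. \<phi> z \<noteq> 0}"] by auto
    qed
    then have "frechet_derivative \<phi> (at z) = (\<lambda>_. 0)" using frechet_derivative_at by metis
    then show ?thesis by (simp add: partial_y_def)
  qed
  then have "closure {z. partial_y \<phi> z \<noteq> 0} \<subseteq> ?K" by (intro closure_minimal) auto
  moreover from this have "compact (closure {z. partial_y \<phi> z \<noteq> 0})"
    using compact_Int_closed[OF K(1) closed_closure[of "{z. partial_y \<phi> z \<noteq> 0}"]]
    by (simp add: Int_absorb1)
  moreover have "smooth_on UNIV (partial_y \<phi>)"
    using smooth_partial_derivative[OF sm, of "(0, 1)"] by (simp add: partial_y_def[abs_def])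
  ultimately show ?thesis using K by (auto simp: test_functions_def)
qed

lemma test_function_bounds:
  fixes \<phi> :: "real \<times> real \<Rightarrow> real"
  assumes "\<phi> \<in> test_functions U"
  obtains R C where "R \<ge> 1" "\<And>z. \<phi> z \<noteq> 0 \<Longrightarrow> \<bar>fst z\<bar> < R \<and> \<bar>snd z\<bar> < R" "\<And>z. \<bar>\<phi> z\<bar> \<le> C"
proof -
  let ?K = "closure {z. \<phi> z \<noteq> 0}"
  have sm: "smooth_on UNIV \<phi>" and K: "compact ?K" using assms by (auto simp: test_functions_def)
  obtain r where r: "\<And>z. z \<in> ?K \<Longrightarrow> norm z \<le> r"
    using compact_imp_bounded[OF K] unfolding bounded_iff by blast
  have "compact (\<phi> ` ?K)" by (intro compact_continuous_image smooth_imp_continuous_on sm K)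
  then obtain C where C: "\<And>z. z \<in> ?K \<Longrightarrow> \<bar>\<phi> z\<bar> \<le> C"
    using compact_imp_bounded[of "\<phi> ` ?K"] unfolding bounded_iff by auto
  show thesis
  proof (rule that[of "max 1 (r + 1)" "max C 0"])
    fix z assume "\<phi> z \<noteq> 0"
    then have "norm z \<le> r" by (intro r[OF subsetD[OF closure_subset]]) simp
    then show "\<bar>fst z\<bar> < max 1 (r + 1) \<and> \<bar>snd z\<bar> < max 1 (r + 1)"
      using norm_fst_le[of "fst z" "snd z"] norm_snd_le[of "snd z" "fst z"] by auto
  next
    fix z show "\<bar>\<phi> z\<bar> \<le> max C 0"
      using C[of z] closure_subset[of "{z. \<phi> z \<noteq> 0}"] by (cases "\<phi> z = 0") auto
  qed simp
qed

lemma continuous_bounded_on_box: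
  fixes f :: "real \<times> real \<Rightarrow> real"
  assumes "continuous_on UNIV f"
  obtains M where "M \<ge> 1" "\<And>z. \<bar>fst z\<bar> \<le> R \<Longrightarrow> \<bar>snd z\<bar> \<le> R \<Longrightarrow> \<bar>f z\<bar> \<le> M"
proof -
  have "compact (f ` ({-R..R} \<times> {-R..R}))"
    by (intro compact_continuous_image continuous_on_subset[OF assms] compact_Times) auto
  then obtain M where M: "\<And>z. z \<in> {-R..R} \<times> {-R..R} \<Longrightarrow> \<bar>f z\<bar> \<le> M"
    using compact_imp_bounded[of "f ` ({-R..R} \<times> {-R..R})"] unfolding bounded_iff by auto
  show thesis
  proof (rule that[of "max 1 M"])
    fix z :: "real \<times> real" assume "\<bar>fst z\<bar> \<le> R" "\<bar>snd z\<bar> \<le> R"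
    then have "z \<in> {-R..R} \<times> {-R..R}" by (cases z) (auto simp: abs_le_iff)
    then show "\<bar>f z\<bar> \<le> max 1 M" using M by fastforce
  qed simp
qed

lemma continuous_on_of_real_power_powr:
  assumes "Re s > 0"
  shows "continuous_on A (\<lambda>y::real. complex_of_real (\<bar>y\<bar> ^ b) powr s)"
  by (intro continuous_on_powr_complex continuous_intros) (use assms in auto)

lemma power_powr_has_vector_derivative:
  fixes y :: real
  assumes "y \<noteq> 0"
  shows "((\<lambda>y. complex_of_real (\<bar>y\<bar> ^ b) powr s) has_vector_derivative
     (of_nat b * s / of_real y) * (complex_of_real (\<bar>y\<bar> ^ b) powr s)) (at y)"
proof -
  have eq: "exp (s * of_real (b * ln \<bar>y\<bar>)) = complex_of_real (\<bar>y\<bar> ^ b) powr s" if "y \<noteq> 0" for y :: real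
  proof -
    have "Ln (complex_of_real (\<bar>y\<bar> ^ b)) = of_real (ln (\<bar>y\<bar> ^ b))"
      using that by (intro Ln_of_real) auto
    moreover have "ln (\<bar>y\<bar> ^ b) = b * ln \<bar>y\<bar>" using that by (simp add: ln_realpow)
    ultimately show ?thesis using that by (simp add: powr_def)
  qed
  have "((\<lambda>y. ln \<bar>y\<bar>) has_real_derivative 1 / y) (at y)"
  proof (cases "y > 0")
    case True
    have "(ln has_real_derivative 1 / y) (at y)" using True by (auto intro!: derivative_eq_intros)
    then show ?thesis
      by (rule has_field_derivative_transform_within_open[where S = "{0<..}"]) (use True in auto)
  next
    case False
    then have y: "y < 0" using assms by simp
    have "((\<lambda>y. ln (- y)) has_real_derivative 1 / y) (at y)" using y by (auto intro!: derivative_eq_intros)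
    then show ?thesis
      by (rule has_field_derivative_transform_within_open[where S = "{..<0}"]) (use y in auto)
  qed
  then have "((\<lambda>y. b * ln \<bar>y\<bar>) has_real_derivative b * (1 / y)) (at y)"
    by (rule DERIV_cmult)
  then have "((\<lambda>y. s * complex_of_real (b * ln \<bar>y\<bar>)) has_vector_derivative s * complex_of_real (b * (1 / y))) (at y)"
    by (intro has_vector_derivative_mult_right has_vector_derivative_of_real)
  moreover have "(exp has_field_derivative exp (s * complex_of_real (b * ln \<bar>y\<bar>))) (at (s * complex_of_real (b * ln \<bar>y\<bar>)))"
    by (rule DERIV_exp)
  ultimately have "((exp \<circ> (\<lambda>y. s * complex_of_real (b * ln \<bar>y\<bar>))) has_vector_derivative
      s * complex_of_real (b * (1 / y)) * exp (s * complex_of_real (b * ln \<bar>y\<bar>))) (at y)"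
    by (rule field_vector_diff_chain_at)
  then have "((\<lambda>y. exp (s * complex_of_real (b * ln \<bar>y\<bar>))) has_vector_derivative
      s * complex_of_real (b * (1 / y)) * exp (s * complex_of_real (b * ln \<bar>y\<bar>))) (at y)"
    by (simp add: o_def)
  then have "((\<lambda>y. complex_of_real (\<bar>y\<bar> ^ b) powr s) has_vector_derivative
      s * complex_of_real (b * (1 / y)) * exp (s * complex_of_real (b * ln \<bar>y\<bar>))) (at y)"
    by (rule has_vector_derivative_transform_within_open[where S = "- {0}"]) (use assms eq in auto)
  then show ?thesis using eq[OF assms] by (simp add: mult_ac divide_inverse)
qed

text \<open>
  The integrand is the derivative of \<open>y ^ (k + 1) |y| ^ (b s) g(y)\<close>, which has compact support. The
  derivative exists off \<open>y = 0\<close>, where the function is still continuous as \<open>Re s > 0\<close>. With \<open>y ^ k\<close>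
  in place of \<open>|y| ^ k\<close> the derivative has the same form on both sides of 0.
\<close>

lemma inner_integration_by_parts:
  fixes g g' :: "real \<Rightarrow> real" and b k :: nat
  assumes s: "Re s > 0"
    and g: "\<And>y. (g has_real_derivative g' y) (at y)" "continuous_on UNIV g'"
    and supp: "\<And>y. g y \<noteq> 0 \<Longrightarrow> \<bar>y\<bar> < R" "\<And>y. g' y \<noteq> 0 \<Longrightarrow> \<bar>y\<bar> < R" and R: "R > 0"
  shows "(LINT y|lborel. (of_nat b * s + of_nat (Suc k)) * (complex_of_real (\<bar>y\<bar> ^ b) powr s * of_real (y ^ k * g y))
        + complex_of_real (\<bar>y\<bar> ^ b) powr s * of_real (y ^ Suc k * g' y)) = 0"
    (is "(LINT y|lborel. ?h y) = 0")
proof -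
  let ?Q = "\<lambda>y::real. complex_of_real (\<bar>y\<bar> ^ b) powr s"
  let ?G = "\<lambda>y. ?Q y * complex_of_real (y ^ Suc k * g y)"
  have gc: "continuous_on UNIV g" using g(1) DERIV_isCont continuous_at_imp_continuous_on by blast
  note cont = continuous_on_of_real_power_powr[OF s]
  have "(?h has_integral ?G R - ?G (- R)) {-R..R}"
  proof (rule fundamental_theorem_of_calculus_interior_strong[of "{0}"])
    fix y assume "y \<in> {-R<..<R} - {0}"
    then have y: "y \<noteq> 0" by simp
    have "((\<lambda>y. y ^ Suc k * g y) has_real_derivative (real (Suc k) * y ^ k * g y + y ^ Suc k * g' y)) (at y)"
      using g(1)[of y] by (auto intro!: derivative_eq_intros simp del: power_Suc)
    then have "((\<lambda>y. complex_of_real (y ^ Suc k * g y)) has_vector_derivative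
        complex_of_real (real (Suc k) * y ^ k * g y + y ^ Suc k * g' y)) (at y)"
      by (rule has_vector_derivative_of_real)
    from has_vector_derivative_mult[OF power_powr_has_vector_derivative[OF y, of b s] this]
    have "(?G has_vector_derivative ?Q y * complex_of_real (real (Suc k) * y ^ k * g y + y ^ Suc k * g' y)
       + (of_nat b * s / of_real y) * ?Q y * complex_of_real (y ^ Suc k * g y)) (at y)" .
    moreover have "?Q y * complex_of_real (real (Suc k) * y ^ k * g y + y ^ Suc k * g' y)
       + (of_nat b * s / of_real y) * ?Q y * complex_of_real (y ^ Suc k * g y) = ?h y"
      using y by (simp add: field_simps)
    ultimately show "(?G has_vector_derivative ?h y) (at y)" by simp
  next
    show "continuous_on {-R..R} ?G"
      by (intro continuous_intros cont continuous_on_subset[OF gc]) auto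
  qed (use R in auto)
  moreover have "g R = 0" "g (- R) = 0" using supp(1)[of R] supp(1)[of "- R"] R by auto
  ultimately have int: "(?h has_integral 0) {-R..R}" by simp
  have "continuous_on {-R..R} ?h"
    by (intro continuous_intros cont continuous_on_subset[OF gc] continuous_on_subset[OF g(2)]) auto
  then have "set_integrable lborel {-R..R} ?h" by (rule borel_integrable_atLeastAtMost')
  from set_borel_integral_eq_integral(2)[OF this] have "(LINT y:{-R..R}|lborel. ?h y) = 0"
    using int by (simp add: integral_unique)
  moreover have "indicator {-R..R} y *\<^sub>R ?h y = ?h y" for y
    using supp(1)[of y] supp(2)[of y] by (cases "g y = 0"; cases "g' y = 0") (auto simp: indicator_def)
  ultimately show ?thesis by (simp add: set_lebesgue_integral_def)
qed

lemma test_function_measurable: "\<phi> \<in> test_functions U \<Longrightarrow> \<phi> \<in> borel_measurable borel"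
  by (auto simp: test_functions_def intro!: borel_measurable_continuous_onI smooth_imp_continuous_on)

lemma monomial_zeta_integrable:
  assumes \<phi>: "\<phi> \<in> test_functions U" and s: "Re s > 0"
  shows "integrable lborel (\<lambda>z. complex_of_real \<bar>fst z ^ a * snd z ^ b\<bar> powr s * complex_of_real (snd z ^ k * \<phi> z))"
proof -
  obtain R C where R: "R \<ge> 1" "\<And>z. \<phi> z \<noteq> 0 \<Longrightarrow> \<bar>fst z\<bar> < R \<and> \<bar>snd z\<bar> < R" and C: "\<And>z. \<bar>\<phi> z\<bar> \<le> C"
    using test_function_bounds[OF \<phi>] by metis
  obtain M where M: "M \<ge> 1" "\<And>z. \<bar>fst z\<bar> \<le> R \<Longrightarrow> \<bar>snd z\<bar> \<le> R \<Longrightarrow> \<bar>fst z ^ a * snd z ^ b\<bar> \<le> M"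
    by (rule continuous_bounded_on_box[of "\<lambda>z. fst z ^ a * snd z ^ b" R]) (auto intro!: continuous_intros)
  have [measurable]: "\<phi> \<in> borel_measurable borel" by (rule test_function_measurable[OF \<phi>])
  have c: "1 / real (Suc (a + b)) * real a \<le> real (0 + 1)" "1 / real (Suc (a + b)) * real b \<le> real (k + 1)"
    by (auto simp: divide_simps) (simp add: add_increasing2 algebra_simps)?
  show ?thesis
  proof (rule local_zeta_integrable[where R = R and M = M and C = C and p = 0 and q = k and \<alpha> = a and \<beta> = b
        and c = "1 / real (Suc (a + b))"])
    show "(\<lambda>z::real \<times> real. fst z ^ a * snd z ^ b) \<in> borel_measurable borel"
      by (intro borel_measurable_continuous_onI) (auto intro!: continuous_intros)
    show "(\<lambda>z. snd z ^ k * \<phi> z) \<in> borel_measurable borel" 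
      by (intro borel_measurable_times borel_measurable_power borel_measurable_continuous_onI[of snd])
        (auto intro!: continuous_intros)
    show "\<bar>snd (x, y) ^ k * \<phi> (x, y)\<bar> \<le> C * \<bar>x\<bar> ^ 0 * \<bar>y\<bar> ^ k" for x y
      using mult_left_mono[OF C[of "(x, y)"], of "\<bar>y\<bar> ^ k"] by (simp add: abs_mult power_abs mult_ac)
    show "- (1 / real (Suc (a + b))) < Re s" using s by (smt (verit) divide_nonneg_nonneg of_nat_0_le_iff)
  qed (use R M c in \<open>auto simp: abs_mult power_abs intro: less_imp_le\<close>, (metis less_imp_le)+)
qed

lemma monomial_zeta_by_parts:
  assumes \<phi>: "\<phi> \<in> test_functions U" and s: "Re s > 0"
  shows "local_zeta (\<lambda>z. fst z ^ a * snd z ^ b) (\<lambda>z. snd z ^ k * \<phi> z) s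
    = - 1 / (of_nat b * s + of_nat (Suc k))
       * local_zeta (\<lambda>z. fst z ^ a * snd z ^ b) (\<lambda>z. snd z ^ Suc k * partial_y \<phi> z) s"
proof -
  let ?f = "\<lambda>z :: real \<times> real. fst z ^ a * snd z ^ b"
  let ?c = "of_nat b * s + of_nat (Suc k)"
  let ?h1 = "\<lambda>z. complex_of_real \<bar>?f z\<bar> powr s * complex_of_real (snd z ^ k * \<phi> z)"
  let ?h2 = "\<lambda>z. complex_of_real \<bar>?f z\<bar> powr s * complex_of_real (snd z ^ Suc k * partial_y \<phi> z)"
  have \<phi>y: "partial_y \<phi> \<in> test_functions U" by (rule partial_y_test_function[OF \<phi>])
  have h: "integrable lborel ?h1" "integrable lborel ?h2"
    using monomial_zeta_integrable[OF \<phi> s] monomial_zeta_integrable[OF \<phi>y s] by blast+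
  have sm: "smooth_on UNIV \<phi>" "smooth_on UNIV (partial_y \<phi>)" using \<phi> \<phi>y by (auto simp: test_functions_def)
  obtain R1 where R1: "R1 \<ge> 1" "\<And>z. \<phi> z \<noteq> 0 \<Longrightarrow> \<bar>fst z\<bar> < R1 \<and> \<bar>snd z\<bar> < R1"
    using test_function_bounds[OF \<phi>] by metis
  obtain R2 where R2: "R2 \<ge> 1" "\<And>z. partial_y \<phi> z \<noteq> 0 \<Longrightarrow> \<bar>fst z\<bar> < R2 \<and> \<bar>snd z\<bar> < R2"
    using test_function_bounds[OF \<phi>y] by metis
  define R where "R = max R1 R2"
  have inner: "(LINT y|lborel. ?c * ?h1 (x, y) + ?h2 (x, y)) = 0" for x
  proof -
    have d: "((\<lambda>y. \<phi> (x, y)) has_real_derivative partial_y \<phi> (x, y)) (at y)" for y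
    proof -
      have "((\<lambda>y. (x, y)) has_derivative (\<lambda>h. (0, h))) (at y)" by (auto intro!: derivative_eq_intros)
      from has_derivative_compose[OF this smooth_imp_has_derivative[OF sm(1)]]
      have "((\<lambda>y. \<phi> (x, y)) has_derivative (\<lambda>h. frechet_derivative \<phi> (at (x, y)) (0, h))) (at y)" .
      moreover have "frechet_derivative \<phi> (at (x, y)) (0, h) = partial_y \<phi> (x, y) * h" for h
      proof -
        have "linear (frechet_derivative \<phi> (at (x, y)))"
          using smooth_imp_has_derivative[OF sm(1)] has_derivative_linear by blast
        from linear_scale[OF this, of h "(0, 1)"] show ?thesis by (simp add: partial_y_def)
      qed
      ultimately show ?thesis by (simp add: has_field_derivative_def)
    qed
    have "(LINT y|lborel. ?c * (complex_of_real (\<bar>y\<bar> ^ b) powr s * of_real (y ^ k * \<phi> (x, y)))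
        + complex_of_real (\<bar>y\<bar> ^ b) powr s * of_real (y ^ Suc k * partial_y \<phi> (x, y))) = 0"
    proof (rule inner_integration_by_parts[OF s d, where R = R])
      show "continuous_on UNIV (\<lambda>y. partial_y \<phi> (x, y))"
        by (rule continuous_on_compose2[OF smooth_imp_continuous_on[OF sm(2), of UNIV]]) (auto intro!: continuous_intros)
    qed (use R1(1) R1(2)[of "(x, _)"] R2(2)[of "(x, _)"] in \<open>auto simp: R_def less_max_iff_disj\<close>)
    then have "complex_of_real (\<bar>x\<bar> ^ a) powr s * (LINT y|lborel. ?c * (complex_of_real (\<bar>y\<bar> ^ b) powr s * of_real (y ^ k * \<phi> (x, y)))
        + complex_of_real (\<bar>y\<bar> ^ b) powr s * of_real (y ^ Suc k * partial_y \<phi> (x, y))) = 0" by simp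
    moreover have "complex_of_real \<bar>?f (x, y)\<bar> powr s = complex_of_real (\<bar>x\<bar> ^ a) powr s * complex_of_real (\<bar>y\<bar> ^ b) powr s" for y
      using powr_times_real[of "complex_of_real (\<bar>x\<bar> ^ a)" "complex_of_real (\<bar>y\<bar> ^ b)" s]
      by (simp add: abs_mult power_abs)
    then have "(\<lambda>y. ?c * ?h1 (x, y) + ?h2 (x, y)) = (\<lambda>y. complex_of_real (\<bar>x\<bar> ^ a) powr s *
       (?c * (complex_of_real (\<bar>y\<bar> ^ b) powr s * of_real (y ^ k * \<phi> (x, y)))
        + complex_of_real (\<bar>y\<bar> ^ b) powr s * of_real (y ^ Suc k * partial_y \<phi> (x, y))))"
      by (simp only: fst_conv snd_conv ring_distribs mult_ac)
    ultimately show ?thesis by simp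
  qed
  have int: "integrable (lborel \<Otimes>\<^sub>M lborel) (\<lambda>(x, y). ?c * ?h1 (x, y) + ?h2 (x, y))"
    using h by (auto simp: lborel_prod case_prod_beta')
  have "(LINT z|lborel. ?c * ?h1 z + ?h2 z) = (LINT x|lborel. LINT y|lborel. ?c * ?h1 (x, y) + ?h2 (x, y))"
    using lborel_pair.integral_fst'[OF int] by (simp add: lborel_prod case_prod_beta')
  also have "\<dots> = 0" unfolding inner by simp
  also have "(LINT z|lborel. ?c * ?h1 z + ?h2 z) = ?c * (LINT z|lborel. ?h1 z) + (LINT z|lborel. ?h2 z)"
    using h by simp
  finally have "?c * local_zeta ?f (\<lambda>z. snd z ^ k * \<phi> z) s
     = - local_zeta ?f (\<lambda>z. snd z ^ Suc k * partial_y \<phi> z) s"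
    unfolding local_zeta_def by (rule eq_neg_iff_add_eq_0[THEN iffD2])
  moreover have "?c \<noteq> 0"
  proof -
    have "Re ?c = b * Re s + real (Suc k)" by simp
    moreover have "b * Re s + real (Suc k) > 0" using s by (intro add_nonneg_pos) auto
    ultimately show ?thesis by (metis zero_complex.simps(1) less_irrefl)
  qed
  ultimately show ?thesis by (metis (no_types, lifting) divide_minus_left minus_divide_left mult_minus_left nonzero_mult_div_cancel_left times_divide_eq_left mult_1)
qed

text \<open>
  Each step trades one derivative of the test function for one power of \<open>y\<close>, which moves the abscissa
  of convergence in \<open>y\<close> to the left by \<open>1 / b\<close>.
\<close>

lemma monomial_zeta_iterated_by_parts:
  assumes \<phi>: "\<phi> \<in> test_functions U"
  shows "\<exists>\<psi>\<in>test_functions U. \<forall>s. Re s > 0 \<longrightarrow>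
    local_zeta (\<lambda>z. fst z ^ a * snd z ^ b) \<phi> s
    = (\<Prod>j<k. - 1 / (of_nat b * s + of_nat (Suc j))) * local_zeta (\<lambda>z. fst z ^ a * snd z ^ b) (\<lambda>z. snd z ^ k * \<psi> z) s"
proof (induction k)
  case 0
  then show ?case using \<phi> by (intro bexI[of _ \<phi>]) auto
next
  case (Suc k)
  then obtain \<psi> where \<psi>: "\<psi> \<in> test_functions U" and eq: "\<And>s. Re s > 0 \<Longrightarrow>
    local_zeta (\<lambda>z. fst z ^ a * snd z ^ b) \<phi> s
    = (\<Prod>j<k. - 1 / (of_nat b * s + of_nat (Suc j))) * local_zeta (\<lambda>z. fst z ^ a * snd z ^ b) (\<lambda>z. snd z ^ k * \<psi> z) s"
    by blast
  show ?case
    by (intro bexI[of _ "partial_y \<psi>"] partial_y_test_function \<psi> allI impI)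
      (simp only: eq monomial_zeta_by_parts[OF \<psi>] prod.lessThan_Suc mult.assoc)
qed

section \<open>The examples\<close>

text \<open>
  The first coordinate is \<open>w\<close>, the second one \<open>u\<close>. The flag adds the term that is flat in \<open>u\<close>, which
  case (D) requires. Case (C) is obtained by exchanging the coordinates.
\<close>

definition perturbed_monomial :: "nat \<Rightarrow> nat \<Rightarrow> nat \<Rightarrow> bool \<Rightarrow> real \<times> real \<Rightarrow> real" where
  "perturbed_monomial n m k c z = fst z ^ n * snd z ^ m + fst z ^ n * snd z ^ (m - 2) * flat_exp k (fst z)
     + (if c then fst z ^ (n - 2) * snd z ^ m * flat_exp k (snd z) else 0)"

lemma power_split_square:
  fixes x :: real
  assumes "j \<ge> 2"
  shows "x ^ j = x ^ (j - 2) * x\<^sup>2"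
  using assms by (metis le_add_diff_inverse2 power_add)

text \<open>
  The exponents of each variable differ by 2 at most, so that a monomial can be factored out of all
  terms such that only squares and values of \<^const>\<open>flat_exp\<close> remain.
\<close>

lemma abs_perturbed_monomial:
  assumes m: "m \<ge> 2" and c: "c \<longrightarrow> n \<ge> 2"
  shows "\<bar>perturbed_monomial n m k c (w, u)\<bar> = \<bar>w\<bar> ^ n * \<bar>u\<bar> ^ m + \<bar>w\<bar> ^ n * \<bar>u\<bar> ^ (m - 2) * flat_exp k w
     + (if c then \<bar>w\<bar> ^ (n - 2) * \<bar>u\<bar> ^ m * flat_exp k u else 0)"
proof -
  have um: "u ^ m = u ^ (m - 2) * u\<^sup>2" "\<bar>u\<bar> ^ m = \<bar>u\<bar> ^ (m - 2) * u\<^sup>2"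
    using power_split_square[OF m, of u] power_split_square[OF m, of "\<bar>u\<bar>"] by simp_all
  show ?thesis
  proof (cases c)
    case True
    then have n: "n \<ge> 2" using c by simp
    have wn: "w ^ n = w ^ (n - 2) * w\<^sup>2" "\<bar>w\<bar> ^ n = \<bar>w\<bar> ^ (n - 2) * w\<^sup>2"
      using power_split_square[OF n, of w] power_split_square[OF n, of "\<bar>w\<bar>"] by simp_all
    have "perturbed_monomial n m k c (w, u) = w ^ (n - 2) * u ^ (m - 2) * (w\<^sup>2 * u\<^sup>2 + w\<^sup>2 * flat_exp k w + u\<^sup>2 * flat_exp k u)"
      using True unfolding perturbed_monomial_def fst_conv snd_conv um wn by (simp add: algebra_simps)
    moreover have "w\<^sup>2 * u\<^sup>2 + w\<^sup>2 * flat_exp k w + u\<^sup>2 * flat_exp k u \<ge> 0"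
      by (intro add_nonneg_nonneg mult_nonneg_nonneg flat_exp_nonneg zero_le_power2)
    ultimately have "\<bar>perturbed_monomial n m k c (w, u)\<bar> = \<bar>w\<bar> ^ (n - 2) * \<bar>u\<bar> ^ (m - 2) * (w\<^sup>2 * u\<^sup>2 + w\<^sup>2 * flat_exp k w + u\<^sup>2 * flat_exp k u)"
      by (simp only: abs_mult power_abs abs_of_nonneg)
    then show ?thesis using True unfolding um wn by (simp add: algebra_simps)
  next
    case False
    have "perturbed_monomial n m k c (w, u) = w ^ n * u ^ (m - 2) * (u\<^sup>2 + flat_exp k w)"
      using False unfolding perturbed_monomial_def fst_conv snd_conv um by (simp add: algebra_simps)
    moreover have "u\<^sup>2 + flat_exp k w \<ge> 0" by (intro add_nonneg_nonneg flat_exp_nonneg zero_le_power2)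
    ultimately have "\<bar>perturbed_monomial n m k c (w, u)\<bar> = \<bar>w\<bar> ^ n * \<bar>u\<bar> ^ (m - 2) * (u\<^sup>2 + flat_exp k w)"
      by (simp only: abs_mult power_abs abs_of_nonneg)
    then show ?thesis using False unfolding um by (simp add: algebra_simps)
  qed
qed

lemma abs_perturbed_monomial_ge:
  assumes "m \<ge> 2" "c \<longrightarrow> n \<ge> 2"
  shows "\<bar>w\<bar> ^ n * \<bar>u\<bar> ^ m \<le> \<bar>perturbed_monomial n m k c (w, u)\<bar>"
    and "\<bar>w\<bar> ^ n * \<bar>u\<bar> ^ (m - 2) * flat_exp k w \<le> \<bar>perturbed_monomial n m k c (w, u)\<bar>"
proof -
  have "0 \<le> \<bar>w\<bar> ^ n * \<bar>u\<bar> ^ m" "0 \<le> \<bar>w\<bar> ^ n * \<bar>u\<bar> ^ (m - 2) * flat_exp k w"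
    "0 \<le> \<bar>w\<bar> ^ (n - 2) * \<bar>u\<bar> ^ m * flat_exp k u"
    by (auto intro!: mult_nonneg_nonneg flat_exp_nonneg)
  then show "\<bar>w\<bar> ^ n * \<bar>u\<bar> ^ m \<le> \<bar>perturbed_monomial n m k c (w, u)\<bar>"
    "\<bar>w\<bar> ^ n * \<bar>u\<bar> ^ (m - 2) * flat_exp k w \<le> \<bar>perturbed_monomial n m k c (w, u)\<bar>"
    unfolding abs_perturbed_monomial[OF assms] by auto
qed

lemma flat_exp_le_power:
  assumes "x > 0" shows "flat_exp k x \<le> x ^ k"
proof -
  define v where "v = inverse x ^ k"
  have v: "v > 0" using assms by (simp add: v_def)
  have "v \<le> exp v" using exp_ge_add_one_self[of v] by linarith
  then have "exp (- v) \<le> inverse v" using v by (simp add: exp_minus)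
  then show ?thesis using assms by (simp add: flat_exp_def v_def power_inverse)
qed

text \<open>
  Everything follows from \<open>exp (- v) \<le> 1 / v\<close>. The last bound shows that on the cusp region the term
  that is flat in \<open>u\<close> is dominated by the monomial as well.
\<close>

lemma cusp_region_bounds:
  fixes w u :: real
  assumes k: "k \<ge> 3" and w: "0 < w" "w \<le> 1"
    and u: "exp (- (inverse w ^ k) / 2) \<le> u" "u \<le> exp (- (inverse w ^ k) / 4)"
  shows "0 < u" "u \<le> 4 * w" "flat_exp k w \<le> u\<^sup>2" "flat_exp k u \<le> 4 * w\<^sup>2"
proof -
  define v where "v = inverse w ^ k"
  have v: "v > 0" using w by (simp add: v_def)
  show u0: "0 < u" using u(1) exp_gt_zero[of "- (inverse w ^ k) / 2"] by linarith
  have "flat_exp k w = (exp (- v / 2))\<^sup>2"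
    using w by (simp add: flat_exp_def v_def power2_eq_square flip: exp_add)
  also have "\<dots> \<le> u\<^sup>2" using u(1) by (intro power_mono) (auto simp: v_def)
  finally show "flat_exp k w \<le> u\<^sup>2" .
  have "v / 4 \<le> exp (v / 4)" using exp_ge_add_one_self[of "v / 4"] by linarith
  then have "exp (- (v / 4)) \<le> inverse (v / 4)" using v unfolding exp_minus by (intro le_imp_inverse_le) auto
  moreover have "inverse (v / 4) = 4 * w ^ k"
  proof -
    have "inverse v = w ^ k" unfolding v_def by (simp only: power_inverse inverse_inverse_eq)
    moreover have "inverse (v / 4) = 4 * inverse v" using v by (simp add: field_simps)
    ultimately show ?thesis by simp
  qed
  ultimately have "exp (- v / 4) \<le> 4 * w ^ k" by simp
  then have uk: "u \<le> 4 * w ^ k" using u(2) by (simp add: v_def)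
  have "w ^ k \<le> w ^ 1" using k w by (intro power_decreasing) auto
  then show "u \<le> 4 * w" using uk by simp
  have "u \<le> exp 0" using u(2) v order_trans[OF u(2), of "exp 0"] by (simp add: v_def)
  then have u1: "u \<le> 1" by simp
  have "flat_exp k u \<le> u ^ k" by (rule flat_exp_le_power[OF u0])
  also have "\<dots> \<le> u ^ 1" using u0 u1 k by (intro power_decreasing) auto
  also have "\<dots> \<le> 4 * w ^ k" using uk by simp
  also have "w ^ k \<le> w\<^sup>2" using k w by (intro power_decreasing) auto
  finally show "flat_exp k u \<le> 4 * w\<^sup>2" by simp
qed

lemma abs_perturbed_monomial_le_on_cusp:
  fixes w u :: real
  assumes m: "m \<ge> 2" and c: "c \<longrightarrow> n \<ge> 2" and k: "k \<ge> 3" and w: "0 < w" "w \<le> 1"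
    and u: "exp (- (inverse w ^ k) / 2) \<le> u" "u \<le> exp (- (inverse w ^ k) / 4)"
  shows "\<bar>perturbed_monomial n m k c (w, u)\<bar> \<le> 6 * w ^ n * u ^ m"
proof -
  note b = cusp_region_bounds[OF k w u]
  have um: "u ^ m = u ^ (m - 2) * u\<^sup>2" by (rule power_split_square[OF m])
  have 1: "w ^ n * u ^ (m - 2) * flat_exp k w \<le> w ^ n * u ^ m"
    unfolding um using b w by (simp add: mult_left_mono mult.assoc)
  have 2: "(if c then w ^ (n - 2) * u ^ m * flat_exp k u else 0) \<le> 4 * (w ^ n * u ^ m)"
  proof (cases c)
    case True
    then have wn: "w ^ n = w ^ (n - 2) * w\<^sup>2" using c power_split_square by blast
    have "w ^ (n - 2) * u ^ m * flat_exp k u \<le> w ^ (n - 2) * u ^ m * (4 * w\<^sup>2)"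
      using b w by (intro mult_left_mono) auto
    then show ?thesis using True unfolding wn by (simp add: mult_ac)
  qed (use w b in simp)
  show ?thesis
  proof -
    have "\<bar>w\<bar> = w" "\<bar>u\<bar> = u" using w b by auto
    then show ?thesis using 1 2 unfolding abs_perturbed_monomial[OF m c] by linarith
  qed
qed

lemma smooth_monomial: "smooth_on UNIV (\<lambda>z::real \<times> real. fst z ^ i * snd z ^ j)"
  by (intro smooth_mult smooth_power smooth_fst smooth_snd)

section \<open>Membership in the cases\<close>

lemma flat_term_x:
  assumes "k \<ge> 1"
  shows "smooth_on UNIV (\<lambda>z::real \<times> real. fst z ^ i * snd z ^ j * flat_exp k (fst z))"
    "flat_at (0, 0) (\<lambda>z::real \<times> real. fst z ^ i * snd z ^ j * flat_exp k (fst z))"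
proof -
  have e: "smooth_on UNIV (\<lambda>z::real \<times> real. flat_exp k (fst z))" "flat_at (0, 0) (\<lambda>z::real \<times> real. flat_exp k (fst z))"
    using smooth_flat_exp[OF assms] flat_flat_exp[OF assms] by (auto intro: smooth_compose_fst flat_compose_fst)
  show "smooth_on UNIV (\<lambda>z::real \<times> real. fst z ^ i * snd z ^ j * flat_exp k (fst z))"
    by (intro smooth_mult[OF smooth_monomial] e)
  show "flat_at (0, 0) (\<lambda>z::real \<times> real. fst z ^ i * snd z ^ j * flat_exp k (fst z))"
    using flat_mult[OF e smooth_monomial] by (simp add: mult.commute)
qed

lemma flat_term_y:
  assumes "k \<ge> 1"
  shows "smooth_on UNIV (\<lambda>z::real \<times> real. fst z ^ i * snd z ^ j * flat_exp k (snd z))"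
    "flat_at (0, 0) (\<lambda>z::real \<times> real. fst z ^ i * snd z ^ j * flat_exp k (snd z))"
proof -
  have e: "smooth_on UNIV (\<lambda>z::real \<times> real. flat_exp k (snd z))" "flat_at (0, 0) (\<lambda>z::real \<times> real. flat_exp k (snd z))"
    using smooth_flat_exp[OF assms] flat_flat_exp[OF assms] by (auto intro: smooth_compose_snd flat_compose_snd)
  show "smooth_on UNIV (\<lambda>z::real \<times> real. fst z ^ i * snd z ^ j * flat_exp k (snd z))"
    by (intro smooth_mult[OF smooth_monomial] e)
  show "flat_at (0, 0) (\<lambda>z::real \<times> real. fst z ^ i * snd z ^ j * flat_exp k (snd z))"
    using flat_mult[OF e smooth_monomial] by (simp add: mult.commute)
qed

lemma flat_power_flat_exp:
  assumes "k \<ge> 1"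
  shows "smooth_on UNIV (\<lambda>x. x ^ i * flat_exp k x)" "flat_at 0 (\<lambda>x. x ^ i * flat_exp k x)"
  using flat_mult[OF smooth_flat_exp[OF assms] flat_flat_exp[OF assms] smooth_power[OF smooth_ident, of i]]
    smooth_mult[OF smooth_power[OF smooth_ident] smooth_flat_exp[OF assms]]
  by (auto simp: mult.commute)

lemma square_in_open_nhd:
  assumes "open U" "(0, 0) \<in> (U :: (real \<times> real) set)"
  obtains r where "r > 0" "r \<le> 1" "{-r..r} \<times> {-r..r} \<subseteq> U"
proof -
  obtain A B where AB: "open A" "open B" "0 \<in> A" "0 \<in> B" "A \<times> B \<subseteq> U"
    using assms open_prod_elim by (metis mem_Sigma_iff)
  have "open (A \<inter> B)" "0 \<in> A \<inter> B" using AB by auto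
  then obtain d where d: "d > 0" "cball 0 d \<subseteq> A \<inter> B" by (meson open_contains_cball)
  show thesis
  proof (rule that[of "min d 1"])
    have "{- min d 1..min d 1} \<subseteq> A \<inter> B"
      using d(2) by (intro order_trans[OF _ d(2)]) (auto simp: dist_norm)
    then show "{- min d 1..min d 1} \<times> {- min d 1..min d 1} \<subseteq> U" using AB(5) by blast
  qed (use d in auto)
qed

lemma flat_in_x_term:
  assumes k: "k \<ge> 1" and b: "b \<ge> 2" and U: "open U" "(0, 0) \<in> U"
  shows "flat_in_x b U (\<lambda>z. fst z ^ a * snd z ^ (b - 2) * flat_exp k (fst z))"
  unfolding flat_in_x_def
proof (intro conjI)
  obtain r where r: "r > 0" "{-r..r} \<times> {-r..r} \<subseteq> U" using square_in_open_nhd[OF U] by metis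
  then have "(r, r) \<in> U" by auto
  then show "\<exists>z\<in>U. fst z ^ a * snd z ^ (b - 2) * flat_exp k (fst z) \<noteq> 0"
    using r by (intro bexI[of _ "(r, r)"]) (auto simp: flat_exp_def)
  let ?gs = "\<lambda>j x. if j = b - 2 then x ^ a * flat_exp k x else 0"
  have "smooth_on UNIV (?gs j) \<and> flat_at 0 (?gs j)" for j
    using flat_power_flat_exp[OF k, of a] smooth_const[of "0::real"] flat_zero[of "0::real"]
    by (cases "j = b - 2") simp_all
  then have "smooth_on (fst ` U) (?gs j) \<and> flat_at 0 (?gs j)" for j
    using smooth_UNIV_imp_smooth_on[OF _ open_image_fst[OF U(1)]] by blast
  moreover have "fst (x, y) ^ a * snd (x, y) ^ (b - 2) * flat_exp k (fst (x, y)) = (\<Sum>j<b. y ^ j * ?gs j x)" for x y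
  proof -
    have "(\<Sum>j<b. y ^ j * ?gs j x) = (\<Sum>j<b. if j = b - 2 then y ^ j * (x ^ a * flat_exp k x) else 0)"
      by (intro sum.cong) auto
    then show ?thesis using b by (simp add: mult_ac)
  qed
  ultimately show "\<exists>gs. (\<forall>j<b. smooth_on (fst ` U) (gs j) \<and> flat_at 0 (gs j)) \<and>
     (\<forall>(x, y)\<in>U. fst (x, y) ^ a * snd (x, y) ^ (b - 2) * flat_exp k (fst (x, y)) = (\<Sum>j<b. y ^ j * gs j x))"
    by (intro exI[of _ ?gs]) auto
  show "smooth_on U (\<lambda>z. fst z ^ a * snd z ^ (b - 2) * flat_exp k (fst z))"
    by (rule smooth_UNIV_imp_smooth_on[OF flat_term_x(1)[OF k] U(1)])
  show "flat_at (0, 0) (\<lambda>z::real \<times> real. fst z ^ a * snd z ^ (b - 2) * flat_exp k (fst z))"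
    by (rule flat_term_x(2)[OF k])
qed

lemma flat_in_y_term:
  assumes k: "k \<ge> 1" and a: "a \<ge> 2" and U: "open U" "(0, 0) \<in> U"
  shows "flat_in_y a U (\<lambda>z. fst z ^ (a - 2) * snd z ^ b * flat_exp k (snd z))"
  unfolding flat_in_y_def
proof (intro conjI)
  obtain r where r: "r > 0" "{-r..r} \<times> {-r..r} \<subseteq> U" using square_in_open_nhd[OF U] by metis
  then have "(r, r) \<in> U" by auto
  then show "\<exists>z\<in>U. fst z ^ (a - 2) * snd z ^ b * flat_exp k (snd z) \<noteq> 0"
    using r by (intro bexI[of _ "(r, r)"]) (auto simp: flat_exp_def)
  let ?hs = "\<lambda>j y. if j = a - 2 then y ^ b * flat_exp k y else 0"
  have "smooth_on UNIV (?hs j) \<and> flat_at 0 (?hs j)" for j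
    using flat_power_flat_exp[OF k, of b] smooth_const[of "0::real"] flat_zero[of "0::real"]
    by (cases "j = a - 2") simp_all
  then have "smooth_on (snd ` U) (?hs j) \<and> flat_at 0 (?hs j)" for j
    using smooth_UNIV_imp_smooth_on[OF _ open_image_snd[OF U(1)]] by blast
  moreover have "fst (x, y) ^ (a - 2) * snd (x, y) ^ b * flat_exp k (snd (x, y)) = (\<Sum>j<a. x ^ j * ?hs j y)" for x y
  proof -
    have "(\<Sum>j<a. x ^ j * ?hs j y) = (\<Sum>j<a. if j = a - 2 then x ^ j * (y ^ b * flat_exp k y) else 0)"
      by (intro sum.cong) auto
    then show ?thesis using a by (simp add: mult_ac)
  qed
  ultimately show "\<exists>hs. (\<forall>j<a. smooth_on (snd ` U) (hs j) \<and> flat_at 0 (hs j)) \<and>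
     (\<forall>(x, y)\<in>U. fst (x, y) ^ (a - 2) * snd (x, y) ^ b * flat_exp k (snd (x, y)) = (\<Sum>j<a. x ^ j * hs j y))"
    by (intro exI[of _ ?hs]) auto
  show "smooth_on U (\<lambda>z. fst z ^ (a - 2) * snd z ^ b * flat_exp k (snd z))"
    by (rule smooth_UNIV_imp_smooth_on[OF flat_term_y(1)[OF k] U(1)])
  show "flat_at (0, 0) (\<lambda>z::real \<times> real. fst z ^ (a - 2) * snd z ^ b * flat_exp k (snd z))"
    by (rule flat_term_y(2)[OF k])
qed

lemma singular_at_origin_monomial_plus_flat:
  assumes ab: "0 < a" "2 \<le> b" and g: "smooth_on UNIV g" "flat_at (0, 0) g" and U: "open U"
    and f: "\<And>z. f z = fst z ^ a * snd z ^ b + g z"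
  shows "singular_at_origin U f"
proof -
  have feq: "f = (\<lambda>z. fst z ^ a * snd z ^ b + g z)" using f by auto
  have "smooth_on U f"
    unfolding feq by (rule smooth_UNIV_imp_smooth_on[OF smooth_add[OF smooth_monomial g(1)] U])
  moreover have "f (0, 0) = 0" using flat_imp_zero[OF g(2)] ab by (simp add: f)
  moreover have "((\<lambda>z. fst z ^ a * snd z ^ b) has_derivative (\<lambda>_. 0)) (at (0::real, 0::real))"
    using has_derivative_mult[OF has_derivative_power[OF has_derivative_fst[OF has_derivative_ident], of a "(0, 0)" UNIV]
        has_derivative_power[OF has_derivative_snd[OF has_derivative_ident], of b "(0, 0)" UNIV]] ab
    by (simp add: power_0_left)
  from has_derivative_add[OF this flat_imp_has_derivative_zero[OF g]]
  have "(f has_derivative (\<lambda>_. 0)) (at (0, 0))" unfolding feq by simp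
  ultimately show ?thesis unfolding singular_at_origin_def by simp
qed

lemma case_B_perturbed_monomial:
  assumes ab: "0 < a" "2 \<le> b" and k: "k \<ge> 1" and U: "open U" "(0, 0) \<in> U"
  shows "case_B a b U (perturbed_monomial a b k False)"
  unfolding case_B_def
proof (intro conjI exI)
  let ?g = "\<lambda>z. fst z ^ a * snd z ^ (b - 2) * flat_exp k (fst z)"
  show "singular_at_origin U (perturbed_monomial a b k False)"
    by (rule singular_at_origin_monomial_plus_flat[OF ab flat_term_x[OF k, of a "b - 2"] U(1)]) (simp add: perturbed_monomial_def)
  show "flat_in_x b U ?g" by (rule flat_in_x_term[OF k ab(2) U])
  show "smooth_on U (\<lambda>_. 1 :: real)" by (rule smooth_UNIV_imp_smooth_on[OF smooth_const U(1)])
qed (auto simp: perturbed_monomial_def)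

lemma case_D_perturbed_monomial:
  assumes ab: "2 \<le> a" "2 \<le> b" and k: "k \<ge> 1" and U: "open U" "(0, 0) \<in> U"
  shows "case_D a b U (perturbed_monomial a b k True)"
  unfolding case_D_def
proof (intro conjI exI)
  let ?g = "\<lambda>z. fst z ^ a * snd z ^ (b - 2) * flat_exp k (fst z)"
  let ?h = "\<lambda>z. fst z ^ (a - 2) * snd z ^ b * flat_exp k (snd z)"
  have "smooth_on UNIV (\<lambda>z. ?g z + ?h z)" "flat_at (0, 0) (\<lambda>z. ?g z + ?h z)"
    by (intro smooth_add flat_add flat_term_x[OF k] flat_term_y[OF k])+
  then show "singular_at_origin U (perturbed_monomial a b k True)"
    by (rule singular_at_origin_monomial_plus_flat[where a = a and b = b, rotated 2])
      (use ab U in \<open>simp_all add: perturbed_monomial_def\<close>)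
  show "flat_in_x b U ?g" by (rule flat_in_x_term[OF k ab(2) U])
  show "flat_in_y a U ?h" by (rule flat_in_y_term[OF k ab(1) U])
  show "smooth_on U (\<lambda>_. 1 :: real)" by (rule smooth_UNIV_imp_smooth_on[OF smooth_const U(1)])
qed (auto simp: perturbed_monomial_def)

lemma case_C_perturbed_monomial:
  assumes ab: "2 \<le> a" "2 \<le> b" and k: "k \<ge> 1" and U: "open U" "(0, 0) \<in> U"
  shows "case_C a b U (\<lambda>z. perturbed_monomial b a k False (snd z, fst z))"
  unfolding case_C_def
proof (intro conjI exI)
  let ?h = "\<lambda>z. fst z ^ (a - 2) * snd z ^ b * flat_exp k (snd z)"
  show "singular_at_origin U (\<lambda>z. perturbed_monomial b a k False (snd z, fst z))"
    by (rule singular_at_origin_monomial_plus_flat[OF _ ab(2) flat_term_y[OF k, of "a - 2" b] U(1), where a = a])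
      (use ab in \<open>simp_all add: perturbed_monomial_def mult_ac\<close>)
  show "flat_in_y a U ?h" by (rule flat_in_y_term[OF k ab(1) U])
  show "smooth_on U (\<lambda>_. 1 :: real)" by (rule smooth_UNIV_imp_smooth_on[OF smooth_const U(1)])
qed (auto simp: perturbed_monomial_def)

section \<open>The critical exponents\<close>

lemma m0_eqI:
  assumes "m > 0"
    and "\<And>\<phi>. \<phi> \<in> test_functions U \<Longrightarrow> zeta_continues f \<phi> (1 / m)"
    and "\<phi> \<in> test_functions U" "\<And>\<rho>. \<rho> > 1 / m \<Longrightarrow> \<not> zeta_continues f \<phi> \<rho>"
  shows "m0 U f = ennreal (1 / m)"
proof (rule antisym)
  have "m0_at f \<phi> \<le> ennreal (1 / m)"
    unfolding m0_at_def using assms(4) by (intro Sup_least) (force intro!: ennreal_leI simp: not_less[symmetric])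
  then show "m0 U f \<le> ennreal (1 / m)"
    unfolding m0_def using assms(3) by (meson Inf_lower2 imageI)
  show "ennreal (1 / m) \<le> m0 U f"
    unfolding m0_def m0_at_def using assms(1,2) by (intro Inf_greatest) (auto intro!: Sup_upper)
qed

lemma smooth_perturbed_monomial:
  assumes "k \<ge> 1"
  shows "smooth_on UNIV (perturbed_monomial n m k c)"
proof -
  note xy = flat_term_x(1)[OF assms, of n "m - 2"] flat_term_y(1)[OF assms, of "n - 2" m]
  show ?thesis
    unfolding perturbed_monomial_def[abs_def]
    using smooth_add[OF smooth_monomial[of n m] xy(1)]
      smooth_add[OF smooth_add[OF smooth_monomial[of n m] xy(1)] xy(2)] by (cases c) simp_all
qed

lemma continuous_on_perturbed_monomial: "k \<ge> 1 \<Longrightarrow> continuous_on A (perturbed_monomial n m k c)"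
  by (rule smooth_imp_continuous_on[OF smooth_perturbed_monomial])

lemma zeta_continues_perturbed_monomial:
  assumes ab: "0 < a" "a < b" "2 \<le> b" and c: "c \<longrightarrow> a \<ge> 2" and k: "k \<ge> 1" and \<phi>: "\<phi> \<in> test_functions U"
  shows "zeta_continues (perturbed_monomial a b k c) \<phi> (1 / b)"
proof -
  let ?f = "perturbed_monomial a b k c"
  obtain R C where R: "R \<ge> 1" "\<And>z. \<phi> z \<noteq> 0 \<Longrightarrow> \<bar>fst z\<bar> < R \<and> \<bar>snd z\<bar> < R" and C: "\<And>z. \<bar>\<phi> z\<bar> \<le> C"
    using test_function_bounds[OF \<phi>] by metis
  obtain M where M: "M \<ge> 1" "\<And>z. \<bar>fst z\<bar> \<le> R \<Longrightarrow> \<bar>snd z\<bar> \<le> R \<Longrightarrow> \<bar>?f z\<bar> \<le> M"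
    using continuous_bounded_on_box[OF continuous_on_perturbed_monomial[OF k]] by blast
  have "local_zeta ?f \<phi> holomorphic_on {s. Re s > - (1 / b)}"
  proof (rule local_zeta_holomorphic[where R = R and M = M and C = C and p = 0 and q = 0 and \<alpha> = a and \<beta> = b])
    show "?f \<in> borel_measurable borel" by (intro borel_measurable_continuous_onI continuous_on_perturbed_monomial k)
    show "\<phi> \<in> borel_measurable borel" by (rule test_function_measurable[OF \<phi>])
    show "\<bar>fst z\<bar> \<le> R \<and> \<bar>snd z\<bar> \<le> R \<and> \<bar>?f z\<bar> \<le> M" if "\<phi> z \<noteq> 0" for z
      using R(2)[OF that] M(2)[of z] by simp
  qed (use R(1) M(1) C ab abs_perturbed_monomial_ge(1)[OF ab(3) c] in auto)
  then have "local_zeta ?f \<phi> meromorphic_on {s. Re s > - (1 / b)}"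
    using open_halfspace_Re_gt[of "- (1 / b)"] by (simp add: analytic_on_open analytic_on_imp_meromorphic_on)
  then show ?thesis
    unfolding zeta_continues_def
    using open_halfspace_Re_gt[of "- (1 / b)"] convex_connected[OF convex_halfspace_Re_gt[of "- (1 / b)"]] by blast
qed

text \<open>
  Both contributions are meromorphic for \<open>Re s > - 1 / a\<close>: the comparison integral is even
  holomorphic, and the factors from \<open>b\<close> integrations by parts carry all poles of the monomial there. The
  remaining integrand has the additional factor \<open>y ^ b\<close>, enough for \<open>Re s > - 1\<close>.
\<close>

lemma zeta_continues_swapped_perturbed_monomial:
  assumes ab: "2 \<le> a" "a < b" and k: "k \<ge> b" and \<phi>: "\<phi> \<in> test_functions U"
  shows "zeta_continues (\<lambda>z. perturbed_monomial b a k False (snd z, fst z)) \<phi> (1 / a)"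
proof -
  let ?f = "\<lambda>z. perturbed_monomial b a k False (snd z, fst z)"
  let ?mono = "\<lambda>z::real \<times> real. fst z ^ a * snd z ^ b"
  let ?D = "{s. Re s > - (1 / real a)}"
  have k1: "k \<ge> 1" using k ab by simp
  have fc: "continuous_on UNIV ?f"
    by (rule continuous_on_compose2[OF continuous_on_perturbed_monomial[OF k1, of UNIV]]) (auto intro!: continuous_intros)
  have f0c: "continuous_on UNIV ?mono" by (rule smooth_imp_continuous_on[OF smooth_monomial])
  have meas: "?f \<in> borel_measurable borel" "?mono \<in> borel_measurable borel" "\<phi> \<in> borel_measurable borel"
    using fc f0c test_function_measurable[OF \<phi>] by (auto intro: borel_measurable_continuous_onI)
  obtain R C where R: "R \<ge> 1" "\<And>z. \<phi> z \<noteq> 0 \<Longrightarrow> \<bar>fst z\<bar> < R \<and> \<bar>snd z\<bar> < R" and C: "\<And>z. \<bar>\<phi> z\<bar> \<le> C"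
    using test_function_bounds[OF \<phi>] by metis
  obtain M where M: "M \<ge> 1" "\<And>z. \<bar>fst z\<bar> \<le> R \<Longrightarrow> \<bar>snd z\<bar> \<le> R \<Longrightarrow> \<bar>?f z\<bar> \<le> M"
    using continuous_bounded_on_box[OF fc] by blast
  have supp: "\<bar>fst z\<bar> \<le> R \<and> \<bar>snd z\<bar> \<le> R \<and> \<bar>?f z\<bar> \<le> M" if "\<phi> z \<noteq> 0" for z
    using R(2)[OF that] M(2)[of z] by simp
  define Dif where "Dif = (\<lambda>s. LINT z|lborel. (complex_of_real \<bar>?f z\<bar> powr s - complex_of_real \<bar>?mono z\<bar> powr s) * complex_of_real (\<phi> z))"
  have Dif: "Dif holomorphic_on ?D"
    unfolding Dif_def
  proof (rule local_zeta_difference_holomorphic[OF meas _ k supp R(1) M(1) C])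
    show "\<bar>?f (x, y)\<bar> = \<bar>x\<bar> ^ a * \<bar>y\<bar> ^ b * (1 + flat_exp k y / x\<^sup>2)" if "x \<noteq> 0" for x y
    proof -
      have "\<bar>x\<bar> ^ a = \<bar>x\<bar> ^ (a - 2) * x\<^sup>2" using power_split_square[OF ab(1), of "\<bar>x\<bar>"] by simp
      then show ?thesis using that ab by (simp add: abs_perturbed_monomial field_simps)
    qed
  qed (use ab in \<open>auto simp: abs_mult power_abs\<close>)
  obtain \<psi> where \<psi>: "\<psi> \<in> test_functions U" and parts: "\<And>s. Re s > 0 \<Longrightarrow> local_zeta ?mono \<phi> s
    = (\<Prod>j<b. - 1 / (of_nat b * s + of_nat (Suc j))) * local_zeta ?mono (\<lambda>z. snd z ^ b * \<psi> z) s"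
    using monomial_zeta_iterated_by_parts[OF \<phi>, of a b b] by blast
  obtain R' C' where R': "R' \<ge> 1" "\<And>z. \<psi> z \<noteq> 0 \<Longrightarrow> \<bar>fst z\<bar> < R' \<and> \<bar>snd z\<bar> < R'" and C': "\<And>z. \<bar>\<psi> z\<bar> \<le> C'"
    using test_function_bounds[OF \<psi>] by metis
  obtain M' where M': "M' \<ge> 1" "\<And>z. \<bar>fst z\<bar> \<le> R' \<Longrightarrow> \<bar>snd z\<bar> \<le> R' \<Longrightarrow> \<bar>?mono z\<bar> \<le> M'"
    using continuous_bounded_on_box[OF f0c] by blast
  define L where "L = local_zeta ?mono (\<lambda>z. snd z ^ b * \<psi> z)"
  have L: "L holomorphic_on ?D"
    unfolding L_def
  proof (rule local_zeta_holomorphic[where R = R' and M = M' and C = C' and p = 0 and q = b and \<alpha> = a and \<beta> = b])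
    show "(\<lambda>z. snd z ^ b * \<psi> z) \<in> borel_measurable borel"
      by (intro borel_measurable_continuous_onI continuous_intros smooth_imp_continuous_on)
        (use \<psi> in \<open>auto simp: test_functions_def\<close>)
    show "\<bar>fst z\<bar> \<le> R' \<and> \<bar>snd z\<bar> \<le> R' \<and> \<bar>?mono z\<bar> \<le> M'" if "snd z ^ b * \<psi> z \<noteq> 0" for z
      using R'(2)[of z] M'(2)[of z] that by simp
    show "\<bar>snd (x, y) ^ b * \<psi> (x, y)\<bar> \<le> C' * \<bar>x\<bar> ^ 0 * \<bar>y\<bar> ^ b" for x y
      using mult_left_mono[OF C'[of "(x, y)"], of "\<bar>y\<bar> ^ b"] by (simp add: abs_mult power_abs mult_ac)
    show "1 / real a * real b \<le> real (b + 1)"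
      using mult_right_mono[of "1 / real a" 1 "real b"] ab by simp
  qed (use R'(1) M'(1) meas ab in \<open>auto simp: abs_mult power_abs\<close>)
  define F where "F = (\<lambda>s. (\<Prod>j<b. - 1 / (of_nat b * s + of_nat (Suc j))) * L s + Dif s)"
  have open_D: "open ?D" by (rule open_halfspace_Re_gt)
  have "L meromorphic_on ?D" "Dif meromorphic_on ?D"
    using L Dif open_D by (simp_all add: analytic_on_open analytic_on_imp_meromorphic_on)
  then have "F meromorphic_on ?D" unfolding F_def by (intro meromorphic_intros)
  moreover have "F s = local_zeta ?f \<phi> s" if s: "Re s > 0" for s
  proof -
    let ?h = "\<lambda>f z. complex_of_real \<bar>f z\<bar> powr s * complex_of_real (\<phi> z)"
    have "integrable lborel (?h ?mono)"
      using monomial_zeta_integrable[OF \<phi> s, of a b 0] by simp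
    moreover have "integrable lborel (?h ?f)"
    proof (rule local_zeta_integrable[OF meas(1,3) supp _ M(1), where C = C and p = 0 and q = 0 and \<alpha> = a and \<beta> = b and c = "1 / b"])
      show "\<bar>x\<bar> ^ a * \<bar>y\<bar> ^ b \<le> \<bar>?f (x, y)\<bar>" for x y
        using abs_perturbed_monomial_ge(1)[of a False b y x k] ab by (simp add: mult.commute)
      show "- (1 / real b) < Re s" using s ab by (smt (verit) divide_nonneg_nonneg of_nat_0_le_iff)
    qed (use R(1) C ab in auto)
    ultimately have "Dif s = local_zeta ?f \<phi> s - local_zeta ?mono \<phi> s"
      unfolding Dif_def local_zeta_def by (simp add: left_diff_distrib)
    then show ?thesis using parts[OF s] by (simp add: F_def L_def)
  qed
  moreover have "connected ?D" by (intro convex_connected convex_halfspace_Re_gt)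
  ultimately show ?thesis unfolding zeta_continues_def using open_D by blast
qed

lemma local_zeta_swap:
  assumes [measurable]: "f \<in> borel_measurable borel" "\<phi> \<in> borel_measurable borel"
  shows "local_zeta (\<lambda>z. f (snd z, fst z)) (\<lambda>z. \<phi> (snd z, fst z)) = local_zeta f \<phi>"
proof
  fix s
  let ?h = "\<lambda>z. complex_of_real \<bar>f z\<bar> powr s * complex_of_real (\<phi> z)"
  have "?h \<in> borel_measurable borel" by measurable
  then have "?h \<in> borel_measurable (lborel \<Otimes>\<^sub>M lborel)" by (simp add: lborel_prod)
  from lborel_pair.integral_product_swap[OF this]
  show "local_zeta (\<lambda>z. f (snd z, fst z)) (\<lambda>z. \<phi> (snd z, fst z)) s = local_zeta f \<phi> s"
    by (simp add: local_zeta_def lborel_prod case_prod_beta')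
qed

definition weighted_bump :: "nat \<Rightarrow> real \<Rightarrow> real \<times> real \<Rightarrow> real" where
  "weighted_bump n r z = fst z ^ (2 * n) * bump r (fst z) * bump r (snd z)"

lemma bump_le_1: "bump r x \<le> 1"
  unfolding bump_def flat_germ_def by (intro mult_le_one) auto

lemma bump_ge:
  assumes "r > 0" "\<bar>x\<bar> \<le> r / 2"
  shows "exp (- 4 / r) \<le> bump r x"
proof -
  have *: "exp (- 2 / r) \<le> flat_germ 1 1 y" if "y \<ge> r / 2" for y
  proof -
    have "inverse y \<le> inverse (r / 2)" using that assms by (intro le_imp_inverse_le) auto
    then show ?thesis using that assms by (simp add: flat_germ_def)
  qed
  have "exp (- 4 / r) = exp (- 2 / r) * exp (- 2 / r)" by (simp flip: exp_add)
  also have "\<dots> \<le> bump r x"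
    unfolding bump_def using assms by (intro mult_mono *) (auto simp: flat_germ_def abs_le_iff)
  finally show ?thesis .
qed

lemma smooth_weighted_bump: "smooth_on UNIV (weighted_bump n r)"
  unfolding weighted_bump_def[abs_def]
  by (intro smooth_mult smooth_power smooth_fst smooth_compose_fst smooth_compose_snd smooth_bump)

lemma supported_on_square_test_function:
  fixes \<phi> :: "real \<times> real \<Rightarrow> real"
  assumes "smooth_on UNIV \<phi>" and "\<And>z. \<phi> z \<noteq> 0 \<Longrightarrow> \<bar>fst z\<bar> \<le> r \<and> \<bar>snd z\<bar> \<le> r"
    and U: "{-r..r} \<times> {-r..r} \<subseteq> U"
  shows "\<phi> \<in> test_functions U"
proof -
  let ?S = "{-r..r} \<times> {-r..r}"
  have S: "compact ?S" by (intro compact_Times) auto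
  have "z \<in> ?S" if "\<phi> z \<noteq> 0" for z using assms(2)[OF that] by (cases z) (auto simp: abs_le_iff)
  then have sub: "closure {z. \<phi> z \<noteq> 0} \<subseteq> ?S"
    by (intro closure_minimal compact_imp_closed[OF S]) auto
  have "compact (closure {z. \<phi> z \<noteq> 0})"
    using compact_Int_closed[OF S closed_closure[of "{z. \<phi> z \<noteq> 0}"]] sub by (simp add: Int_absorb1)
  then show ?thesis using assms(1) sub U by (auto simp: test_functions_def)
qed

text \<open>
  For \<open>w < r / 8\<close> the cusp region lies in the square of half-width \<open>r / 2\<close>, where the bump is bounded
  below.
\<close>

lemma perturbed_monomial_not_continuable:
  assumes m: "m \<ge> 2" and n: "n \<ge> 1" and c: "c \<longrightarrow> n \<ge> 2" and k: "k = 2 * n + 1"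
    and r: "0 < r" "r \<le> 1" and \<rho>: "\<rho> > 1 / m"
  shows "\<not> zeta_continues (perturbed_monomial n m k c) (weighted_bump n r) \<rho>"
proof -
  have k1: "k \<ge> 1" "k \<ge> 3" using k n by auto
  obtain M where M: "M \<ge> 1" "\<And>z. \<bar>fst z\<bar> \<le> 1 \<Longrightarrow> \<bar>snd z\<bar> \<le> 1 \<Longrightarrow> \<bar>perturbed_monomial n m k c z\<bar> \<le> M"
    using continuous_bounded_on_box[OF continuous_on_perturbed_monomial[OF k1(1)]] by blast
  define \<delta> where "\<delta> = r / 8"
  show ?thesis
  proof (rule flat_perturbation_not_continuable[where R = 1 and M = M and C = 1 and A = 6
        and \<kappa> = "exp (- 4 / r) * exp (- 4 / r)" and \<delta> = \<delta> and k = k and n = n and m = m])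
    show "perturbed_monomial n m k c \<in> borel_measurable borel"
      by (intro borel_measurable_continuous_onI continuous_on_perturbed_monomial k1)
    show "weighted_bump n r \<in> borel_measurable borel"
      by (intro borel_measurable_continuous_onI smooth_imp_continuous_on smooth_weighted_bump)
    show "\<bar>fst z\<bar> \<le> 1 \<and> \<bar>snd z\<bar> \<le> 1 \<and> \<bar>perturbed_monomial n m k c z\<bar> \<le> M" if "weighted_bump n r z \<noteq> 0" for z
    proof -
      have "\<bar>fst z\<bar> < r" "\<bar>snd z\<bar> < r" using that by (auto simp: weighted_bump_def bump_pos_iff)
      then show ?thesis using r M(2)[of z] by simp
    qed
    show "0 \<le> weighted_bump n r z" for z
      by (simp add: weighted_bump_def bump_nonneg)
    show "weighted_bump n r (w, u) \<le> 1 * \<bar>w\<bar> ^ (2 * n)" for w u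
      using mult_left_le[OF mult_le_one[OF bump_le_1 bump_nonneg bump_le_1], of "w ^ (2 * n)" r w r u]
      by (simp add: weighted_bump_def mult.assoc power_even_abs)
    fix w u :: real
    assume wu: "0 < w" "w < \<delta>" "exp (- (inverse w ^ k) / 2) \<le> u" "u \<le> exp (- (inverse w ^ k) / 4)"
    have w1: "w \<le> 1" using wu r by (simp add: \<delta>_def)
    note b = cusp_region_bounds[OF k1(2) wu(1) w1 wu(3,4)]
    have "exp (- 4 / r) * exp (- 4 / r) \<le> bump r w * bump r u"
      using b wu r by (intro mult_mono bump_ge bump_nonneg) (auto simp: \<delta>_def)
    from mult_left_mono[OF this, of "w ^ (2 * n)"]
    show "\<bar>perturbed_monomial n m k c (w, u)\<bar> \<le> 6 * w ^ n * u ^ m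
      \<and> exp (- 4 / r) * exp (- 4 / r) * w ^ (2 * n) \<le> weighted_bump n r (w, u)"
      using abs_perturbed_monomial_le_on_cusp[OF m c k1(2) wu(1) w1 wu(3,4)] wu(1) by (simp add: weighted_bump_def mult_ac)
  qed (use m k r \<rho> M(1) abs_perturbed_monomial_ge[OF m c] in \<open>auto simp: \<delta>_def\<close>)
qed

lemma m0_perturbed_monomial:
  assumes ab: "0 < a" "a < b" "2 \<le> b" and c: "c \<longrightarrow> a \<ge> 2" and U: "open U" "(0, 0) \<in> U"
  shows "m0 U (perturbed_monomial a b (2 * a + 1) c) = ennreal (1 / b)"
proof -
  obtain r where r: "r > 0" "r \<le> 1" "{-r..r} \<times> {-r..r} \<subseteq> U" using square_in_open_nhd[OF U] .
  show ?thesis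
  proof (rule m0_eqI)
    show "weighted_bump a r \<in> test_functions U"
      by (rule supported_on_square_test_function[OF smooth_weighted_bump _ r(3)])
        (auto simp: weighted_bump_def bump_pos_iff)
  qed (use ab c r zeta_continues_perturbed_monomial perturbed_monomial_not_continuable in auto)
qed

lemma m0_swapped_perturbed_monomial:
  assumes ab: "2 \<le> a" "a < b" and U: "open U" "(0, 0) \<in> U"
  shows "m0 U (\<lambda>z. perturbed_monomial b a (2 * b + 1) False (snd z, fst z)) = ennreal (1 / a)"
proof -
  let ?f = "perturbed_monomial b a (2 * b + 1) False"
  obtain r where r: "r > 0" "r \<le> 1" "{-r..r} \<times> {-r..r} \<subseteq> U" using square_in_open_nhd[OF U] .
  let ?\<phi> = "weighted_bump b r"
  show ?thesis
  proof (rule m0_eqI)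
    have "smooth_on UNIV (\<lambda>z. ?\<phi> (snd z, fst z))"
      unfolding weighted_bump_def fst_conv snd_conv
      by (intro smooth_mult smooth_power smooth_snd smooth_compose_fst smooth_compose_snd smooth_bump)
    then show "(\<lambda>z. ?\<phi> (snd z, fst z)) \<in> test_functions U"
      by (rule supported_on_square_test_function[OF _ _ r(3)]) (auto simp: weighted_bump_def bump_pos_iff)
    fix \<rho> :: real assume \<rho>: "\<rho> > 1 / a"
    have "local_zeta (\<lambda>z. ?f (snd z, fst z)) (\<lambda>z. ?\<phi> (snd z, fst z)) = local_zeta ?f ?\<phi>"
      by (intro local_zeta_swap borel_measurable_continuous_onI continuous_on_perturbed_monomial
          smooth_imp_continuous_on smooth_weighted_bump) simp
    then show "\<not> zeta_continues (\<lambda>z. ?f (snd z, fst z)) (\<lambda>z. ?\<phi> (snd z, fst z)) \<rho>"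
      using perturbed_monomial_not_continuable[of a b False "2 * b + 1" r \<rho>] ab r \<rho> by (simp add: zeta_continues_def)
  qed (use ab zeta_continues_swapped_perturbed_monomial in auto)
qed

theorem theorem3p9:
  fixes a b :: nat
  assumes "0 < a" and "0 < b" and "a < b"
  shows "(b \<ge> 2 \<longrightarrow>
            (\<exists>f. for_small_nhds (\<lambda>U. case_B a b U f \<and> m0 U f = ennreal (1 / real b)))) \<and>
         (a \<ge> 2 \<longrightarrow>
            (\<exists>f. for_small_nhds (\<lambda>U. case_C a b U f \<and> m0 U f = ennreal (1 / real a)))) \<and>
         (a \<ge> 2 \<longrightarrow>
            (\<exists>f. for_small_nhds (\<lambda>U. case_D a b U f \<and> m0 U f = ennreal (1 / real b))))"
proof (intro conjI impI)
  have all: "for_small_nhds P" if "\<And>U. open U \<Longrightarrow> (0, 0) \<in> U \<Longrightarrow> P U" for P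
    unfolding for_small_nhds_def using that by (intro exI[of _ UNIV]) auto
  show "\<exists>f. for_small_nhds (\<lambda>U. case_B a b U f \<and> m0 U f = ennreal (1 / real b))" if "b \<ge> 2"
    using assms that by (intro exI[of _ "perturbed_monomial a b (2 * a + 1) False"] all conjI case_B_perturbed_monomial m0_perturbed_monomial) auto
  show "\<exists>f. for_small_nhds (\<lambda>U. case_C a b U f \<and> m0 U f = ennreal (1 / real a))" if "a \<ge> 2"
    using assms that
    by (intro exI[of _ "\<lambda>z. perturbed_monomial b a (2 * b + 1) False (snd z, fst z)"] all conjI case_C_perturbed_monomial m0_swapped_perturbed_monomial) auto
  show "\<exists>f. for_small_nhds (\<lambda>U. case_D a b U f \<and> m0 U f = ennreal (1 / real b))" if "a \<ge> 2"
    using assms that by (intro exI[of _ "perturbed_monomial a b (2 * a + 1) True"] all conjI case_D_perturbed_monomial m0_perturbed_monomial) auto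
qed

end
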